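(* Let $N$ be an even-plane matroid. Then every claw-free, $N$-free matroid $M$ satisfies $\chi(M)\le f(\omega(M))$, where $f(k)=(k+2)2^{k+1}+k(\dim(N)+4)$.
   Context: A matroid is a pair $M=(E,G)$ where $G$ is the set of nonzero vectors of a finite-dimensional $\mathbb F_2$-vector space $V(G)=G\cup\{0\}\cong\mathbb F_2^n$ and $E\subseteq G$; $n=\dim(M)$. Isomorphism: a linear isomorphism of ambient spaces mapping ground sets onto each other. A flat of $G$ is a set $F\subseteq G$ with $F\cup\{0\}$ a subspace; its dimension is that of the subspace; planes are $3$-dimensional flats. $M|F=(E\cap F,F)$; $M$ is $N$-free if no $M|F$ is isomorphic to $N$. A claw is $(B,G)$ with $\dim G=3$, $B$ a basis; claw-free means claw-free as an induced restriction. $M$ is even-plane if $|E\cap P|$ is even for every plane $P$ of $G$. $\omega(M)$ is the largest dimension of a flat contained in $E$ ($0$ if $E=\varnothing$); $M^c=(G\setminus E,G)$; $\chi(M)=\dim(M)-\omega(M^c)$. *)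

theory Defs
  imports Complex_Main "HOL-Library.Z2"
begin

text \<open>
  A matroid is a pair of a set E and the set G of nonzero vectors of a finite-dimensional
  vector space over the two-element field \<^typ>\<open>bit\<close>. That vector space is a subspace of an
  arbitrary (not necessarily finite-dimensional) space given by a type with a scalar
  multiplication, so that restrictions live over the same type as the original matroid.
\<close>

record 'a matroid =
  ground :: "'a set"
  geom :: "'a set"

definition restriction :: "'a matroid \<Rightarrow> 'a set \<Rightarrow> 'a matroid" where
  "restriction M F = \<lparr>ground = ground M \<inter> F, geom = F\<rparr>"

definition complement :: "'a matroid \<Rightarrow> 'a matroid" where
  "complement M = \<lparr>ground = geom M - ground M, geom = geom M\<rparr>"

definition isomorphic ::
    "(bit \<Rightarrow> 'a::ab_group_add \<Rightarrow> 'a) \<Rightarrow> (bit \<Rightarrow> 'b::ab_group_add \<Rightarrow> 'b) \<Rightarrow>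
     'a matroid \<Rightarrow> 'b matroid \<Rightarrow> bool" where
  "isomorphic s t M N \<longleftrightarrow>
    (\<exists>f. bij_betw f (insert 0 (geom M)) (insert 0 (geom N)) \<and>
         (\<forall>x \<in> insert 0 (geom M). \<forall>y \<in> insert 0 (geom M). f (x + y) = f x + f y) \<and>
         (\<forall>c. \<forall>x \<in> insert 0 (geom M). f (s c x) = t c (f x)) \<and>
         f ` ground M = ground N)"

locale binary_space = vector_space scale
  for scale :: "bit \<Rightarrow> 'a::ab_group_add \<Rightarrow> 'a"
begin

definition is_matroid :: "'a matroid \<Rightarrow> bool" where
  "is_matroid M \<longleftrightarrow>
    0 \<notin> geom M \<and> (\<exists>B. finite B \<and> insert 0 (geom M) = span B) \<and> ground M \<subseteq> geom M"

definition flat_of :: "'a set \<Rightarrow> 'a set \<Rightarrow> bool" where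
  "flat_of G F \<longleftrightarrow> F \<subseteq> G \<and> subspace (insert 0 F)"

definition flat_dim :: "'a set \<Rightarrow> nat" where
  "flat_dim F = dim (insert 0 F)"

definition mdim :: "'a matroid \<Rightarrow> nat" where
  "mdim M = flat_dim (geom M)"

definition even_plane :: "'a matroid \<Rightarrow> bool" where
  "even_plane M \<longleftrightarrow>
    (\<forall>P. flat_of (geom M) P \<and> flat_dim P = 3 \<longrightarrow> even (card (ground M \<inter> P)))"

definition is_claw :: "'a matroid \<Rightarrow> bool" where
  "is_claw M \<longleftrightarrow>
    is_matroid M \<and> mdim M = 3 \<and>
    independent (ground M) \<and> span (ground M) = insert 0 (geom M)"

text \<open>The empty set is a flat of dimension 0, so the maximum exists and is 0 if E is empty.\<close>

definition omega :: "'a matroid \<Rightarrow> nat" where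
  "omega M = Max {flat_dim F |F. flat_of (geom M) F \<and> F \<subseteq> ground M}"

text \<open>The subtraction does not truncate: a flat of G has dimension at most that of G.\<close>

definition chi :: "'a matroid \<Rightarrow> nat" where
  "chi M = mdim M - omega (complement M)"

end

definition free_of ::
    "(bit \<Rightarrow> 'a::ab_group_add \<Rightarrow> 'a) \<Rightarrow> (bit \<Rightarrow> 'b::ab_group_add \<Rightarrow> 'b) \<Rightarrow>
     'a matroid \<Rightarrow> 'b matroid \<Rightarrow> bool" where
  "free_of s t M N \<longleftrightarrow>
    \<not> (\<exists>F. binary_space.flat_of s (geom M) F \<and> isomorphic s t (restriction M F) N)"

text \<open>
  It suffices to let the claws range over the type of M: a restriction of M that is isomorphic
  to a claw over some other type is itself a claw.
\<close>

definition (in binary_space) claw_free :: "'a matroid \<Rightarrow> bool" where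
  "claw_free M \<longleftrightarrow> (\<forall>C. is_claw C \<longrightarrow> free_of scale scale M C)"

end

theory Submission
  imports Defs
begin

text \<open>
  Let \<open>S\<close> be a maximal subspace disjoint from \<open>E\<close>. Claw-freeness makes the intersection of \<open>E\<close> with every
  other coset \<open>x + S\<close> a coset of a subspace \<open>K x\<close> of \<open>S\<close>, and it restricts the triples
  \<open>K x, K y, K (x + y)\<close> so severely that the space above \<open>S\<close> is filtered into levels on which \<open>dim (K x)\<close>
  takes only two consecutive values. Flats contained in \<open>E\<close> that come from different levels add up, so
  each level can be treated on its own. There, either \<open>K\<close> has at most two values \<open>L\<close>, \<open>T\<close>, and the complement
  of \<open>E\<close> is essentially triangle-free, so that a density increment argument yields a large flat in \<open>E\<close>;
  or, up to two summands on which \<open>K\<close> is constant (which again give flats in \<open>E\<close>), \<open>K\<close> is injective. Its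
  values then either contain a common subspace of index two, which gives a flat in \<open>E\<close>, or have index two
  in a common subspace, in which case \<open>E\<close> is locally given by a quadratic form of large rank, and \<open>N\<close> embeds.
\<close>


section \<open>Subspaces over the two-element field\<close>

text \<open>A largest flat of the complement of \<open>E\<close> serves as \<open>S\<close>, so
  \<open>chi\<close> is the dimension of the whole space modulo \<open>S\<close>. The number of
  levels is not bounded in advance, hence levels cannot be paid for one by one: the bound for a
  level must be superadditive in the dimension of the flat it contributes, and every level that
  costs anything contributes at least one dimension. This is why dim(N) + 4 is multiplied by k. The
  term (k + 2) * 2^(k + 1) counts density increments: with N = 2^(k + 1), each N steps at least
  double a density that starts at 1/N. The quadratic form arises as follows. If every
  \<open>K x\<close> has index two in \<open>T\<close>, it is the kernel of a nonzero functional on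
  \<open>T\<close>, and a trisection says that the functionals of x, y and x + y sum to zero. Thus
  the space modulo \<open>T\<close> is paired with \<open>T\<close>, and this pairing records how
  membership in \<open>E\<close> changes along \<open>T\<close>. Claw-freeness makes the planes
  independent modulo \<open>T\<close> even, so an embedding of an even-plane matroid can be extended
  vector by vector: the error of a tentative extension is an affine function, and a shift by an
  element of \<open>T\<close> cancels it.\<close>

definition sumset :: "'a::plus set \<Rightarrow> 'a set \<Rightarrow> 'a set" where
  "sumset A B = {a + b |a b. a \<in> A \<and> b \<in> B}"

lemma sumsetI: "a \<in> A \<Longrightarrow> b \<in> B \<Longrightarrow> a + b \<in> sumset A B"
  by (auto simp: sumset_def)

lemma sumsetE:
  assumes "x \<in> sumset A B"
  obtains a b where "a \<in> A" "b \<in> B" "x = a + b"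
  using assms by (auto simp: sumset_def)

text \<open>For subspaces this is codimension one: over the two-element field \<open>Q - P\<close>
  is then a single coset of \<open>P\<close>. The formulation by sums avoids dimensions and directly
  provides the rule that two outer elements add up to an inner one.\<close>

definition index_two :: "'a::plus set \<Rightarrow> 'a set \<Rightarrow> bool" where
  "index_two P Q \<longleftrightarrow> P \<subset> Q \<and> (\<forall>u \<in> Q - P. \<forall>v \<in> Q - P. u + v \<in> P)"

context binary_space
begin

lemma add_self [simp]: "x + x = 0" for x :: 'a
proof -
  have "x + x = scale 1 x + scale 1 x" by simp
  also have "\<dots> = scale (1 + 1) x" by (simp only: scale_left_distrib)
  also have "\<dots> = 0" by simp
  finally show ?thesis .
qed

lemma add_left_self [simp]: "x + (x + y) = y" for x y :: 'a
  by (simp flip: add.assoc)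

lemma uminus_eq [simp]: "- x = x" for x :: 'a
  by (rule minus_unique) simp

lemma diff_eq [simp]: "x - y = x + y" for x y :: 'a
  by (simp only: diff_conv_add_uminus uminus_eq)

lemma add_eq_0_iff_eq [simp]: "x + y = 0 \<longleftrightarrow> x = y" for x y :: 'a
  by (metis add_left_self add_0_right add_self)

lemma subspace_iff: "subspace H \<longleftrightarrow> 0 \<in> H \<and> (\<forall>x \<in> H. \<forall>y \<in> H. x + y \<in> H)"
proof
  show "subspace H \<Longrightarrow> 0 \<in> H \<and> (\<forall>x \<in> H. \<forall>y \<in> H. x + y \<in> H)"
    by (auto simp: subspace_def)
next
  assume H: "0 \<in> H \<and> (\<forall>x \<in> H. \<forall>y \<in> H. x + y \<in> H)"
  have "scale c x \<in> H" if "x \<in> H" for c x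
    using that H by (cases c) auto
  with H show "subspace H" by (auto simp: subspace_def)
qed

lemma subspaceI:
  "0 \<in> H \<Longrightarrow> (\<And>x y. x \<in> H \<Longrightarrow> y \<in> H \<Longrightarrow> x + y \<in> H) \<Longrightarrow> subspace H"
  by (simp add: subspace_iff)

lemma subspace_add_iff:
  assumes "subspace H" "x \<in> H"
  shows "x + y \<in> H \<longleftrightarrow> y \<in> H" "y + x \<in> H \<longleftrightarrow> y \<in> H"
  using assms add_left_self[of x y] by (metis add.commute subspace_iff)+

definition ext :: "'a \<Rightarrow> 'a set \<Rightarrow> 'a set" where
  "ext x H = H \<union> (+) x ` H"

lemma mem_ext: "y \<in> ext x H \<longleftrightarrow> y \<in> H \<or> x + y \<in> H"
proof -
  have "y \<in> (+) x ` H \<longleftrightarrow> x + y \<in> H"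
    by (metis add_left_self image_iff)
  then show ?thesis by (simp add: ext_def)
qed

lemma subspace_ext:
  assumes "subspace H"
  shows "subspace (ext x H)"
proof (rule subspaceI)
  show "0 \<in> ext x H" using assms by (simp add: ext_def subspace_iff)
next
  fix y z assume "y \<in> ext x H" "z \<in> ext x H"
  then consider "y \<in> H" "z \<in> H" | "y \<in> H" "x + z \<in> H" | "x + y \<in> H" "z \<in> H"
    | "x + y \<in> H" "x + z \<in> H" by (auto simp: mem_ext)
  then show "y + z \<in> ext x H"
  proof cases
    case 1 then show ?thesis using assms by (simp add: mem_ext subspace_iff)
  next
    case 2 then have "y + (x + z) \<in> H" using assms by (simp add: subspace_iff)
    then show ?thesis by (simp add: mem_ext add.left_commute)
  next
    case 3 then have "(x + y) + z \<in> H" using assms by (simp add: subspace_iff)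
    then show ?thesis by (simp add: mem_ext add.assoc)
  next
    case 4 then have "(x + y) + (x + z) \<in> H" using assms by (simp add: subspace_iff)
    then show ?thesis by (simp add: mem_ext ac_simps)
  qed
qed

lemma card_ext:
  assumes "subspace H" "finite H" "x \<notin> H"
  shows "card (ext x H) = 2 * card H"
proof -
  have "H \<inter> (+) x ` H = {}"
    using assms by (auto simp: subspace_add_iff)
  then show ?thesis
    using assms by (simp add: ext_def card_Un_disjoint card_image inj_on_def)
qed

lemma ext_subset:
  assumes "subspace F" "H \<subseteq> F" "x \<in> F"
  shows "ext x H \<subseteq> F"
  using assms by (auto simp: ext_def subspace_iff)

lemma self_in_ext: "subspace H \<Longrightarrow> x \<in> ext x H"
  by (simp add: mem_ext subspace_iff)

lemma span_insert_eq_ext: "span (insert b B) = ext b (span B)"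
proof -
  have "(\<exists>k. x - scale k b \<in> span B) \<longleftrightarrow> x \<in> ext b (span B)" for x
  proof
    assume "\<exists>k. x - scale k b \<in> span B"
    then obtain k where k: "x - scale k b \<in> span B" ..
    then show "x \<in> ext b (span B)"
      by (cases k) (auto simp: mem_ext add.commute)
  next
    assume "x \<in> ext b (span B)"
    then have "x - scale 0 b \<in> span B \<or> x - scale 1 b \<in> span B"
      by (auto simp: mem_ext add.commute)
    then show "\<exists>k. x - scale k b \<in> span B" by blast
  qed
  then show ?thesis unfolding span_insert by blast
qed

lemma card_span_independent:
  assumes "finite B" "independent B"
  shows "finite (span B) \<and> card (span B) = 2 ^ card B"
  using assms
proof (induction B rule: finite_induct)
  case empty
  then show ?case by simp
next
  case (insert b B)
  then have *: "b \<notin> span B" "independent B" by (auto simp: independent_insert)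
  with insert show ?case
    by (simp add: span_insert_eq_ext card_ext) (simp add: ext_def)
qed

lemma finite_span:
  assumes "finite B"
  shows "finite (span B)"
  using assms by (induction B rule: finite_induct) (simp_all add: span_insert_eq_ext, simp add: ext_def)

text \<open>Comparisons of dimension such as \<open>subspace_dim_mono\<close>,
  \<open>dim_ext\<close> and \<open>dim_sumset\<close> are read off from cardinalities, which avoids
  handling bases.\<close>

lemma card_subspace:
  assumes "subspace H" "finite H"
  shows "card H = 2 ^ dim H"
proof -
  obtain B where B: "B \<subseteq> H" "independent B" "H \<subseteq> span B" "card B = dim H"
    by (rule basis_exists)
  moreover have "span B = H" using B assms by (metis span_minimal subset_antisym)
  moreover have "finite B" using B assms finite_subset by blast
  ultimately show ?thesis using card_span_independent by metis
qed

lemma subspace_dim_mono: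
  assumes "subspace H" "subspace K" "finite K" "H \<subseteq> K"
  shows "dim H \<le> dim K"
proof -
  have "card H \<le> card K" using assms card_mono by blast
  then have "(2::nat) ^ dim H \<le> 2 ^ dim K"
    using assms card_subspace finite_subset by metis
  then show ?thesis by simp
qed

lemma subspace_eq_if_dim_ge:
  assumes "subspace H" "subspace K" "finite K" "H \<subseteq> K" "dim K \<le> dim H"
  shows "H = K"
proof -
  have "dim K = dim H" using subspace_dim_mono assms by (simp add: le_antisym)
  then have "card H = card K" using assms card_subspace finite_subset by metis
  then show ?thesis using assms card_subset_eq by blast
qed

lemma subspace_psubset_dim:
  assumes "subspace H" "subspace K" "finite K" "H \<subset> K"
  shows "dim H < dim K"
  using assms subspace_eq_if_dim_ge[of H K] by (metis not_le psubset_eq)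

lemma dim_ext:
  assumes "subspace H" "finite H" "x \<notin> H"
  shows "dim (ext x H) = Suc (dim H)"
proof -
  have "finite (ext x H)" using assms by (simp add: ext_def)
  then have "(2::nat) ^ dim (ext x H) = 2 ^ Suc (dim H)"
    using card_ext[OF assms] assms by (simp add: card_subspace subspace_ext)
  then show ?thesis by (simp only: power_inject_exp)
qed

lemma subspace_sumset:
  assumes "subspace H" "subspace K"
  shows "subspace (sumset H K)"
  unfolding sumset_def using subspace_sums[OF assms] .

lemma sumset_superset:
  assumes "subspace H" "subspace K"
  shows "H \<subseteq> sumset H K" "K \<subseteq> sumset H K"
proof -
  have "x + 0 \<in> sumset H K" if "x \<in> H" for x
    using that assms by (intro sumsetI) (auto simp: subspace_iff)
  then show "H \<subseteq> sumset H K" by auto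
  have "0 + x \<in> sumset H K" if "x \<in> K" for x
    using that assms by (intro sumsetI) (auto simp: subspace_iff)
  then show "K \<subseteq> sumset H K" by auto
qed

lemma sumset_subset:
  assumes "subspace F" "H \<subseteq> F" "K \<subseteq> F"
  shows "sumset H K \<subseteq> F"
  using assms by (auto simp: sumset_def subspace_iff)

lemma finite_sumset: "finite H \<Longrightarrow> finite K \<Longrightarrow> finite (sumset H K)"
  by (simp add: sumset_def finite_image_set2)

lemma dim_sumset:
  assumes "subspace H" "subspace K" "finite H" "finite K" "H \<inter> K = {0}"
  shows "dim (sumset H K) = dim H + dim K"
proof -
  have inj: "inj_on (\<lambda>(h, k). h + k) (H \<times> K)"
  proof (rule inj_onI, clarify)
    fix h k h' k' assume *: "h \<in> H" "k \<in> K" "h' \<in> H" "k' \<in> K" "h + k = h' + k'"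
    then have "h + h' = k + k'"
      by (metis add.commute add.left_commute add_left_self)
    moreover have "h + h' \<in> H" "k + k' \<in> K" using * assms by (auto simp: subspace_iff)
    ultimately have "h + h' \<in> H \<inter> K" "k + k' \<in> H \<inter> K" by simp_all
    then have "h + h' = 0" "k + k' = 0" unfolding assms(5) by blast+
    then show "h = h' \<and> k = k'" by simp
  qed
  have "sumset H K = (\<lambda>(h, k). h + k) ` (H \<times> K)" by (auto simp: sumset_def)
  then have "card (sumset H K) = card H * card K"
    using card_image[OF inj] by (simp add: card_cartesian_product)
  then have "(2::nat) ^ dim (sumset H K) = 2 ^ (dim H + dim K)"
    using assms by (simp add: card_subspace subspace_sumset finite_sumset power_add)
  then show ?thesis by (simp only: power_inject_exp)
qed

lemma complement_exists:
  assumes "subspace F" "subspace F'" "finite F'" "F \<subseteq> F'"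
  obtains A where "subspace A" "A \<subseteq> F'" "A \<inter> F = {0}" "sumset F A = F'"
    "dim F' = dim F + dim A"
proof -
  define Q where "Q A \<longleftrightarrow> subspace A \<and> A \<subseteq> F' \<and> A \<inter> F = {0}" for A
  have "Q {0}" using assms by (auto simp: Q_def subspace_iff)
  moreover have "finite {A. Q A}"
    using assms(3) by (rule finite_subset[rotated, OF finite_Pow_iff[THEN iffD2]]) (auto simp: Q_def)
  ultimately obtain A where A: "Q A" and max: "\<And>B. Q B \<Longrightarrow> A \<subseteq> B \<Longrightarrow> B = A"
    using finite_has_maximal[of "{A. Q A}"] by auto
  then have sA: "subspace A" "A \<subseteq> F'" "A \<inter> F = {0}" by (auto simp: Q_def)
  have "x \<in> sumset F A" if x: "x \<in> F'" for x
  proof (rule ccontr)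
    assume nx: "x \<notin> sumset F A"
    have "y = 0" if y: "y \<in> ext x A" "y \<in> F" for y
    proof (cases "y \<in> A")
      case True then show ?thesis using sA y by auto
    next
      case False
      then have "x + y \<in> A" using y by (simp add: mem_ext)
      then have "y + (x + y) \<in> sumset F A" using y by (intro sumsetI)
      then show ?thesis using nx by (simp add: ac_simps)
    qed
    then have "ext x A \<inter> F = {0}"
      using assms subspace_ext[OF sA(1), of x] by (auto simp: subspace_iff)
    then have "Q (ext x A)"
      using sA x assms by (simp add: Q_def subspace_ext ext_subset)
    then have "ext x A = A" by (rule max) (auto simp: ext_def)
    then have "x \<in> A" using self_in_ext sA by metis
    then show False using nx sumset_superset sA assms by blast
  qed
  moreover have "sumset F A \<subseteq> F'" using assms sA sumset_subset by blast
  ultimately have eq: "sumset F A = F'" by blast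
  have "dim F' = dim F + dim A"
    unfolding eq[symmetric] using assms sA finite_subset
    by (intro dim_sumset) (auto simp: Int_commute)
  with that sA eq show ?thesis by blast
qed

lemma index_two_dim:
  assumes "index_two P Q" "subspace P" "subspace Q" "finite Q"
  shows "dim Q = Suc (dim P)"
proof -
  obtain u where u: "u \<in> Q" "u \<notin> P" using assms by (auto simp: index_two_def)
  have "Q = ext u P"
  proof
    show "Q \<subseteq> ext u P"
      using assms u by (auto simp: mem_ext index_two_def)
    show "ext u P \<subseteq> Q"
      using assms u by (intro ext_subset) (auto simp: index_two_def)
  qed
  then show ?thesis using dim_ext assms u finite_subset
    by (metis index_two_def psubset_imp_subset)
qed

lemma index_two_if_dim:
  assumes "P \<subseteq> Q" "subspace P" "subspace Q" "finite Q" "dim Q = Suc (dim P)"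
  shows "index_two P Q"
proof -
  have ne: "P \<noteq> Q" using assms by auto
  have "u + v \<in> P" if "u \<in> Q" "u \<notin> P" "v \<in> Q" "v \<notin> P" for u v
  proof -
    have "ext u P = Q"
      using assms that finite_subset[OF assms(1)]
      by (intro subspace_eq_if_dim_ge) (auto simp: subspace_ext ext_subset dim_ext)
    then have "v \<in> ext u P" using that by simp
    then show ?thesis using that by (simp add: mem_ext)
  qed
  then show ?thesis using assms ne by (auto simp: index_two_def)
qed

end

section \<open>Triangle-free sets avoid large subspaces\<close>

context binary_space
begin

text \<open>The character with value (-1)^m, where m is the number of nonzero coordinates of
  \<open>x\<close> in \<open>J\<close>. For a finite basis \<open>B\<close> the subsets of
  \<open>B\<close> index all characters of \<open>span B\<close>, and \<open>{}\<close> gives the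
  trivial one.\<close>

definition chr :: "'a set \<Rightarrow> 'a set \<Rightarrow> 'a \<Rightarrow> real" where
  "chr B J x = (\<Prod>b\<in>J. if representation B x b = 0 then 1 else -1)"

lemma chr_add:
  assumes "independent B" "x \<in> span B" "y \<in> span B"
  shows "chr B J (x + y) = chr B J x * chr B J y"
proof -
  have "(if p + q = 0 then 1 else -1 :: real) = (if p = 0 then 1 else -1) * (if q = 0 then 1 else -1)"
    for p q :: bit by (cases p; cases q) auto
  then show ?thesis
    using assms by (simp add: chr_def representation_add prod.distrib)
qed

lemma chr_cases: "chr B J x = 1 \<or> chr B J x = -1"
proof (cases "finite J")
  case True
  then show ?thesis unfolding chr_def by (induction J rule: finite_induct) auto
qed (simp add: chr_def)

lemma chr_empty [simp]: "chr B {} x = 1"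
  by (simp add: chr_def)

lemma chr_zero: "chr B J 0 = 1"
  by (simp add: chr_def representation_zero)

text \<open>Orthogonality of characters: the sum over \<open>J\<close> is an expanded product over
  \<open>b\<close> of the sign at \<open>b\<close> plus 1, and a nonzero coordinate of
  \<open>x\<close> contributes the factor 0.\<close>

lemma sum_chr:
  assumes "finite B" "independent B" "x \<in> span B"
  shows "(\<Sum>J\<in>Pow B. chr B J x) = (if x = 0 then 2 ^ card B else 0)"
proof -
  have eq: "(\<Sum>J\<in>Pow B. chr B J x) = (\<Prod>b\<in>B. (if representation B x b = 0 then 1 else -1) + 1)"
    using assms(1) by (subst prod_add) (auto simp: chr_def)
  show ?thesis
  proof (cases "x = 0")
    case True
    then show ?thesis unfolding eq by (simp add: representation_zero)
  next
    case False
    have "\<exists>b\<in>B. representation B x b \<noteq> 0"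
    proof (rule ccontr)
      assume "\<not> ?thesis"
      then have "(\<Sum>b\<in>B. scale (representation B x b) b) = 0"
        by (intro sum.neutral) auto
      moreover have "(\<Sum>b\<in>B. scale (representation B x b) b) = x"
        using assms by (intro sum_representation_eq) auto
      ultimately show False using False by simp
    qed
    then show ?thesis unfolding eq using assms(1) False by (auto intro: prod_zero)
  qed
qed

text \<open>
  Since no sum of two elements of \<open>A\<close> lies in \<open>S\<close>, the sum of \<open>(F A J)\<^sup>2 * F S J\<close> over all characters \<open>J\<close>
  vanishes, and the contribution of the trivial one forces a large nontrivial coefficient \<open>F A J\<close>.
\<close>

lemma density_increment:
  assumes U: "subspace U" "finite U" and AS: "A \<subseteq> U" "S \<subseteq> U" "S \<noteq> {}"
    and le: "card S \<le> card A" and free: "\<And>a s. a \<in> A \<Longrightarrow> s \<in> S \<Longrightarrow> a + s \<notin> A"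
  obtains H u where "subspace H" "H \<subseteq> U" "dim U = Suc (dim H)" "u \<in> U"
    "card A * (card U + card S) \<le> 2 * card U * card {a \<in> A. u + a \<in> H}"
proof -
  obtain B where B: "B \<subseteq> U" "independent B" "U \<subseteq> span B"
    by (rule basis_exists)
  have finB: "finite B" using B U finite_subset by blast
  have UB: "span B = U" using B U by (metis span_minimal subset_antisym)
  have fin: "finite A" "finite S" using AS U finite_subset by blast+
  define n where "n = (2::real) ^ card B"
  have n: "real (card U) = n" "n > 0"
    using card_span_independent[OF finB B(2)] UB by (auto simp: n_def)
  define a where "a = real (card A)"
  define s where "s = real (card S)"
  have s0: "s > 0" using fin AS by (simp add: s_def card_gt_0_iff)
  have as: "s \<le> a" using le by (simp add: a_def s_def)
  have add: "chr B J (x + y) = chr B J x * chr B J y" if "x \<in> U" "y \<in> U" for J x y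
    using chr_add B UB that by simp
  have sumc: "(\<Sum>J\<in>Pow B. chr B J x) = (if x = 0 then n else 0)" if "x \<in> U" for x
    using sum_chr finB B UB that by (simp add: n_def)
  define F where "F X J = (\<Sum>x\<in>X. chr B J x)" for X J
  have parseval: "(\<Sum>J\<in>Pow B. (F X J)\<^sup>2) = n * real (card X)" if X: "X \<subseteq> U" for X
  proof -
    have finX: "finite X" using X U finite_subset by blast
    have "(\<Sum>J\<in>Pow B. (F X J)\<^sup>2) = (\<Sum>J\<in>Pow B. \<Sum>x\<in>X. \<Sum>y\<in>X. chr B J (x + y))"
      unfolding F_def power2_eq_square sum_product
      using X by (intro sum.cong refl) (simp add: add subset_eq)
    also have "\<dots> = (\<Sum>x\<in>X. \<Sum>J\<in>Pow B. \<Sum>y\<in>X. chr B J (x + y))"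
      by (rule sum.swap)
    also have "\<dots> = (\<Sum>x\<in>X. \<Sum>y\<in>X. \<Sum>J\<in>Pow B. chr B J (x + y))"
      by (intro sum.cong refl sum.swap)
    also have "\<dots> = (\<Sum>x\<in>X. \<Sum>y\<in>X. if x = y then n else 0)"
      using X U by (intro sum.cong refl, subst sumc) (auto simp: subspace_iff)
    also have "\<dots> = n * real (card X)" using finX by (simp add: sum.delta)
    finally show ?thesis .
  qed
  have "(\<Sum>J\<in>Pow B. (F A J)\<^sup>2 * F S J) =
      (\<Sum>J\<in>Pow B. \<Sum>x\<in>A. \<Sum>y\<in>A. \<Sum>z\<in>S. chr B J (x + y + z))"
  proof (rule sum.cong[OF refl])
    fix J
    have "(\<Sum>x\<in>A. \<Sum>y\<in>A. \<Sum>z\<in>S. chr B J (x + y + z)) =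
        (\<Sum>x\<in>A. \<Sum>y\<in>A. \<Sum>z\<in>S. chr B J x * chr B J y * chr B J z)"
      using AS U by (intro sum.cong refl) (simp add: add subset_eq subspace_iff)
    also have "\<dots> = (F A J)\<^sup>2 * F S J"
      by (simp add: F_def power2_eq_square flip: sum_distrib_left sum_distrib_right)
    finally show "(F A J)\<^sup>2 * F S J = (\<Sum>x\<in>A. \<Sum>y\<in>A. \<Sum>z\<in>S. chr B J (x + y + z))" ..
  qed
  also have "\<dots> = (\<Sum>x\<in>A. \<Sum>J\<in>Pow B. \<Sum>y\<in>A. \<Sum>z\<in>S. chr B J (x + y + z))"
    by (rule sum.swap)
  also have "\<dots> = (\<Sum>x\<in>A. \<Sum>y\<in>A. \<Sum>J\<in>Pow B. \<Sum>z\<in>S. chr B J (x + y + z))"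
    by (intro sum.cong refl sum.swap)
  also have "\<dots> = (\<Sum>x\<in>A. \<Sum>y\<in>A. \<Sum>z\<in>S. \<Sum>J\<in>Pow B. chr B J (x + y + z))"
    by (intro sum.cong refl sum.swap)
  also have "\<dots> = 0"
  proof -
    have "(\<Sum>J\<in>Pow B. chr B J (x + y + z)) = 0" if xyz: "x \<in> A" "y \<in> A" "z \<in> S" for x y z
    proof -
      have "x + y + z \<noteq> 0" using xyz free[of x z] by (auto simp: ac_simps)
      moreover have "x \<in> U" "y \<in> U" "z \<in> U" using xyz AS by auto
      then have "x + y + z \<in> U" using U by (simp add: subspace_iff)
      ultimately show ?thesis by (simp add: sumc)
    qed
    then show ?thesis by simp
  qed
  finally have triple: "(\<Sum>J\<in>Pow B. (F A J)\<^sup>2 * F S J) = 0" .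
  have F0: "F X {} = real (card X)" for X by (simp add: F_def)
  have split: "(\<Sum>J\<in>Pow B. h J) = h {} + (\<Sum>J\<in>Pow B - {{}}. h J)" for h :: "'a set \<Rightarrow> real"
    using finB by (intro sum.remove) auto
  have tail: "(\<Sum>J\<in>Pow B - {{}}. (F X J)\<^sup>2) = n * real (card X) - (real (card X))\<^sup>2"
    if "X \<subseteq> U" for X
    using parseval[OF that] split[of "\<lambda>J. (F X J)\<^sup>2"] unfolding F0 by linarith
  \<comment> \<open>The two cosets of the hyperplane belonging to \<open>J\<close> contain half of
    \<open>a + F A J\<close> and half of \<open>a - F A J\<close> elements of \<open>A\<close>. A
    coefficient of absolute value at least \<open>c\<close> therefore gives the gain
    \<open>1 + s / n\<close>.\<close>
  define c where "c = a * s / n"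
  have "\<exists>J\<in>Pow B - {{}}. c \<le> \<bar>F A J\<bar>"
  proof (rule ccontr)
    assume "\<not> ?thesis"
    then have small: "\<bar>F A J\<bar> < c" if "J \<in> Pow B - {{}}" for J
      using that by (meson not_le)
    have "a > 0" using s0 as by linarith
    then have c0: "c > 0" using s0 n(2) by (simp add: c_def)
    have "a\<^sup>2 * s = - (\<Sum>J\<in>Pow B - {{}}. (F A J)\<^sup>2 * F S J)"
      using triple split[of "\<lambda>J. (F A J)\<^sup>2 * F S J"] unfolding F0 a_def s_def by linarith
    also have "\<dots> = (\<Sum>J\<in>Pow B - {{}}. - ((F A J)\<^sup>2 * F S J))" by (simp add: sum_negf)
    \<comment> \<open>One factor \<open>F A J\<close> is bounded by \<open>c\<close>, the remaining
      product by the mean of the squares. Parseval then applies to \<open>A\<close> and to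
      \<open>S\<close>, and \<open>s \<le> a\<close> brings both contributions below
      \<open>n * a\<close>.\<close>
    also have "\<dots> \<le> (\<Sum>J\<in>Pow B - {{}}. c / 2 * ((F A J)\<^sup>2 + (F S J)\<^sup>2))"
    proof (rule sum_mono)
      fix J assume J: "J \<in> Pow B - {{}}"
      have "- ((F A J)\<^sup>2 * F S J) \<le> \<bar>(F A J)\<^sup>2 * F S J\<bar>"
        by (rule abs_ge_minus_self)
      also have "\<dots> = \<bar>F A J\<bar> * (\<bar>F A J\<bar> * \<bar>F S J\<bar>)"
        by (simp only: abs_mult power2_eq_square mult.assoc)
      also have "\<dots> \<le> c * (\<bar>F A J\<bar> * \<bar>F S J\<bar>)"
        using small[OF J] by (intro mult_right_mono) auto
      also have "\<bar>F A J\<bar> * \<bar>F S J\<bar> \<le> ((F A J)\<^sup>2 + (F S J)\<^sup>2) / 2"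
        using sum_squares_bound[of "\<bar>F A J\<bar>" "\<bar>F S J\<bar>"] by simp
      finally show "- ((F A J)\<^sup>2 * F S J) \<le> c / 2 * ((F A J)\<^sup>2 + (F S J)\<^sup>2)"
        using c0 by (simp add: mult_left_mono)
    qed
    also have "\<dots> = c / 2 * (n * a - a\<^sup>2 + (n * s - s\<^sup>2))"
      unfolding sum_distrib_left[symmetric] sum.distrib tail[OF AS(1)] tail[OF AS(2)] a_def s_def ..
    also have "\<dots> < c / 2 * (n * a + n * a)"
    proof (rule mult_strict_left_mono)
      have "n * s \<le> n * a" using as n by simp
      moreover have "a\<^sup>2 > 0" "s\<^sup>2 > 0" using s0 as by auto
      ultimately show "n * a - a\<^sup>2 + (n * s - s\<^sup>2) < n * a + n * a" by linarith
    qed (use c0 in simp)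
    also have "\<dots> = a\<^sup>2 * s" using n by (simp add: c_def power2_eq_square)
    finally show False by simp
  qed
  then obtain J where J: "J \<subseteq> B" "J \<noteq> {}" and big: "c \<le> \<bar>F A J\<bar>" by auto
  define H where "H = {x \<in> U. chr B J x = 1}"
  have finJ: "finite J" using J finB finite_subset by blast
  \<comment> \<open>Such a \<open>b\<close> has sign -1. It shows that \<open>H\<close> is proper,
    and it is the translation \<open>u\<close> if the denser coset is the one outside
    \<open>H\<close>.\<close>
  obtain b where b: "b \<in> J" using J by auto
  have chrb: "chr B J b = -1"
  proof -
    have "chr B J b = (\<Prod>b'\<in>J. if b' = b then -1 else 1)"
      unfolding chr_def using b J B by (intro prod.cong refl) (subst representation_basis, auto)
    also have "\<dots> = -1" using finJ b by (simp add: prod.delta)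
    finally show ?thesis .
  qed
  have bU: "b \<in> U" using b J B by auto
  have H: "subspace H" "H \<subseteq> U"
    using U by (auto simp: H_def subspace_iff add chr_zero)
  have i2: "index_two H U"
    unfolding index_two_def
  proof (intro conjI ballI)
    have "b \<notin> H" using chrb by (simp add: H_def)
    then show "H \<subset> U" using bU H(2) by blast
    fix u v assume "u \<in> U - H" "v \<in> U - H"
    then show "u + v \<in> H"
      using chr_cases[of B J u] chr_cases[of B J v] U by (auto simp: H_def add subspace_iff)
  qed
  define N where "N e = real (card {x \<in> A. chr B J x = e})" for e
  have part: "A = {x \<in> A. chr B J x = 1} \<union> {x \<in> A. chr B J x = -1}"
    using chr_cases by blast
  have disj: "{x \<in> A. chr B J x = 1} \<inter> {x \<in> A. chr B J x = -1} = {}" by auto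
  have "card ({x \<in> A. chr B J x = 1} \<union> {x \<in> A. chr B J x = -1}) =
      card {x \<in> A. chr B J x = 1} + card {x \<in> A. chr B J x = -1}"
    using fin disj by (intro card_Un_disjoint) simp_all
  then have "a = N 1 + N (-1)"
    unfolding part[symmetric] a_def N_def by simp
  moreover have "F ({x \<in> A. chr B J x = 1} \<union> {x \<in> A. chr B J x = -1}) J = N 1 - N (-1)"
    unfolding F_def N_def using fin disj by (subst sum.union_disjoint) auto
  then have "F A J = N 1 - N (-1)"
    unfolding part[symmetric] .
  ultimately have "a + c \<le> 2 * N 1 \<or> a + c \<le> 2 * N (-1)"
    using big by linarith
  then obtain e where e: "e = 1 \<or> e = -1" "a + c \<le> 2 * N e" by blast
  obtain u where u: "u \<in> U" "chr B J u = e"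
    using e chrb bU U by (auto simp: subspace_iff chr_zero)
  have "{x \<in> A. u + x \<in> H} = {x \<in> A. chr B J x = e}"
  proof -
    have "u + x \<in> H \<longleftrightarrow> chr B J x = e" if "x \<in> A" for x
      using that AS U u e chr_cases[of B J x] by (auto simp: H_def add subspace_iff)
    then show ?thesis by blast
  qed
  then have "a + c \<le> 2 * real (card {x \<in> A. u + x \<in> H})" using e by (simp add: N_def)
  then have "n * (a + c) \<le> n * (2 * real (card {x \<in> A. u + x \<in> H}))"
    using n by (intro mult_left_mono) auto
  moreover have "n * (a + c) = a * (n + s)" using n by (simp add: c_def field_simps)
  ultimately have "a * (n + s) \<le> n * (2 * real (card {x \<in> A. u + x \<in> H}))" by linarith
  then have "real (card A * (card U + card S)) \<le> real (2 * card U * card {x \<in> A. u + x \<in> H})"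
    unfolding a_def s_def n(1)[symmetric] by (simp only: of_nat_mult of_nat_add of_nat_numeral mult_ac)
  then have "card A * (card U + card S) \<le> 2 * card U * card {x \<in> A. u + x \<in> H}"
    by (simp only: of_nat_le_iff)
  then show ?thesis using that H u index_two_dim[OF i2 H(1) U] by blast
qed

section \<open>From a density increment to a bound on the dimension\<close>

lemma card_eq_translate:
  fixes A B :: "'a set"
  assumes "\<And>x. x \<in> A \<Longrightarrow> u + x \<in> B" "\<And>x. x \<in> B \<Longrightarrow> u + x \<in> A"
  shows "card A = card B"
proof -
  have "B = (+) u ` A"
  proof
    show "B \<subseteq> (+) u ` A"
    proof
      fix x assume "x \<in> B"
      then have "u + (u + x) \<in> (+) u ` A" using assms(2) by blast
      then show "x \<in> (+) u ` A" by simp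
    qed
  qed (use assms(1) in blast)
  then show ?thesis by (simp add: card_image inj_on_def)
qed

text \<open>For a maximal subspace \<open>F\<close> disjoint from \<open>Y\<close>, every nontrivial
  coset of \<open>F\<close> in \<open>U\<close> contains a point of \<open>Y\<close>, since
  otherwise \<open>F\<close> could be enlarged. There are at least 2^(dim U - t) - 1 such cosets;
  the missing trivial coset is paid for by \<open>Suc t\<close> in the exponent.\<close>

lemma dense_if_meets_subspaces:
  assumes U: "subspace U" "finite U" and Y: "0 \<notin> Y"
    and small: "\<And>W. subspace W \<Longrightarrow> W \<subseteq> U \<Longrightarrow> W \<inter> Y = {} \<Longrightarrow> dim W \<le> t"
    and dim: "Suc t \<le> dim U"
  shows "2 ^ (dim U - Suc t) \<le> card (Y \<inter> U)"
proof -
  define Q where "Q W \<longleftrightarrow> subspace W \<and> W \<subseteq> U \<and> W \<inter> Y = {}" for W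
  have "Q {0}" using U Y by (auto simp: Q_def subspace_iff)
  moreover have "finite {W. Q W}"
    using U(2) by (rule finite_subset[rotated, OF finite_Pow_iff[THEN iffD2]]) (auto simp: Q_def)
  ultimately obtain F where F: "Q F" and max: "\<And>W. Q W \<Longrightarrow> F \<subseteq> W \<Longrightarrow> W = F"
    using finite_has_maximal[of "{A. Q A}"] by auto
  then have sF: "subspace F" "F \<subseteq> U" "F \<inter> Y = {}" by (auto simp: Q_def)
  obtain A where A: "subspace A" "A \<subseteq> U" "A \<inter> F = {0}" "dim U = dim F + dim A"
    using complement_exists[OF sF(1) U(1) U(2) sF(2)] by blast
  have "\<exists>f\<in>F. a + f \<in> Y" if a: "a \<in> A - {0}" for a
  proof (rule ccontr)
    assume "\<not> ?thesis"
    then have no: "a + f \<notin> Y" if "f \<in> F" for f using that by blast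
    have "Q (ext a F)"
      unfolding Q_def
    proof (intro conjI)
      show "subspace (ext a F)" using sF subspace_ext by blast
      show "ext a F \<subseteq> U" using a A sF U by (intro ext_subset) auto
      show "ext a F \<inter> Y = {}" using no sF by (auto simp: ext_def)
    qed
    then have "ext a F = F" by (rule max) (auto simp: ext_def)
    then have "a \<in> F" using self_in_ext sF by metis
    then show False using a A by auto
  qed
  then obtain h where h: "\<And>a. a \<in> A - {0} \<Longrightarrow> h a \<in> F \<and> a + h a \<in> Y" by metis
  have inj: "inj_on (\<lambda>a. a + h a) (A - {0})"
  proof (rule inj_onI)
    fix a b assume ab: "a \<in> A - {0}" "b \<in> A - {0}" "a + h a = b + h b"
    then have "a + b = h a + h b"
      by (metis add.commute add.left_commute add_left_self)
    moreover have "h a + h b \<in> F" using h ab sF by (simp add: subspace_iff)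
    moreover have "a + b \<in> A" using ab A by (simp add: subspace_iff)
    ultimately have "a + b \<in> A \<inter> F" by simp
    then show "a = b" unfolding A(3) by simp
  qed
  have "(\<lambda>a. a + h a) ` (A - {0}) \<subseteq> Y \<inter> U"
    using h A sF U by (auto simp: subspace_iff subset_eq)
  then have "card (A - {0}) \<le> card (Y \<inter> U)"
    using card_inj_on_le[OF inj] U by blast
  moreover have "card (A - {0}) = 2 ^ dim A - 1"
    using A U card_subspace[OF A(1)] finite_subset[OF A(2)] by (simp add: subspace_iff)
  moreover have "2 ^ (dim U - Suc t) \<le> (2::nat) ^ dim A - 1"
  proof -
    have "dim F \<le> t" using small sF by blast
    then have "Suc (dim U - Suc t) \<le> dim A" using A(4) dim by simp
    then have "(2::nat) ^ Suc (dim U - Suc t) \<le> 2 ^ dim A" by (intro power_increasing) auto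
    then show ?thesis using one_le_power[of "2::nat" "dim U - Suc t"] by simp
  qed
  ultimately show ?thesis by simp
qed

text \<open>\<open>Y\<close> has density at least \<open>1 / N\<close> in every subspace of
  dimension above \<open>t\<close>. Each increment passes to a hyperplane and gains the factor
  \<open>1 + 1 / N\<close>, so after \<open>Suc t * N\<close> steps the density reaches 1, that is,
  a coset \<open>u + H\<close> lies in \<open>Y\<close>. If the dimension allows this many steps
  with \<open>dim H\<close> still above \<open>t\<close>, then \<open>Y\<close> also contains some
  \<open>h\<close> in \<open>H\<close>, and \<open>u\<close>, \<open>h\<close>, \<open>u + h\<close>
  is a triangle.\<close>

theorem triangle_free_dim_le:
  assumes U: "subspace U" "finite U" and Y: "Y \<subseteq> U" "0 \<notin> Y"
    and triangle_free: "\<And>x y. x \<in> Y \<Longrightarrow> y \<in> Y \<Longrightarrow> x + y \<notin> Y"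
    and small: "\<And>W. subspace W \<Longrightarrow> W \<subseteq> U \<Longrightarrow> W \<inter> Y = {} \<Longrightarrow> dim W \<le> t"
  shows "dim U \<le> Suc t * 2 ^ Suc t + t"
proof (rule ccontr)
  define N where "N = (2::nat) ^ Suc t"
  define n where "n = Suc t * N"
  assume "\<not> ?thesis"
  then have m: "n + Suc t \<le> dim U" by (simp add: n_def N_def)
  have N: "N > 0" by (simp add: N_def)
  then have N0: "real N > 0" by simp
  have dense: "card H \<le> N * card (Y \<inter> H)" if H: "subspace H" "H \<subseteq> U" "Suc t \<le> dim H" for H
  proof -
    have finH: "finite H" using H U finite_subset by blast
    have "2 ^ (dim H - Suc t) \<le> card (Y \<inter> H)"
      using dense_if_meets_subspaces[OF H(1) finH Y(2) small H(3)] H by blast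
    then have "N * 2 ^ (dim H - Suc t) \<le> N * card (Y \<inter> H)" by simp
    moreover have "N * 2 ^ (dim H - Suc t) = card H"
      unfolding card_subspace[OF H(1) finH] N_def power_add[symmetric] using H(3) by simp
    ultimately show ?thesis by simp
  qed
  have iterate: "\<exists>H u. subspace H \<and> H \<subseteq> U \<and> dim H + i = dim U \<and> u \<in> U \<and>
      (1 + 1 / real N) ^ i * real (card H) \<le> real N * real (card {y \<in> Y. u + y \<in> H})" if "i \<le> n" for i
    using that
  proof (induction i)
    case 0
    have "{y \<in> Y. 0 + y \<in> U} = Y \<inter> U" by auto
    moreover have "real (card U) \<le> real (N * card (Y \<inter> U))"
      using dense[OF U(1) subset_refl] m by (simp only: of_nat_le_iff)
    ultimately have "(1 + 1 / real N) ^ 0 * real (card U) \<le> real N * real (card {y \<in> Y. 0 + y \<in> U})"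
      by (simp only: power_0 mult_1 of_nat_mult)
    moreover have "0 \<in> U" using U subspace_0 by blast
    ultimately show ?case using U(1) by (intro exI[of _ U] exI[of _ 0]) simp
  next
    case (Suc i)
    then have "i \<le> n" by simp
    then obtain H u where H: "subspace H" "H \<subseteq> U" "dim H + i = dim U" "u \<in> U"
      and dens: "(1 + 1 / real N) ^ i * real (card H) \<le> real N * real (card {y \<in> Y. u + y \<in> H})"
      using Suc.IH by blast
    have finH: "finite H" using H U finite_subset by blast
    have dH: "Suc t \<le> dim H" using H m Suc.prems by simp
    define A where "A = {x \<in> H. u + x \<in> Y}"
    have cardA: "card A = card {y \<in> Y. u + y \<in> H}"
      by (rule card_eq_translate[of _ u]) (simp_all add: A_def)
    have cH: "card H = N * 2 ^ (dim H - Suc t)"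
      unfolding card_subspace[OF H(1) finH] N_def power_add[symmetric] using dH by simp
    have "2 ^ (dim H - Suc t) \<le> card (Y \<inter> H)"
      using dense[OF H(1,2) dH] N unfolding cH by simp
    \<comment> \<open>While \<open>A\<close> is a translate of part of \<open>Y\<close>,
      \<open>S\<close> consists of points of \<open>Y\<close> itself: this is what turns
      triangle-freeness into \<open>a + s \<notin> A\<close>. Having exactly
      \<open>card H / N\<close> elements, \<open>S\<close> yields the same factor
      \<open>1 + 1 / N\<close> at every step, and it is no larger than \<open>A\<close>, whose
      density is at least \<open>1 / N\<close>.\<close>
    then obtain S where S: "S \<subseteq> Y \<inter> H" "card S = 2 ^ (dim H - Suc t)"
      by (rule obtain_subset_with_card_n)
    have "1 \<le> (1 + 1 / real N) ^ i" using N0 by (intro one_le_power) simp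
    then have "1 * real (card H) \<le> (1 + 1 / real N) ^ i * real (card H)"
      by (rule mult_right_mono) simp
    then have "real (card H) \<le> real N * real (card A)"
      using dens unfolding cardA by linarith
    then have "real (N * card S) \<le> real (N * card A)"
      unfolding cH S(2) of_nat_mult .
    then have "card S \<le> card A" using N by (simp only: of_nat_le_iff mult_le_cancel1)
    moreover have "S \<noteq> {}" using S by auto
    moreover have "a + s \<notin> A" if "a \<in> A" "s \<in> S" for a s
      using that S triangle_free[of "u + a" s] by (auto simp: A_def add.assoc)
    moreover have "A \<subseteq> H" "S \<subseteq> H" using S by (auto simp: A_def)
    ultimately obtain H' v where H': "subspace H'" "H' \<subseteq> H" "dim H = Suc (dim H')" "v \<in> H"
      and incr: "card A * (card H + card S) \<le> 2 * card H * card {a \<in> A. v + a \<in> H'}"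
      using density_increment[OF H(1) finH, of A S] by blast
    have "card {a \<in> A. v + a \<in> H'} = card {y \<in> Y. (u + v) + y \<in> H'}"
    proof (rule card_eq_translate[of _ u])
      fix a assume "a \<in> {a \<in> A. v + a \<in> H'}"
      then show "u + a \<in> {y \<in> Y. u + v + y \<in> H'}" by (simp add: A_def ac_simps)
    next
      fix y assume y: "y \<in> {y \<in> Y. u + v + y \<in> H'}"
      then have "v + (u + v + y) \<in> H" using H H' by (auto simp: subspace_iff)
      then show "u + y \<in> {a \<in> A. v + a \<in> H'}" using y by (simp add: A_def ac_simps)
    qed
    then have "real (card A * (card H + card S)) \<le>
        real (2 * card H * card {y \<in> Y. (u + v) + y \<in> H'})"
      using incr by (simp only: of_nat_le_iff)
    then have "real (card A) * (real (card H) + real (card S)) \<le>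
        2 * real (card H) * real (card {y \<in> Y. (u + v) + y \<in> H'})"
      by (simp only: of_nat_mult of_nat_add of_nat_numeral)
    moreover have "real (card S) = real (card H) / real N"
      unfolding cH S(2) using N0 by simp
    moreover have H0: "real (card H) > 0" unfolding cH using N by simp
    ultimately have "real (card H) * (real (card A) * (1 + 1 / real N)) \<le>
        real (card H) * (2 * real (card {y \<in> Y. (u + v) + y \<in> H'}))"
      by (simp add: algebra_simps)
    then have A': "real (card A) * (1 + 1 / real N) \<le> 2 * real (card {y \<in> Y. (u + v) + y \<in> H'})"
      using H0 by simp
    have "2 * ((1 + 1 / real N) ^ Suc i * real (card H')) =
        (1 + 1 / real N) * ((1 + 1 / real N) ^ i * real (card H))"
      unfolding card_subspace[OF H(1) finH] card_subspace[OF H'(1) finite_subset[OF H'(2) finH]] H'(3)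
      by simp
    also have "\<dots> \<le> (1 + 1 / real N) * (real N * real (card A))"
      using dens N0 unfolding cardA by (intro mult_left_mono) simp_all
    also have "\<dots> = real N * (real (card A) * (1 + 1 / real N))" by (simp only: mult_ac)
    also have "\<dots> \<le> real N * (2 * real (card {y \<in> Y. (u + v) + y \<in> H'}))"
      using A' by (intro mult_left_mono) simp_all
    finally have "(1 + 1 / real N) ^ Suc i * real (card H') \<le>
        real N * real (card {y \<in> Y. (u + v) + y \<in> H'})" by linarith
    moreover have "v \<in> U" using H H' by blast
    then have "u + v \<in> U" using H U subspace_add by blast
    moreover have "H' \<subseteq> U" "dim H' + Suc i = dim U" using H H' by simp_all
    ultimately show ?case using H'(1) by blast
  qed
  obtain H u where H: "subspace H" "H \<subseteq> U" "dim H + n = dim U" "u \<in> U"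
    and dens: "(1 + 1 / real N) ^ n * real (card H) \<le> real N * real (card {y \<in> Y. u + y \<in> H})"
    using iterate[of n] by blast
  have finH: "finite H" using H U finite_subset by blast
  \<comment> \<open>\<open>N\<close> steps at least double the density, so \<open>Suc t\<close>
    rounds of \<open>N\<close> steps gain the factor \<open>N = 2 ^ Suc t\<close>.\<close>
  have "1 + real N * (1 / real N) \<le> (1 + 1 / real N) ^ N"
    using N0 by (intro Bernoulli_inequality) (simp add: field_simps)
  then have "2 ^ Suc t \<le> ((1 + 1 / real N) ^ N) ^ Suc t"
    using N0 by (intro power_mono) auto
  also have "\<dots> = (1 + 1 / real N) ^ n"
    unfolding n_def mult.commute[of "Suc t" N] power_mult ..
  finally have "real N \<le> (1 + 1 / real N) ^ n" by (simp add: N_def)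
  then have "real N * real (card H) \<le> (1 + 1 / real N) ^ n * real (card H)"
    by (intro mult_right_mono) auto
  then have "real N * real (card H) \<le> real N * real (card {y \<in> Y. u + y \<in> H})"
    using dens by linarith
  then have "card H \<le> card {y \<in> Y. u + y \<in> H}" using N0 by simp
  also have "\<dots> = card ((+) u ` {y \<in> Y. u + y \<in> H})" by (simp add: card_image inj_on_def)
  finally have eq: "(+) u ` {y \<in> Y. u + y \<in> H} = H"
    using finH by (intro card_seteq) auto
  have all: "u + h \<in> Y" if "h \<in> H" for h
  proof -
    have "h \<in> (+) u ` {y \<in> Y. u + y \<in> H}" unfolding eq by (fact that)
    then obtain y where "y \<in> Y" "h = u + y" by blast
    then show ?thesis by simp
  qed
  have "Y \<inter> H \<noteq> {}"
  proof
    assume "Y \<inter> H = {}"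
    then have "card H \<le> 0" using dense[OF H(1,2)] H(3) m by simp
    then show False using H finH by (auto simp: subspace_iff)
  qed
  then obtain h where "h \<in> Y" "h \<in> H" by blast
  moreover have "u + 0 \<in> Y" using all[of 0] H by (simp add: subspace_iff)
  ultimately show False using triangle_free[of u h] all[of h] by simp
qed

end

section \<open>The stabilizers of the cosets of a maximal disjoint subspace\<close>

text \<open>For subspaces, the quotient of \<open>sumset P Q\<close> by \<open>P \<inter> Q\<close>
  has four elements, and \<open>P\<close>, \<open>Q\<close>, \<open>R\<close> come from its three
  subgroups of order two. In particular the relation is symmetric.\<close>

definition trisection :: "'a::plus set \<Rightarrow> 'a set \<Rightarrow> 'a set \<Rightarrow> bool" where
  "trisection P Q R \<longleftrightarrow> P \<inter> Q = P \<inter> R \<and> P \<inter> Q = Q \<inter> R \<and>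
    index_two (P \<inter> Q) P \<and> index_two (P \<inter> Q) Q \<and> index_two (P \<inter> Q) R \<and>
    (\<forall>p \<in> P - Q. \<forall>q \<in> Q - P. p + q \<in> R)"

text \<open>If two of the spaces coincide, the third may be arbitrarily smaller, but larger only by
  index two. This asymmetry lets dimensions of stabilizers grow by at most one under addition, on
  which the filtration rests.\<close>

definition triangle_type :: "'a::plus set \<Rightarrow> 'a set \<Rightarrow> 'a set \<Rightarrow> bool" where
  "triangle_type P Q R \<longleftrightarrow>
    P = Q \<and> R \<subseteq> P \<or> P = R \<and> Q \<subseteq> P \<or> Q = R \<and> P \<subseteq> Q \<or>
    P = Q \<and> index_two P R \<or> P = R \<and> index_two P Q \<or> Q = R \<and> index_two Q P \<or>
    trisection P Q R"

text \<open>For subspaces this says that \<open>P \<subseteq> Q\<close>, or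
  \<open>P \<subseteq> R\<close>, or \<open>P \<inter> Q = P \<inter> R\<close> has index two in
  \<open>P\<close>. The form given here is what a claw containing two points with difference
  \<open>s\<close> yields.\<close>

definition half_closed :: "'a::plus set \<Rightarrow> 'a set \<Rightarrow> 'a set \<Rightarrow> bool" where
  "half_closed P Q R \<longleftrightarrow> (\<forall>s \<in> P - Q. \<forall>u \<in> P. u \<in> R \<or> u + s \<in> R)"

context binary_space
begin

text \<open>If some \<open>s\<close> in \<open>P - Q\<close> lies in \<open>R\<close>, then
  \<open>u + s \<in> R\<close> implies \<open>u \<in> R\<close>, so \<open>R = P\<close>; likewise
  with \<open>Q\<close> and \<open>R\<close> exchanged. Failing both, \<open>Q = R\<close>, and the
  hypothesis becomes index two.\<close>

lemma half_closed_sup: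
  assumes "subspace P" "subspace Q" "subspace R" "Q \<subseteq> P" "R \<subseteq> P"
    and "half_closed P Q R" "half_closed P R Q"
  shows "P = Q \<or> P = R \<or> Q = R \<and> index_two Q P"
proof (rule ccontr)
  assume "\<not> ?thesis"
  then have nPQ: "P \<noteq> Q" and ne: "P \<noteq> R" "\<not> (Q = R \<and> index_two Q P)" by simp_all
  have R: "R = P" if "s \<in> P - Q" "s \<in> R" for s
  proof -
    have "u \<in> R" if "u \<in> P" for u
      using assms(6) \<open>s \<in> P - Q\<close> \<open>s \<in> R\<close> that subspace_add_iff(2)[OF assms(3), of s u]
      unfolding half_closed_def by blast
    then show ?thesis using assms by blast
  qed
  have Q: "Q = P" if "s \<in> P - R" "s \<in> Q" for s
  proof -
    have "u \<in> Q" if "u \<in> P" for u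
      using assms(7) \<open>s \<in> P - R\<close> \<open>s \<in> Q\<close> that subspace_add_iff(2)[OF assms(2), of s u]
      unfolding half_closed_def by blast
    then show ?thesis using assms by blast
  qed
  have eq: "Q = R" using R Q nPQ ne(1) assms(4,5) by blast
  have "u + v \<in> Q" if "u \<in> P - Q" "v \<in> P - Q" for u v
    using assms(6) that unfolding half_closed_def eq by (metis DiffE add.commute)
  then have "index_two Q P" using nPQ assms(4) by (auto simp: index_two_def)
  then show False using ne eq by blast
qed

text \<open>The six half-closedness conditions settle the case that one space contains the other
  two. Otherwise \<open>union\<close> with one summand 0 sends \<open>P - Q\<close> plus
  \<open>Q - P\<close> into \<open>R\<close>, and similarly for the other pairs. This excludes every
  inclusion, and because a subspace covered by two subspaces lies in one of them, the pairwise
  intersections agree.\<close>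

lemma triangle_typeI:
  assumes sub: "subspace P" "subspace Q" "subspace R"
    and union: "\<And>a b c. a \<in> P \<Longrightarrow> b \<in> Q \<Longrightarrow> c \<in> R \<Longrightarrow> a + b + c \<in> P \<union> Q \<union> R"
    and half: "half_closed P Q R" "half_closed P R Q" "half_closed Q P R" "half_closed Q R P"
      "half_closed R P Q" "half_closed R Q P"
  shows "triangle_type P Q R"
proof -
  consider "Q \<subseteq> P" "R \<subseteq> P" | "P \<subseteq> Q" "R \<subseteq> Q" | "P \<subseteq> R" "Q \<subseteq> R"
    | "\<not> (Q \<subseteq> P \<and> R \<subseteq> P)" "\<not> (P \<subseteq> Q \<and> R \<subseteq> Q)" "\<not> (P \<subseteq> R \<and> Q \<subseteq> R)" by blast
  then show ?thesis
  proof cases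
    case 1
    then show ?thesis
      using half_closed_sup[OF sub(1) sub(2) sub(3) 1 half(1) half(2)] unfolding triangle_type_def by blast
  next
    case 2
    then show ?thesis
      using half_closed_sup[OF sub(2) sub(1) sub(3) 2 half(3) half(4)] unfolding triangle_type_def by blast
  next
    case 3
    then show ?thesis
      using half_closed_sup[OF sub(3) sub(1) sub(2) 3 half(5) half(6)] unfolding triangle_type_def by blast
  next
    case 4
    have zero: "0 \<in> P" "0 \<in> Q" "0 \<in> R" using sub by (auto simp: subspace_iff)
    have PQ: "a + b \<in> R" if "a \<in> P - Q" "b \<in> Q - P" for a b
      using union[of a b 0] that zero subspace_add_iff[OF sub(1), of a b]
        subspace_add_iff[OF sub(2), of b a] by auto
    have PR: "a + c \<in> Q" if "a \<in> P - R" "c \<in> R - P" for a c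
      using union[of a 0 c] that zero subspace_add_iff[OF sub(1), of a c]
        subspace_add_iff[OF sub(3), of c a] by auto
    have QR: "b + c \<in> P" if "b \<in> Q - R" "c \<in> R - Q" for b c
      using union[of 0 b c] that zero subspace_add_iff[OF sub(2), of b c]
        subspace_add_iff[OF sub(3), of c b] by auto
    have no_union: "A \<subseteq> B \<or> A \<subseteq> C" if "subspace A" "subspace B" "subspace C" "A \<subseteq> B \<union> C" for A B C
    proof (rule ccontr)
      assume "\<not> ?thesis"
      then obtain x y where xy: "x \<in> A" "x \<notin> B" "y \<in> A" "y \<notin> C" by blast
      then have "x \<in> C" "y \<in> B" using that by auto
      then have "x + y \<notin> B" "x + y \<notin> C"
        using xy that subspace_add_iff by metis+
      then show False using xy that by (auto simp: subspace_iff)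
    qed
    have not_sub: "\<not> A \<subseteq> B"
      if hyp: "subspace B" "\<not> (A \<subseteq> B \<and> C \<subseteq> B)" "\<not> (A \<subseteq> C \<and> B \<subseteq> C)"
        and sum: "\<And>b c. b \<in> B - C \<Longrightarrow> c \<in> C - B \<Longrightarrow> b + c \<in> A" for A B C
    proof
      assume AB: "A \<subseteq> B"
      then obtain b c where bc: "b \<in> B - C" "c \<in> C - B" using hyp by blast
      then have "b + c \<in> B" using sum AB by blast
      then show False using bc subspace_add_iff(1)[OF hyp(1), of b c] by blast
    qed
    have QP: "b + a \<in> R" if "b \<in> Q - P" "a \<in> P - Q" for a b
      using PQ[OF that(2,1)] by (simp add: add.commute)
    have RP: "c + a \<in> Q" if "c \<in> R - P" "a \<in> P - R" for a c
      using PR[OF that(2,1)] by (simp add: add.commute)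
    have RQ: "c + b \<in> P" if "c \<in> R - Q" "b \<in> Q - R" for b c
      using QR[OF that(2,1)] by (simp add: add.commute)
    have n: "\<not> (R \<subseteq> P \<and> Q \<subseteq> P)" "\<not> (R \<subseteq> Q \<and> P \<subseteq> Q)" "\<not> (Q \<subseteq> R \<and> P \<subseteq> R)"
      using 4 by blast+
    note inc = not_sub[OF sub(2) 4(2) 4(3) QR] not_sub[OF sub(1) 4(1) n(3) PR]
      not_sub[OF sub(3) 4(3) 4(2) RQ] not_sub[OF sub(1) n(1) n(2) PQ]
      not_sub[OF sub(3) n(3) 4(1) RP] not_sub[OF sub(2) n(2) n(1) QP]
    have PRQ: "P \<inter> R \<subseteq> Q"
    proof (rule ccontr)
      assume "\<not> ?thesis"
      then obtain c where c: "c \<in> P" "c \<in> R" "c \<notin> Q" by blast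
      have "b \<in> P" if "b \<in> Q" "b \<notin> R" for b
        using QR[of b c] c that subspace_add_iff(2)[OF sub(1) c(1), of b] by blast
      then show False using no_union[OF sub(2) sub(1) sub(3)] inc by blast
    qed
    have PQR: "P \<inter> Q \<subseteq> R"
    proof (rule ccontr)
      assume "\<not> ?thesis"
      then obtain c where c: "c \<in> P" "c \<in> Q" "c \<notin> R" by blast
      have "b \<in> P" if "b \<in> R" "b \<notin> Q" for b
        using QR[of c b] c that subspace_add_iff(1)[OF sub(1) c(1), of b] by blast
      then show False using no_union[OF sub(3) sub(1) sub(2)] inc by blast
    qed
    have QRP: "Q \<inter> R \<subseteq> P"
    proof (rule ccontr)
      assume "\<not> ?thesis"
      then obtain c where c: "c \<in> Q" "c \<in> R" "c \<notin> P" by blast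
      have "b \<in> Q" if "b \<in> P" "b \<notin> R" for b
        using PR[of b c] c that subspace_add_iff(2)[OF sub(2) c(1), of b] by blast
      then show False using no_union[OF sub(1) sub(2) sub(3)] inc by blast
    qed
    have eq: "P \<inter> Q = P \<inter> R" "P \<inter> Q = Q \<inter> R" using PRQ PQR QRP by blast+
    obtain p q r where p: "p \<in> P" "p \<notin> Q" and q: "q \<in> Q" "q \<notin> P" and r: "r \<in> R" "r \<notin> P"
      using inc by blast
    have rQ: "r \<notin> Q" and pR: "p \<notin> R" and qR: "q \<notin> R" using r p q eq by blast+
    have "u + v \<in> P \<inter> Q" if "u \<in> P - P \<inter> Q" "v \<in> P - P \<inter> Q" for u v
    proof -
      \<comment> \<open>Adding \<open>q\<close> moves both elements into \<open>R\<close>, and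
        \<open>q\<close> cancels in the sum.\<close>
      have "(u + q) + (v + q) \<in> R" using PQ[of u q] PQ[of v q] that q subspace_add[OF sub(3)] by blast
      then have "u + v \<in> R" by (simp add: ac_simps)
      moreover have "u + v \<in> P" using that subspace_add[OF sub(1)] by blast
      ultimately show ?thesis using eq by blast
    qed
    then have iP: "index_two (P \<inter> Q) P" unfolding index_two_def using inc by blast
    have "u + v \<in> P \<inter> Q" if "u \<in> Q - P \<inter> Q" "v \<in> Q - P \<inter> Q" for u v
    proof -
      have "(p + u) + (p + v) \<in> R" using PQ[of p u] PQ[of p v] that p subspace_add[OF sub(3)] by blast
      then have "u + v \<in> R" by (simp add: ac_simps)
      moreover have "u + v \<in> Q" using that subspace_add[OF sub(2)] by blast
      ultimately show ?thesis using eq by blast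
    qed
    then have iQ: "index_two (P \<inter> Q) Q" unfolding index_two_def using inc by blast
    have "u + v \<in> P \<inter> Q" if "u \<in> R - P \<inter> Q" "v \<in> R - P \<inter> Q" for u v
    proof -
      have "u \<notin> P" "v \<notin> P" using that eq by blast+
      then have "(p + u) + (p + v) \<in> Q" using PR[of p u] PR[of p v] that p pR subspace_add[OF sub(2)] by blast
      then have "u + v \<in> Q" by (simp add: ac_simps)
      moreover have "u + v \<in> R" using that subspace_add[OF sub(3)] by blast
      ultimately show ?thesis using eq by blast
    qed
    moreover have "P \<inter> Q \<subset> R"
      unfolding eq(1) using inc by blast
    ultimately have iR: "index_two (P \<inter> Q) R" unfolding index_two_def by blast
    have "\<forall>p \<in> P - Q. \<forall>q \<in> Q - P. p + q \<in> R" using PQ by blast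
    then have "trisection P Q R"
      unfolding trisection_def using eq iP iQ iR by (intro conjI)
    then show ?thesis unfolding triangle_type_def by (intro disjI2)
  qed
qed

end

section \<open>Claw-free sets relative to a maximal disjoint subspace\<close>

locale claw_free_config = binary_space scale
  for scale :: "bit \<Rightarrow> 'a::ab_group_add \<Rightarrow> 'a" +
  fixes V E S :: "'a set"
  assumes V: "subspace V" "finite V"
    and E: "E \<subseteq> V"
    and claw: "\<And>x y z. x \<in> E \<Longrightarrow> y \<in> E \<Longrightarrow> z \<in> E \<Longrightarrow> x \<noteq> y \<Longrightarrow> z \<noteq> x \<Longrightarrow> z \<noteq> y \<Longrightarrow> z \<noteq> x + y \<Longrightarrow>
        x + y \<in> E \<or> x + z \<in> E \<or> y + z \<in> E \<or> x + y + z \<in> E"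
    and S: "subspace S" "S \<subseteq> V" "S \<inter> E = {}"
    and S_maximal: "\<And>x. x \<in> V \<Longrightarrow> x \<notin> S \<Longrightarrow> \<exists>s\<in>S. x + s \<in> E"
begin

text \<open>The stabilizer in \<open>S\<close> of the part of \<open>E\<close> in
  \<open>x + S\<close>; one inclusion suffices because translations are involutions. No point of
  \<open>E\<close> is fixed, so the value depends on the coset only. On \<open>S\<close> itself,
  which \<open>E\<close> avoids, the value is all of \<open>S\<close>, so only cosets other than
  \<open>S\<close> carry information.\<close>

definition K :: "'a \<Rightarrow> 'a set" where
  "K x = {s \<in> S. \<forall>u \<in> S. x + u \<in> E \<longrightarrow> x + u + s \<in> E}"

lemma E_notin_S: "e \<in> E \<Longrightarrow> e \<notin> S"
  using S by blast

lemma zero_S: "0 \<in> S"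
  using S by (simp add: subspace_iff)

lemma S_add: "x \<in> S \<Longrightarrow> y \<in> S \<Longrightarrow> x + y \<in> S"
  using S by (simp add: subspace_iff)

lemma S_add_iff: "x \<in> S \<Longrightarrow> x + y \<in> S \<longleftrightarrow> y \<in> S" "x \<in> S \<Longrightarrow> y + x \<in> S \<longleftrightarrow> y \<in> S"
  using subspace_add_iff S by blast+

lemma finite_S: "finite S"
  using S V finite_subset by blast

text \<open>Claw-freeness for \<open>e\<close>, \<open>e + s\<close>, \<open>e + t\<close>: sums of
  two of these lie in \<open>S\<close>, hence outside \<open>E\<close>, and only the sum of all
  three is left.\<close>

lemma coset_affine:
  assumes "e \<in> E" "s \<in> S" "t \<in> S" "e + s \<in> E" "e + t \<in> E"
  shows "e + s + t \<in> E"
proof (cases "s = 0 \<or> t = 0 \<or> s = t")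
  case True
  then show ?thesis using assms by (auto simp: add.assoc)
next
  case False
  have "e + t \<noteq> e + (e + s)"
    using assms E_notin_S S_add_iff by (metis add_left_self)
  then have "e + (e + s) \<in> E \<or> e + (e + t) \<in> E \<or> e + s + (e + t) \<in> E \<or> e + (e + s) + (e + t) \<in> E"
    using assms False by (intro claw) auto
  moreover have "s \<notin> E" "t \<notin> E" "s + t \<notin> E" using assms S_add E_notin_S by blast+
  ultimately show ?thesis by (simp add: ac_simps)
qed

lemma K_D: "s \<in> K x \<Longrightarrow> u \<in> S \<Longrightarrow> x + u \<in> E \<Longrightarrow> x + u + s \<in> E"
  unfolding K_def by blast

lemma K_I: "s \<in> S \<Longrightarrow> (\<And>u. u \<in> S \<Longrightarrow> x + u \<in> E \<Longrightarrow> x + u + s \<in> E) \<Longrightarrow> s \<in> K x"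
  unfolding K_def by blast

lemma K_subset: "K x \<subseteq> S"
  unfolding K_def by blast

lemma K_iff:
  assumes "e \<in> E"
  shows "s \<in> K e \<longleftrightarrow> s \<in> S \<and> e + s \<in> E"
proof
  assume "s \<in> K e"
  then show "s \<in> S \<and> e + s \<in> E" using K_D[of s e 0] K_subset assms zero_S by auto
next
  assume "s \<in> S \<and> e + s \<in> E"
  then show "s \<in> K e" using coset_affine[OF assms] by (intro K_I) blast+
qed

lemma finite_K: "finite (K x)"
  using K_subset finite_S finite_subset by blast

lemma K_shift_subset:
  assumes "s \<in> S"
  shows "K x \<subseteq> K (x + s)"
proof
  fix t assume t: "t \<in> K x"
  show "t \<in> K (x + s)"
  proof (rule K_I)
    show "t \<in> S" using t K_subset by blast
    fix u assume "u \<in> S" "x + s + u \<in> E"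
    then show "x + s + u + t \<in> E"
      using K_D[OF t, of "s + u"] S_add[OF assms] by (simp add: add.assoc)
  qed
qed

lemma K_shift:
  assumes "s \<in> S"
  shows "K (x + s) = K x"
proof
  have "K (x + s) \<subseteq> K (x + s + s)" using assms by (rule K_shift_subset)
  then show "K (x + s) \<subseteq> K x" by (simp add: add.assoc)
qed (rule K_shift_subset[OF assms])

lemma subspace_K: "subspace (K x)"
proof (rule subspaceI)
  show "0 \<in> K x" using zero_S by (intro K_I) simp_all
next
  fix s t assume s: "s \<in> K x" and t: "t \<in> K x"
  then have SS: "s \<in> S" "t \<in> S" using K_subset by auto
  show "s + t \<in> K x"
  proof (rule K_I)
    show "s + t \<in> S" using SS S_add by blast
    fix u assume u: "u \<in> S" "x + u \<in> E"
    then have "x + (u + s) \<in> E" using K_D[OF s u] by (simp add: add.assoc)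
    then show "x + u + (s + t) \<in> E"
      using K_D[OF t, of "u + s"] S_add[OF u(1) SS(1)] by (simp add: add.assoc)
  qed
qed

lemma K_eq_if_coset:
  assumes "x + y \<in> S"
  shows "K x = K y"
  using K_shift[OF assms, of x] unfolding add_left_self by (rule sym)

text \<open>With \<open>w = x + y + z\<close>, the sums of two of the points are
  \<open>z + w\<close>, \<open>y + w\<close> and \<open>x + w\<close>, while \<open>w\<close> lies
  in \<open>S\<close> and so outside \<open>E\<close>. Claw-freeness puts one of the three shifted
  points into \<open>E\<close>.\<close>

lemma sum_in_K:
  assumes "x \<in> E" "y \<in> E" "z \<in> E" "x + y + z \<in> S"
  shows "x + y + z \<in> K x \<or> x + y + z \<in> K y \<or> x + y + z \<in> K z"
proof (rule ccontr)
  assume no: "\<not> ?thesis"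
  then have "x + (x + y + z) \<notin> E" "y + (x + y + z) \<notin> E" "z + (x + y + z) \<notin> E"
    using assms K_iff by blast+
  then have "y + z \<notin> E" "x + z \<notin> E" "x + y \<notin> E" by (simp_all add: ac_simps)
  moreover have "x + y + z \<notin> E" using assms E_notin_S by blast
  moreover have "x \<noteq> y"
  proof
    assume "x = y"
    then have "x + y + z = z" by simp
    then have "z \<in> S" using assms(4) by (simp only:)
    then show False using assms(3) E_notin_S by blast
  qed
  moreover have "z \<noteq> x"
  proof
    assume "z = x"
    then have "x + y + z = y" by (simp add: ac_simps)
    then have "y \<in> S" using assms(4) by (simp only:)
    then show False using assms(2) E_notin_S by blast
  qed
  moreover have "z \<noteq> y"
  proof
    assume "z = y"
    then have "x + y + z = x" by (simp add: ac_simps)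
    then have "x \<in> S" using assms(4) by (simp only:)
    then show False using assms(1) E_notin_S by blast
  qed
  moreover have "z \<noteq> x + y" using no subspace_0[OF subspace_K, of x] by auto
  ultimately show False using claw[OF assms(1-3)] by simp
qed

text \<open>Maximality of \<open>S\<close> provides a point \<open>x + y + s\<close> of
  \<open>E\<close>. Its sum with \<open>x\<close> and \<open>y\<close> is \<open>s\<close>, which by
  \<open>sum_in_K\<close> stabilizes one of the three cosets and can be absorbed there.\<close>

lemma triangle_exists:
  assumes "x \<in> E" "y \<in> E" "x + y \<notin> S"
  obtains s t where "s \<in> K x" "t \<in> K y" "(x + s) + (y + t) \<in> E"
proof -
  have "x + y \<in> V" using assms E V by (auto simp: subspace_iff)
  then obtain s where s: "s \<in> S" "x + y + s \<in> E" using S_maximal assms by blast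
  have eq: "x + y + (x + y + s) = s" by (simp add: ac_simps)
  have "s \<in> K x \<or> s \<in> K y \<or> s \<in> K (x + y + s)"
    using sum_in_K[OF assms(1,2) s(2)] unfolding eq using s by blast
  then show ?thesis
  proof (elim disjE)
    assume "s \<in> K x" show ?thesis
      by (rule that[of s 0]) (use \<open>s \<in> K x\<close> s subspace_0[OF subspace_K] in \<open>simp_all add: ac_simps\<close>)
  next
    assume "s \<in> K y" show ?thesis
      by (rule that[of 0 s]) (use \<open>s \<in> K y\<close> s subspace_0[OF subspace_K] in \<open>simp_all add: ac_simps\<close>)
  next
    assume "s \<in> K (x + y + s)"
    then have "x + y + s + s \<in> E" using s K_iff by blast
    then have "x + y \<in> E" by (simp add: add.assoc)
    then show ?thesis
      by (intro that[of 0 0]) (use subspace_0[OF subspace_K] in simp_all)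
  qed
qed

text \<open>Claw-freeness for \<open>x + u\<close>, \<open>x + u + s\<close> and \<open>y\<close>:
  the first two add up to \<open>s\<close>, all three to \<open>y + s\<close>, and both are outside
  \<open>E\<close>. The two remaining sums are those in the conclusion.\<close>

lemma half_closed_K:
  assumes "x \<in> E" "y \<in> E" "x + y \<in> E"
  shows "half_closed (K x) (K y) (K (x + y))"
  unfolding half_closed_def
proof (intro ballI)
  fix s u assume s: "s \<in> K x - K y" and u: "u \<in> K x"
  have SS: "s \<in> S" "u \<in> S" using s u K_subset by auto
  have xu: "x + u \<in> E" using u assms K_iff by blast
  have "K (x + u) = K x" using K_shift SS by blast
  then have xus: "x + u + s \<in> E" using s xu K_iff by blast
  have ys: "y + s \<notin> E" using s SS assms K_iff by blast
  have ne: "s \<noteq> 0" using s subspace_0[OF subspace_K, of y] by auto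
  have nS: "x + y \<notin> S" using assms E_notin_S by blast
  have "y \<noteq> x + u"
    using nS SS by auto
  moreover have "y \<noteq> x + u + s"
    using nS SS S_add[of u s] by (auto simp: add.assoc)
  moreover have "y \<noteq> x + u + (x + u + s)"
    using SS E_notin_S assms by (auto simp: ac_simps)
  ultimately have "x + u + (x + u + s) \<in> E \<or> x + u + y \<in> E \<or> x + u + s + y \<in> E \<or> x + u + (x + u + s) + y \<in> E"
    using xu xus assms ne by (intro claw) auto
  then have "s \<in> E \<or> x + y + u \<in> E \<or> x + y + (u + s) \<in> E \<or> y + s \<in> E"
    by (simp add: ac_simps)
  then have "x + y + u \<in> E \<or> x + y + (u + s) \<in> E" using ys SS E_notin_S by blast
  then show "u \<in> K (x + y) \<or> u + s \<in> K (x + y)"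
    using K_iff[OF assms(3)] SS S_add by blast
qed

lemma triangle_type_K_triangle:
  assumes "x \<in> E" "y \<in> E" "x + y \<in> E"
  shows "triangle_type (K x) (K y) (K (x + y))"
proof (rule triangle_typeI)
  fix a b c assume abc: "a \<in> K x" "b \<in> K y" "c \<in> K (x + y)"
  have SS: "a \<in> S" "b \<in> S" "c \<in> S" using abc K_subset by auto
  have eq: "(x + a) + (y + b) + (x + y + c) = a + b + c" by (simp add: ac_simps)
  have "x + a \<in> E" "y + b \<in> E" "x + y + c \<in> E" using abc assms K_iff by blast+
  then have "a + b + c \<in> K (x + a) \<or> a + b + c \<in> K (y + b) \<or> a + b + c \<in> K (x + y + c)"
    using sum_in_K[of "x + a" "y + b" "x + y + c"] SS S_add unfolding eq by blast
  then show "a + b + c \<in> K x \<union> K y \<union> K (x + y)" using SS K_shift by auto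
next
  have "x + (x + y) \<in> E" "y + (x + y) \<in> E" "x + y + x \<in> E" "x + y + y \<in> E" "y + x \<in> E"
    using assms by (simp_all add: ac_simps)
  note h = half_closed_K[OF assms] half_closed_K[OF assms(1,3) this(1)]
    half_closed_K[OF assms(2,1) this(5)] half_closed_K[OF assms(2,3) this(2)]
    half_closed_K[OF assms(3,1) this(3)] half_closed_K[OF assms(3,2) this(4)]
  show "half_closed (K x) (K y) (K (x + y))" "half_closed (K x) (K (x + y)) (K y)"
    "half_closed (K y) (K x) (K (x + y))" "half_closed (K y) (K (x + y)) (K x)"
    "half_closed (K (x + y)) (K x) (K y)" "half_closed (K (x + y)) (K y) (K x)"
    using h by (simp_all add: ac_simps)
qed (rule subspace_K)+

lemma coset_meets_E:
  assumes "x \<in> V" "x \<notin> S"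
  obtains e where "e \<in> E" "x + e \<in> S" "K e = K x"
proof -
  obtain s where s: "s \<in> S" "x + s \<in> E" using S_maximal assms by blast
  then show ?thesis using that[of "x + s"] K_shift by simp
qed

lemma triangle_type_K:
  assumes "x \<in> V" "y \<in> V" "x \<notin> S" "y \<notin> S" "x + y \<notin> S"
  shows "triangle_type (K x) (K y) (K (x + y))"
proof -
  obtain d where d: "d \<in> E" "x + d \<in> S" "K d = K x"
    by (rule coset_meets_E[OF assms(1,3)])
  obtain e where e: "e \<in> E" "y + e \<in> S" "K e = K y"
    by (rule coset_meets_E[OF assms(2,4)])
  have xy: "(x + d) + (y + e) \<in> S" by (rule S_add[OF d(2) e(2)])
  have "d + e \<notin> S"
  proof
    assume "d + e \<in> S"
    then have "(d + e) + ((x + d) + (y + e)) \<in> S" using xy by (rule S_add)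
    then show False using assms(5) by (simp add: ac_simps)
  qed
  then obtain s t where s: "s \<in> K d" and t: "t \<in> K e" and st: "(d + s) + (e + t) \<in> E"
    by (rule triangle_exists[OF d(1) e(1)])
  have SS: "s \<in> S" "t \<in> S" using s t K_subset by auto
  have "d + s \<in> E" "e + t \<in> E" using s t K_iff[OF d(1)] K_iff[OF e(1)] by simp_all
  then have "triangle_type (K (d + s)) (K (e + t)) (K ((d + s) + (e + t)))"
    using st by (rule triangle_type_K_triangle)
  moreover have "K (d + s) = K x" "K (e + t) = K y"
    using K_shift[OF SS(1)] K_shift[OF SS(2)] d(3) e(3) by simp_all
  moreover have "((x + d) + (y + e)) + (s + t) \<in> S" by (rule S_add[OF xy S_add[OF SS]])
  then have "((d + s) + (e + t)) + (x + y) \<in> S" by (simp add: ac_simps)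
  then have "K ((d + s) + (e + t)) = K (x + y)" by (rule K_eq_if_coset)
  ultimately show ?thesis by (simp only:)
qed

text \<open>The main device for building flats inside \<open>E\<close>: the correction needed in
  \<open>triangle_exists\<close> is here a shift by an element of \<open>K (x + y)\<close>, so it
  can be undone.\<close>

lemma sum_in_E:
  assumes "x \<in> E" "y \<in> E" "x + y \<notin> S" and sub: "K x \<subseteq> K (x + y)" "K y \<subseteq> K (x + y)"
  shows "x + y \<in> E"
proof -
  obtain s t where s: "s \<in> K x" and t: "t \<in> K y" and st: "(x + s) + (y + t) \<in> E"
    by (rule triangle_exists[OF assms(1-3)])
  have k: "s + t \<in> K (x + y)"
    by (rule subspace_add[OF subspace_K subsetD[OF sub(1) s] subsetD[OF sub(2) t]])
  have S: "s + t \<in> S" by (rule subsetD[OF K_subset k])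
  have "(x + s) + (y + t) = x + y + (s + t)" by (simp only: ac_simps)
  then have z: "x + y + (s + t) \<in> E" using st by (simp only:)
  have "x + y + (s + t) + (s + t) \<in> E" by (rule K_D[OF k S z])
  then show ?thesis by (simp only: add.assoc add_self add_0_right)
qed

end

section \<open>Flats inside the ground set\<close>

context claw_free_config
begin

text \<open>A flat inside \<open>E\<close> together with the zero vector. It meets \<open>S\<close>
  only in 0, so its dimension is not lost modulo \<open>S\<close>.\<close>

definition eflat :: "'a set \<Rightarrow> bool" where
  "eflat W \<longleftrightarrow> subspace W \<and> W - {0} \<subseteq> E"

lemma zero_not_E: "0 \<notin> E"
  using zero_S E_notin_S by blast

lemma eflat_subset: "eflat W \<Longrightarrow> W \<subseteq> V"
  unfolding eflat_def using E subspace_0[OF V(1)] by blast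

lemma eflat_int_S: "eflat W \<Longrightarrow> W \<inter> S = {0}"
  unfolding eflat_def using S(3) zero_S subspace_0 by blast

lemma eflat_finite: "eflat W \<Longrightarrow> finite W"
  using eflat_subset V(2) finite_subset by blast

lemma eflat_zero: "eflat {0}"
  by (simp add: eflat_def subspace_iff)

lemma eflat_extI:
  assumes "eflat W" "e \<in> E" "\<And>w. w \<in> W - {0} \<Longrightarrow> w + e \<in> E"
  shows "eflat (ext e W)"
proof -
  have "e + w \<in> E" if "w \<in> W" for w
    using that assms(2) assms(3)[of w] by (cases "w = 0") (simp_all add: add.commute)
  then have "ext e W - {0} \<subseteq> E"
    using assms(1) by (auto simp: eflat_def ext_def)
  then show ?thesis
    using assms(1) by (simp add: eflat_def subspace_ext)
qed

text \<open>Greedy principle: a maximal flat \<open>W\<close> in \<open>E\<close> inside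
  \<open>B\<close> satisfies \<open>sumset W S = B\<close>, since otherwise the point
  \<open>e\<close> provided for a new coset would enlarge it.\<close>

lemma eflat_exists_if_extends:
  assumes B: "subspace B" "S \<subseteq> B" "B \<subseteq> V"
    and extends: "\<And>W x. eflat W \<Longrightarrow> W \<subseteq> B \<Longrightarrow> x \<in> B \<Longrightarrow> x \<notin> sumset W S \<Longrightarrow>
      \<exists>e\<in>E. x + e \<in> S \<and> (\<forall>w\<in>W - {0}. w + e \<in> E)"
  shows "\<exists>W. eflat W \<and> W \<subseteq> B \<and> dim B = dim W + dim S"
proof -
  define Q where "Q W \<longleftrightarrow> eflat W \<and> W \<subseteq> B" for W
  have "Q {0}" using eflat_zero subspace_0[OF B(1)] by (simp add: Q_def)
  moreover have finB: "finite B" using B(3) V(2) by (rule finite_subset)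
  then have "finite {W. Q W}"
    by (rule finite_subset[rotated, OF finite_Pow_iff[THEN iffD2]]) (auto simp: Q_def)
  ultimately obtain W where W: "Q W" and max: "\<And>W'. Q W' \<Longrightarrow> W \<subseteq> W' \<Longrightarrow> W' = W"
    using finite_has_maximal[of "{W. Q W}"] by auto
  then have sW: "eflat W" "W \<subseteq> B" by (simp_all add: Q_def)
  then have subW: "subspace W" by (simp add: eflat_def)
  have "x \<in> sumset W S" if x: "x \<in> B" for x
  proof (rule ccontr)
    assume nx: "x \<notin> sumset W S"
    then obtain e where e: "e \<in> E" "x + e \<in> S" "\<And>w. w \<in> W - {0} \<Longrightarrow> w + e \<in> E"
      using extends[OF sW x] by blast
    have "x + e \<in> B" using e(2) B(2) by (rule subsetD[rotated])
    then have eB: "e \<in> B" by (simp add: subspace_add_iff[OF B(1) x])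
    have "Q (ext e W)"
      using eflat_extI[OF sW(1) e(1,3)] ext_subset[OF B(1) sW(2) eB] by (simp add: Q_def)
    then have "ext e W = W" by (rule max) (simp add: ext_def)
    then have "e \<in> W" using self_in_ext[OF subW, of e] by simp
    then have "e + (x + e) \<in> sumset W S" using e(2) by (rule sumsetI)
    then show False using nx by (simp add: ac_simps)
  qed
  then have "sumset W S = B" using sumset_subset[OF B(1) sW(2) B(2)] by blast
  then have "dim B = dim W + dim S"
    using dim_sumset[OF subW S(1) eflat_finite[OF sW(1)] finite_S eflat_int_S[OF sW(1)]] by simp
  then show ?thesis using sW by blast
qed

lemma add_notin_sumset:
  assumes "x \<notin> sumset W S" "x + e \<in> S" "w \<in> W"
  shows "w + e \<notin> S"
proof
  assume "w + e \<in> S"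
  then have "(w + e) + (x + e) \<in> S" using assms(2) by (rule S_add)
  then have "w + x \<in> S" by (simp add: ac_simps)
  then have "w + (w + x) \<in> sumset W S" by (rule sumsetI[OF assms(3)])
  then show False using assms(1) by simp
qed

text \<open>With equal stabilizers \<open>sum_in_E\<close> applies to any two points in different
  cosets, so every point of \<open>E\<close> in a new coset extends the flat.\<close>

lemma eflat_exists_if_K_const:
  assumes B: "subspace B" "S \<subseteq> B" "B \<subseteq> V" and const: "\<And>x. x \<in> B \<Longrightarrow> x \<notin> S \<Longrightarrow> K x = L"
  shows "\<exists>W. eflat W \<and> W \<subseteq> B \<and> dim B = dim W + dim S"
proof (rule eflat_exists_if_extends[OF B])
  fix W x assume W: "eflat W" "W \<subseteq> B" and x: "x \<in> B" "x \<notin> sumset W S"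
  have "0 \<in> W" using W(1) by (simp add: eflat_def subspace_0)
  then have "x \<notin> S" using x(2) sumsetI[of 0 W x S] by auto
  then obtain e where e: "e \<in> E" "x + e \<in> S"
    using coset_meets_E[of x] x(1) B(3) by blast
  have "x + e \<in> B" using e(2) B(2) by blast
  then have eB: "e \<in> B" by (simp add: subspace_add_iff[OF B(1) x(1)])
  have "w + e \<in> E" if w: "w \<in> W - {0}" for w
  proof -
    have wE: "w \<in> E" using w W(1) by (auto simp: eflat_def)
    have wB: "w \<in> B" using w W(2) by blast
    have nS: "w + e \<notin> S" using add_notin_sumset[OF x(2) e(2)] w by blast
    have "w + e \<in> B" using wB eB by (rule subspace_add[OF B(1)])
    then have "K w = L" "K e = L" "K (w + e) = L"
      using const wB eB nS E_notin_S[OF wE] E_notin_S[OF e(1)] by simp_all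
    then show ?thesis by (intro sum_in_E[OF wE e(1) nS]) simp_all
  qed
  then show "\<exists>e\<in>E. x + e \<in> S \<and> (\<forall>w\<in>W - {0}. w + e \<in> E)" using e by blast
qed

text \<open>
  Every element of \<open>E\<close> in a coset of \<open>S\<close> comes with a partner, and each element of a coset is linked
  to exactly one of the two partners of another coset; claw-freeness makes this linking transitive.
\<close>

lemma eflat_exists_if_star:
  assumes B: "subspace B" "S \<subseteq> B" "B \<subseteq> V" and K0: "subspace K0"
    and index: "\<And>x. x \<in> B \<Longrightarrow> x \<notin> S \<Longrightarrow> index_two K0 (K x)"
    and inter: "\<And>x y. x \<in> B \<Longrightarrow> y \<in> B \<Longrightarrow> x \<notin> S \<Longrightarrow> y \<notin> S \<Longrightarrow> x + y \<notin> S \<Longrightarrow> K x \<inter> K y = K0"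
    and sum: "\<And>x y p q. x \<in> B \<Longrightarrow> y \<in> B \<Longrightarrow> x \<notin> S \<Longrightarrow> y \<notin> S \<Longrightarrow> x + y \<notin> S \<Longrightarrow>
      p \<in> K x - K0 \<Longrightarrow> q \<in> K y - K0 \<Longrightarrow> p + q \<in> K (x + y) - K0"
  shows "\<exists>W. eflat W \<and> W \<subseteq> B \<and> dim B = dim W + dim S"
proof (rule eflat_exists_if_extends[OF B])
  fix W x assume W: "eflat W" "W \<subseteq> B" and x: "x \<in> B" "x \<notin> sumset W S"
  have subW: "subspace W" and W0: "0 \<in> W" using W(1) by (simp_all add: eflat_def subspace_0)
  have "x \<notin> S" using x(2) sumsetI[OF W0, of x S] by auto
  then obtain e where e: "e \<in> E" "x + e \<in> S"
    using coset_meets_E[of x] x(1) B(3) by blast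
  have "x + e \<in> B" using e(2) B(2) by blast
  then have eB: "e \<in> B" by (simp add: subspace_add_iff[OF B(1) x(1)])
  have eS: "e \<notin> S" using e(1) by (rule E_notin_S)
  have we_S: "w + e \<notin> S" if "w \<in> W" for w
    using add_notin_sumset[OF x(2) e(2) that] .
  have K0K: "K0 \<subseteq> K y" if "y \<in> B" "y \<notin> S" for y
    using index[OF that] by (simp add: index_two_def psubset_imp_subset)
  \<comment> \<open>\<open>e + p3\<close> is the partner of \<open>e\<close>: modulo
    \<open>K0\<close> these are the only two points of \<open>E\<close> in the coset
    \<open>e + S\<close>.\<close>
  obtain p3 where p3: "p3 \<in> K e" "p3 \<notin> K0"
    using index[OF eB eS] by (auto simp: index_two_def)
  have p3S: "p3 \<in> S" using p3(1) K_subset by blast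
  have ep: "e + p3 \<in> E" using K_iff[OF e(1)] p3(1) by simp
  have W_E: "w \<in> E" "w \<in> B" "w \<notin> S" "w + e \<in> B" if "w \<in> W - {0}" for w
  proof -
    show "w \<in> E" using that W(1) by (auto simp: eflat_def)
    then show "w \<notin> S" by (rule E_notin_S)
    show "w \<in> B" using that W(2) by blast
    then show "w + e \<in> B" using eB by (rule subspace_add[OF B(1)])
  qed
  \<comment> \<open>The correction \<open>s + t\<close> from \<open>triangle_exists\<close> lies in
    \<open>K (w + e)\<close>, after adding \<open>p3\<close> if exactly one of \<open>s\<close> and
    \<open>t\<close> is outside \<open>K0\<close>. Hence \<open>w\<close> is linked to
    \<open>e\<close> or to its partner.\<close>
  have one: "w + e \<in> E \<or> w + e + p3 \<in> E" if w: "w \<in> W - {0}" for w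
  proof -
    note w' = W_E[OF w]
    have nS: "w + e \<notin> S" using we_S w by blast
    obtain s t where s: "s \<in> K w" and t: "t \<in> K e" and st: "(w + s) + (e + t) \<in> E"
      by (rule triangle_exists[OF w'(1) e(1) nS])
    have SS: "s \<in> S" "t \<in> S" using s t K_subset by auto
    have z: "w + e + (s + t) \<in> E" using st by (simp add: ac_simps)
    have zero: "K0 \<subseteq> K (w + e)" by (rule K0K[OF w'(4) nS])
    have "s + t \<in> K (w + e) \<or> s + t + p3 \<in> K (w + e)"
    proof (cases "s \<in> K0")
      case True
      then have sK: "s \<in> K (w + e)" using zero by blast
      show ?thesis
      proof (cases "t \<in> K0")
        case True
        then have "t \<in> K (w + e)" using zero by blast
        then show ?thesis using subspace_add[OF subspace_K sK] by blast
      next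
        case False
        then have "t + p3 \<in> K0"
          using t p3 index[OF eB eS] by (simp add: index_two_def)
        then have "t + p3 \<in> K (w + e)" using zero by blast
        then have "s + (t + p3) \<in> K (w + e)" by (rule subspace_add[OF subspace_K sK])
        then show ?thesis by (simp add: add.assoc)
      qed
    next
      case sK0: False
      show ?thesis
      proof (cases "t \<in> K0")
        case True
        then have "t + p3 \<notin> K0" using p3(2) by (simp add: subspace_add_iff[OF K0])
        moreover have "t + p3 \<in> K e" using subspace_add[OF subspace_K t p3(1)] .
        ultimately have "s + (t + p3) \<in> K (w + e)"
          using sum[OF w'(2) eB w'(3) eS nS, of s "t + p3"] s sK0 by blast
        then show ?thesis by (simp add: add.assoc)
      next
        case False
        then have "s + t \<in> K (w + e)"
          using sum[OF w'(2) eB w'(3) eS nS, of s t] s t sK0 by blast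
        then show ?thesis by blast
      qed
    qed
    then show ?thesis
    proof
      assume "s + t \<in> K (w + e)"
      then have "w + e + (s + t) + (s + t) \<in> E" by (rule K_D[OF _ S_add[OF SS] z])
      then show ?thesis by (simp add: add.assoc)
    next
      assume "s + t + p3 \<in> K (w + e)"
      then have "w + e + (s + t) + (s + t + p3) \<in> E" by (rule K_D[OF _ S_add[OF SS] z])
      moreover have "w + e + (s + t) + (s + t + p3) = w + e + p3" by (simp add: ac_simps)
      ultimately show ?thesis by simp
    qed
  qed
  \<comment> \<open>All \<open>w\<close> are linked to the same partner. Otherwise claw-freeness for
    \<open>w1 + p1\<close>, \<open>w2\<close>, \<open>e\<close> gives one point of \<open>E\<close>
    in the coset of \<open>w1 + w2 + e\<close>, and \<open>triangle_exists\<close> gives another.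
    Their difference \<open>u + v\<close> lies in \<open>K (w1 + w2 + e)\<close>, which meets the
    other stabilizers involved only in \<open>K0\<close>.\<close>
  have same: "w2 + e \<in> E" if w1: "w1 \<in> W - {0}" and w2: "w2 \<in> W - {0}" and l1: "w1 + e \<in> E" for w1 w2
  proof (rule ccontr)
    assume l2: "w2 + e \<notin> E"
    then have d: "w2 + e + p3 \<in> E" using one[OF w2] by blast
    note w1' = W_E[OF w1] and w2' = W_E[OF w2]
    have "w1 \<noteq> w2" using l1 l2 by blast
    moreover have "w1 + w2 \<in> W" using w1 w2 subspace_add[OF subW] by blast
    ultimately have w12: "w1 + w2 \<in> W - {0}" by simp
    note w12' = W_E[OF w12]
    have S1: "w1 + e \<notin> S" and S2: "w2 + e \<notin> S" and S12: "w1 + w2 + e \<notin> S"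
      using we_S w1 w2 w12 by blast+
    obtain p1 where p1: "p1 \<in> K w1" "p1 \<notin> K0"
      using index[OF w1'(2,3)] by (auto simp: index_two_def)
    have p1S: "p1 \<in> S" using p1(1) K_subset by blast
    have xE: "w1 + p1 \<in> E" using K_iff[OF w1'(1)] p1(1) by simp
    have a: "w1 + p1 + w2 \<notin> E"
    proof
      assume "w1 + p1 + w2 \<in> E"
      then have "w1 + w2 + p1 \<in> E" by (simp add: ac_simps)
      then have "p1 \<in> K (w1 + w2)" using K_iff[OF w12'(1)] p1S by simp
      moreover have "w1 + (w1 + w2) \<notin> S" using w2'(3) by simp
      then have "K w1 \<inter> K (w1 + w2) = K0" by (rule inter[OF w1'(2) w12'(2) w1'(3) w12'(3)])
      ultimately show False using p1 by blast
    qed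
    have b: "w1 + p1 + e \<notin> E"
    proof
      assume "w1 + p1 + e \<in> E"
      then have "w1 + e + p1 \<in> E" by (simp add: ac_simps)
      then have "p1 \<in> K (w1 + e)" using K_iff[OF l1] p1S by simp
      moreover have "w1 + (w1 + e) \<notin> S" using eS by simp
      then have "K w1 \<inter> K (w1 + e) = K0" by (rule inter[OF w1'(2,4) w1'(3) S1])
      ultimately show False using p1 by blast
    qed
    have ne: "w1 + p1 \<noteq> w2" "e \<noteq> w1 + p1" "e \<noteq> w2" "e \<noteq> w1 + p1 + w2"
    proof -
      show "w1 + p1 \<noteq> w2"
      proof
        assume "w1 + p1 = w2"
        then have "w1 + w2 = p1" by (metis add_left_self)
        then show False using w12'(3) p1S by simp
      qed
      show "e \<noteq> w1 + p1"
      proof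
        assume "e = w1 + p1"
        then have "w1 + e = p1" by simp
        then show False using S1 p1S by simp
      qed
      show "e \<noteq> w2" using S2 zero_S by auto
      show "e \<noteq> w1 + p1 + w2"
      proof
        assume "e = w1 + p1 + w2"
        then have "w1 + w2 + e = p1" by (simp add: ac_simps)
        then show False using S12 p1S by simp
      qed
    qed
    have "w1 + p1 + w2 + e \<in> E"
      using claw[OF xE w2'(1) e(1) ne] a b l2 by blast
    then have X: "w1 + w2 + e + p1 \<in> E" by (simp add: ac_simps)
    have "w2 + e + p3 + w1 \<notin> S"
    proof
      assume "w2 + e + p3 + w1 \<in> S"
      then have "p3 + (w2 + e + p3 + w1) \<in> S" by (rule S_add[OF p3S])
      then show False using S12 by (simp add: ac_simps)
    qed
    then obtain s t where s: "s \<in> K (w2 + e + p3)" and t: "t \<in> K w1"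
      and st: "(w2 + e + p3 + s) + (w1 + t) \<in> E"
      by (rule triangle_exists[OF d w1'(1)])
    have sK: "s \<in> K (w2 + e)" using s K_shift[OF p3S, of "w2 + e"] by simp
    have SS: "s \<in> S" "t \<in> S" using s t K_subset by auto
    define u where "u = p3 + s"
    define v where "v = p1 + t"
    have uS: "u \<in> S" "v \<in> S" using S_add p3S p1S SS by (simp_all add: u_def v_def)
    have vK: "v \<in> K w1" unfolding v_def by (rule subspace_add[OF subspace_K p1(1) t])
    have "w1 + w2 + e + p1 + (u + v) = (w2 + e + p3 + s) + (w1 + t)"
      by (simp add: u_def v_def ac_simps)
    then have "w1 + w2 + e + p1 + (u + v) \<in> E" using st by (simp only:)
    then have "u + v \<in> K (w1 + w2 + e + p1)" using K_iff[OF X] S_add[OF uS] by simp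
    then have uvK: "u + v \<in> K (w1 + w2 + e)" using K_shift[OF p1S] by simp
    have int2: "K e \<inter> K (w2 + e) = K0"
    proof (rule inter[OF eB w2'(4) eS S2])
      show "e + (w2 + e) \<notin> S" using w2'(3) by (simp add: ac_simps)
    qed
    have p3n: "p3 \<notin> K (w2 + e)" using int2 p3 by blast
    then have "u \<notin> K (w2 + e)" unfolding u_def using sK by (simp add: subspace_add_iff[OF subspace_K])
    then have u0: "u \<notin> K0" using K0K[OF w2'(4) S2] by blast
    have u12: "u \<in> K e \<or> u \<in> K w2"
    proof (cases "s \<in> K0")
      case True
      then have "s \<in> K e" using K0K[OF eB eS] by blast
      then have "u \<in> K e" unfolding u_def by (rule subspace_add[OF subspace_K p3(1)])
      then show ?thesis ..
    next
      case False
      have eq: "e + (w2 + e) = w2" by (simp add: ac_simps)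
      have nS: "e + (w2 + e) \<notin> S" unfolding eq by (rule w2'(3))
      have "p3 + s \<in> K (e + (w2 + e)) - K0"
        using sum[OF eB w2'(4) eS S2 nS, of p3 s] p3 sK False by blast
      then show ?thesis unfolding eq u_def by blast
    qed
    have B12: "w1 + w2 + e \<in> B" by (rule w12'(4))
    have eqs: "e + (w1 + w2 + e) = w1 + w2" "w2 + (w1 + w2 + e) = w1 + e"
      "(w1 + e) + (w1 + w2 + e) = w2" "(w1 + w2) + (w1 + w2 + e) = e"
      "w1 + (w1 + w2 + e) = w2 + e"
      by (simp_all add: ac_simps)
    have i1: "K e \<inter> K (w1 + w2 + e) = K0"
      by (rule inter[OF eB B12 eS S12]) (simp only: eqs w12'(3) not_False_eq_True)
    have i2: "K w2 \<inter> K (w1 + w2 + e) = K0"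
      by (rule inter[OF w2'(2) B12 w2'(3) S12]) (simp only: eqs S1 not_False_eq_True)
    have i3: "K (w1 + e) \<inter> K (w1 + w2 + e) = K0"
      by (rule inter[OF w1'(4) B12 S1 S12]) (simp only: eqs w2'(3) not_False_eq_True)
    have i4: "K (w1 + w2) \<inter> K (w1 + w2 + e) = K0"
      by (rule inter[OF w12'(2) B12 w12'(3) S12]) (simp only: eqs eS not_False_eq_True)
    show False
    proof (cases "v \<in> K0")
      case True
      then have "v \<in> K (w1 + w2 + e)" using K0K[OF B12 S12] by blast
      then have "u \<in> K (w1 + w2 + e)" using uvK by (simp add: subspace_add_iff[OF subspace_K])
      then show False using u12 u0 i1 i2 by blast
    next
      case v0: False
      show False
        using u12
      proof
        assume "u \<in> K e"
        then have "v + u \<in> K (w1 + e) - K0"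
          using sum[OF w1'(2) eB w1'(3) eS S1, of v u] u0 v0 vK by blast
        then show False using uvK i3 by (auto simp: add.commute)
      next
        assume "u \<in> K w2"
        then have "v + u \<in> K (w1 + w2) - K0"
          using sum[OF w1'(2) w2'(2) w1'(3) w2'(3) w12'(3), of v u] u0 v0 vK by blast
        then show False using uvK i4 by (auto simp: add.commute)
      qed
    qed
  qed
  show "\<exists>e\<in>E. x + e \<in> S \<and> (\<forall>w\<in>W - {0}. w + e \<in> E)"
  proof (cases "\<exists>w1\<in>W - {0}. w1 + e \<in> E")
    case True
    then have "\<forall>w\<in>W - {0}. w + e \<in> E" using same by blast
    then show ?thesis using e by blast
  next
    case False
    then have "\<forall>w\<in>W - {0}. w + (e + p3) \<in> E" using one by (auto simp: add.assoc)
    moreover have "x + (e + p3) \<in> S" using S_add[OF e(2) p3S] by (simp add: add.assoc)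
    ultimately show ?thesis using ep by blast
  qed
qed

text \<open>If \<open>T\<close> contains all stabilizers, the points of \<open>E\<close> in a coset
  of \<open>S\<close> lie in a single coset of \<open>T\<close>. The lift collects these cosets and
  \<open>T\<close> itself: it keeps the quotient of \<open>B\<close> by \<open>S\<close> and all
  points of \<open>E\<close> in \<open>B\<close>, while \<open>S\<close> shrinks to
  \<open>T\<close>.\<close>

definition lift :: "'a set \<Rightarrow> 'a set \<Rightarrow> 'a set" where
  "lift B T = T \<union> {h \<in> B - S. \<exists>t\<in>T. h + t \<in> E}"

lemma lift_outside: "h \<in> lift B T \<Longrightarrow> h \<notin> T \<Longrightarrow> h \<in> B \<and> h \<notin> S \<and> (\<exists>t\<in>T. h + t \<in> E)"
  unfolding lift_def by blast

lemma lift_superset: "T \<subseteq> lift B T"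
  unfolding lift_def by blast

lemma lift_int_S: "T \<subseteq> S \<Longrightarrow> lift B T \<inter> S = T"
  unfolding lift_def by blast

lemma lift_subset: "T \<subseteq> B \<Longrightarrow> lift B T \<subseteq> B"
  unfolding lift_def by blast

context
  fixes B T :: "'a set"
  assumes B: "subspace B" "S \<subseteq> B" "B \<subseteq> V" and T: "subspace T" "T \<subseteq> S"
    and K_T: "\<And>x. x \<in> B \<Longrightarrow> x \<notin> S \<Longrightarrow> K x \<subseteq> T"
begin

lemma lift_shift:
  assumes "h \<in> lift B T" "t \<in> T"
  shows "h + t \<in> lift B T"
proof (cases "h \<in> T")
  case True
  then have "h + t \<in> T" using assms(2) by (rule subspace_add[OF T(1)])
  then show ?thesis using lift_superset by blast
next
  case False
  then obtain u where u: "u \<in> T" "h + u \<in> E" and h: "h \<in> B" "h \<notin> S"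
    using lift_outside[OF assms(1)] by blast
  have tS: "t \<in> S" using assms(2) T(2) by blast
  have "h + t + (t + u) \<in> E" using u(2) by (simp add: ac_simps)
  moreover have "t + u \<in> T" using assms(2) u(1) by (rule subspace_add[OF T(1)])
  moreover have "t \<in> B" using tS B(2) by blast
  then have "h + t \<in> B" by (rule subspace_add[OF B(1) h(1)])
  moreover have "h + t \<notin> S" using h(2) tS by (simp add: S_add_iff)
  ultimately show ?thesis unfolding lift_def by blast
qed

text \<open>Two points of \<open>E\<close> in the same coset of \<open>S\<close> differ by an
  element of a stabilizer, hence of \<open>T\<close>. For different cosets the corrections in
  \<open>triangle_exists\<close> belong to \<open>T\<close>. So sums stay in the selected cosets of
  \<open>T\<close>.\<close>

lemma subspace_lift: "subspace (lift B T)"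
proof (rule subspaceI)
  show "0 \<in> lift B T" using lift_superset subspace_0[OF T(1)] by blast
next
  fix x y assume x: "x \<in> lift B T" and y: "y \<in> lift B T"
  consider "x \<in> T" | "y \<in> T" | "x \<notin> T" "y \<notin> T" by blast
  then show "x + y \<in> lift B T"
  proof cases
    case 1
    then show ?thesis using lift_shift[OF y 1] by (simp add: add.commute)
  next
    case 2
    then show ?thesis by (rule lift_shift[OF x])
  next
    case 3
    obtain t where t: "t \<in> T" "x + t \<in> E" and xB: "x \<in> B" "x \<notin> S"
      using lift_outside[OF x 3(1)] by blast
    obtain u where u: "u \<in> T" "y + u \<in> E" and yB: "y \<in> B" "y \<notin> S"
      using lift_outside[OF y 3(2)] by blast
    have tS: "t \<in> S" "u \<in> S" using t(1) u(1) T(2) by blast+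
    have KT: "K (x + t) \<subseteq> T" "K (y + u) \<subseteq> T"
      using K_T[OF xB] K_T[OF yB] K_shift[OF tS(1)] K_shift[OF tS(2)] by simp_all
    have tu: "t + u \<in> T" by (rule subspace_add[OF T(1) t(1) u(1)])
    then have tuS: "t + u \<in> S" using T(2) by blast
    show ?thesis
    proof (cases "x + y \<in> S")
      case True
      then have "x + y + (t + u) \<in> S" using tuS by (rule S_add)
      then have *: "x + t + (y + u) \<in> S" by (simp add: ac_simps)
      have "x + t + (x + t + (y + u)) \<in> E" using u(2) by simp
      then have "x + t + (y + u) \<in> K (x + t)" using * K_iff[OF t(2)] by simp
      then have "x + t + (y + u) \<in> T" using KT by blast
      then have "x + t + (y + u) + (t + u) \<in> T" using tu by (rule subspace_add[OF T(1)])
      then have "x + y \<in> T" by (simp add: ac_simps)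
      then show ?thesis using lift_superset by blast
    next
      case False
      have "x + t + (y + u) \<notin> S"
      proof
        assume "x + t + (y + u) \<in> S"
        then have "x + t + (y + u) + (t + u) \<in> S" using tuS by (rule S_add)
        then show False using False by (simp add: ac_simps)
      qed
      then obtain s r where s: "s \<in> K (x + t)" and r: "r \<in> K (y + u)"
        and sr: "(x + t + s) + (y + u + r) \<in> E"
        by (rule triangle_exists[OF t(2) u(2)])
      have "s \<in> T" "r \<in> T" using s r KT by blast+
      then have "s + r \<in> T" by (rule subspace_add[OF T(1)])
      then have "t + u + (s + r) \<in> T" by (rule subspace_add[OF T(1) tu])
      moreover have "x + y + (t + u + (s + r)) \<in> E" using sr by (simp add: ac_simps)
      moreover have "x + y \<in> B" by (rule subspace_add[OF B(1) xB(1) yB(1)])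
      ultimately show ?thesis using False unfolding lift_def by blast
    qed
  qed
qed

lemma finite_lift: "finite (lift B T)"
proof -
  have "lift B T \<subseteq> V" using lift_subset[of T B] T(2) B(2,3) by blast
  then show ?thesis using V(2) by (rule finite_subset)
qed

text \<open>A complement of \<open>T\<close> in the lift is also a complement of \<open>S\<close> in
  \<open>B\<close>, because every coset of \<open>S\<close> other than \<open>S\<close> contains a
  point of \<open>E\<close>.\<close>

lemma dim_lift: "dim (lift B T) + dim S = dim B + dim T"
proof -
  obtain A where A: "subspace A" "A \<subseteq> lift B T" "A \<inter> T = {0}" "sumset T A = lift B T"
    "dim (lift B T) = dim T + dim A"
    by (rule complement_exists[OF T(1) subspace_lift finite_lift lift_superset])
  have AS: "S \<inter> A = {0}"
    using A(2,3) lift_int_S[OF T(2)] by blast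
  have finA: "finite A" using A(2) finite_lift by (rule finite_subset)
  have "b \<in> sumset S A" if b: "b \<in> B" for b
  proof (cases "b \<in> S")
    case True
    then show ?thesis using sumset_superset(1)[OF S(1) A(1)] by blast
  next
    case False
    have "b \<in> V" using b B(3) by blast
    then obtain e where e: "e \<in> E" "b + e \<in> S" by (rule coset_meets_E[OF _ False])
    have "b + e \<in> B" using e(2) B(2) by blast
    then have eB: "e \<in> B" by (simp add: subspace_add_iff[OF B(1) b])
    have "e + 0 \<in> E" using e(1) by simp
    then have "e \<in> lift B T"
      using eB E_notin_S[OF e(1)] subspace_0[OF T(1)] unfolding lift_def by blast
    then obtain t a where ta: "t \<in> T" "a \<in> A" "e = t + a"
      unfolding A(4)[symmetric] by (rule sumsetE)
    have "t \<in> S" using ta(1) T(2) by blast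
    then have "b + e + t \<in> S" by (rule S_add[OF e(2)])
    then have "b + e + t + a \<in> sumset S A" using ta(2) by (rule sumsetI)
    then show ?thesis using ta(3) by (simp add: ac_simps)
  qed
  moreover have "A \<subseteq> B" using A(2) lift_subset[of T B] T(2) B(2) by blast
  then have "sumset S A \<subseteq> B" by (rule sumset_subset[OF B(1,2)])
  ultimately have "sumset S A = B" by blast
  then have "dim B = dim S + dim A"
    using dim_sumset[OF S(1) A(1) finite_S finA AS] by simp
  then show ?thesis using A(5) by simp
qed

end

text \<open>In the lift over \<open>T\<close>, a complement \<open>U\<close> of \<open>L\<close> is
  taken, with \<open>Y\<close> the nonzero points of \<open>U\<close> outside \<open>E\<close>. A
  point of \<open>Y\<close> outside \<open>T\<close> has stabilizer \<open>L\<close> and lies in the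
  half of its \<open>T\<close>-coset that \<open>E\<close> misses. Shifting two such points by
  elements of \<open>T - L\<close> brings both into \<open>E\<close> but changes their sum only by
  an element of \<open>L\<close>. Hence \<open>Y\<close> is triangle-free, while subspaces of
  \<open>U\<close> avoiding \<open>Y\<close> are flats in \<open>E\<close>.\<close>

lemma dim_le_if_two_values:
  assumes B: "subspace B" "S \<subseteq> B" "B \<subseteq> V"
    and LT: "subspace L" "subspace T" "T \<subseteq> S" "index_two L T"
    and two: "\<And>x. x \<in> B \<Longrightarrow> x \<notin> S \<Longrightarrow> K x = L \<or> K x = T"
    and small: "\<And>W. eflat W \<Longrightarrow> W \<subseteq> B \<Longrightarrow> dim W \<le> w"
  shows "dim B \<le> dim S + (Suc w * 2 ^ Suc w + w)"
proof -
  have LsubT: "L \<subseteq> T" using LT(4) by (simp add: index_two_def psubset_imp_subset)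
  have sumL: "u + v \<in> L" if "u \<in> T" "v \<in> T" "u \<notin> L" "v \<notin> L" for u v
    using LT(4) that by (simp add: index_two_def)
  have KT: "K x \<subseteq> T" if "x \<in> B" "x \<notin> S" for x using two[OF that] LsubT by blast
  define H where "H = lift B T"
  have H: "subspace H" "finite H" "dim H + dim S = dim B + dim T"
    unfolding H_def
    by (rule subspace_lift[OF B LT(2,3) KT] finite_lift[OF B LT(2,3) KT] dim_lift[OF B LT(2,3) KT]; assumption)+
  have TH: "T \<subseteq> H" unfolding H_def by (rule lift_superset)
  have HS: "H \<inter> S = T" unfolding H_def by (rule lift_int_S[OF LT(3)])
  have HB: "H \<subseteq> B" unfolding H_def using lift_subset[of T B] LT(3) B(2) by blast
  have LH: "L \<subseteq> H" using LsubT TH by blast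
  obtain U where U: "subspace U" "U \<subseteq> H" "U \<inter> L = {0}" "dim H = dim L + dim U"
    by (rule complement_exists[OF LT(1) H(1,2) LH])
  define Y where "Y = U - {0} - E"
  have finU: "finite U" using U(2) H(2) by (rule finite_subset)
  have UL: "u \<notin> L" if "u \<in> U" "u \<noteq> 0" for u using that U(3) by blast
  have outside: "\<exists>t\<in>T. t \<notin> L \<and> y + t \<in> E \<and> K y = L" if y: "y \<in> Y" "y \<notin> T" for y
  proof -
    have yU: "y \<in> U" "y \<notin> E" using y by (auto simp: Y_def)
    have "y \<in> lift B T" using yU(1) U(2) by (auto simp: H_def)
    then obtain t where t: "t \<in> T" "y + t \<in> E" and yB: "y \<in> B" "y \<notin> S"
      using lift_outside y(2) by blast
    have tS: "t \<in> S" using t(1) LT(3) by blast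
    have "t \<notin> K y"
    proof
      assume "t \<in> K y"
      then have "y + t + t \<in> E" using K_D[OF _ tS t(2)] by blast
      then show False using yU(2) by (simp add: add.assoc)
    qed
    then have "K y = L" "t \<notin> L" using two[OF yB] t(1) LsubT by blast+
    then show ?thesis using t by blast
  qed
  have mixed: "y + z \<notin> Y" if y: "y \<in> Y" "y \<notin> T" and z: "z \<in> Y" "z \<in> T" for y z
  proof
    assume yz: "y + z \<in> Y"
    obtain t where t: "t \<in> T" "t \<notin> L" "y + t \<in> E" "K y = L" using outside[OF y] by blast
    have "z \<notin> L" using z(1) UL by (auto simp: Y_def)
    then have "t + z \<in> L" using sumL t z by blast
    moreover have "K (y + t) = L" using K_shift[of t y] t LT(3) by auto
    ultimately have "y + t + (t + z) \<in> E" using K_iff[OF t(3)] by blast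
    then have "y + z \<in> E" by (simp add: ac_simps)
    then show False using yz by (simp add: Y_def)
  qed
  have "dim U \<le> Suc w * 2 ^ Suc w + w"
  proof (rule triangle_free_dim_le[OF U(1) finU])
    show "Y \<subseteq> U" "0 \<notin> Y" by (auto simp: Y_def)
  next
    fix W assume W: "subspace W" "W \<subseteq> U" "W \<inter> Y = {}"
    then have "eflat W" by (auto simp: eflat_def Y_def)
    moreover have "W \<subseteq> B" using W(2) U(2) HB by blast
    ultimately show "dim W \<le> w" by (rule small)
  next
    fix x y assume x: "x \<in> Y" and y: "y \<in> Y"
    have xU: "x \<in> U" "x \<noteq> 0" and yU: "y \<in> U" "y \<noteq> 0" using x y by (auto simp: Y_def)
    consider "x \<in> T" "y \<in> T" | "x \<in> T" "y \<notin> T" | "x \<notin> T" "y \<in> T"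
      | "x \<notin> T" "y \<notin> T" "x + y \<in> T" | "x \<notin> T" "y \<notin> T" "x + y \<notin> T" by blast
    then show "x + y \<notin> Y"
    proof cases
      case 1
      \<comment> \<open>\<open>U\<close> meets \<open>L\<close> trivially and \<open>L\<close> has
        index two in \<open>T\<close>, so \<open>U\<close> has at most one nonzero point in
        \<open>T\<close>.\<close>
      then have "x + y \<in> L" using sumL UL xU yU by blast
      then show ?thesis using UL[of "x + y"] unfolding Y_def by blast
    next
      case 2
      then show ?thesis using mixed[OF y _ x] by (simp add: add.commute)
    next
      case 3
      then show ?thesis using mixed[OF x _ y] by simp
    next
      case 4
      show ?thesis
      proof
        assume "x + y \<in> Y"
        then have "x + (x + y) \<notin> Y" using mixed[OF x 4(1) _ 4(3)] by blast
        then show False using y by simp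
      qed
    next
      case 5
      show ?thesis
      proof
        assume xy: "x + y \<in> Y"
        obtain t where t: "t \<in> T" "t \<notin> L" "x + t \<in> E" "K x = L" using outside[OF x 5(1)] by blast
        obtain u where u: "u \<in> T" "u \<notin> L" "y + u \<in> E" "K y = L" using outside[OF y 5(2)] by blast
        obtain r where r: "K (x + y) = L" using outside[OF xy 5(3)] by blast
        have tu: "t + u \<in> L" using sumL t u by blast
        have SS: "t \<in> S" "u \<in> S" using t u LT(3) by blast+
        have "x + y \<notin> S" using xy 5(3) U(2) HS by (auto simp: Y_def)
        then have nS: "x + t + (y + u) \<notin> S"
          using S_add[OF SS] S_add_iff(1)[of "t + u" "x + y"] by (simp add: ac_simps)
        have "K (x + y + (t + u)) = L" using K_shift[OF S_add[OF SS]] r by simp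
        then have Kxy: "K (x + t + (y + u)) = L" by (simp add: ac_simps)
        have Kx: "K (x + t) = L" "K (y + u) = L" using K_shift SS t u by simp_all
        have "x + t + (y + u) \<in> E"
          using sum_in_E[OF t(3) u(3) nS] Kx Kxy by simp
        then have "x + t + (y + u) + (t + u) \<in> E" using K_iff Kxy tu by blast
        then have "x + y \<in> E" by (simp add: ac_simps)
        then show False using xy by (simp add: Y_def)
      qed
    qed
  qed
  moreover have "dim T = Suc (dim L)"
    using index_two_dim[OF LT(4,1,2)] finite_subset[OF LT(3) finite_S] by blast
  ultimately show ?thesis using H(3) U(4) by simp
qed

end

section \<open>Levels with at least three stabilizers\<close>

context binary_space
begin

section \<open>Elementary properties of trisections\<close>

lemma trisectionD:
  assumes "trisection P Q R"
  shows "P \<inter> Q = P \<inter> R" "P \<inter> Q = Q \<inter> R"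
    "index_two (P \<inter> Q) P" "index_two (P \<inter> Q) Q" "index_two (P \<inter> Q) R"
    "\<And>p q. p \<in> P \<Longrightarrow> p \<notin> Q \<Longrightarrow> q \<in> Q \<Longrightarrow> q \<notin> P \<Longrightarrow> p + q \<in> R"
  using assms unfolding trisection_def by blast+

lemma trisection_obtain:
  assumes "trisection P Q R"
  obtains p q where "p \<in> P" "p \<notin> Q" "q \<in> Q" "q \<notin> P" "p + q \<in> R"
proof -
  have "P \<inter> Q \<subset> P" "P \<inter> Q \<subset> Q"
    using trisectionD(3,4)[OF assms] by (simp_all add: index_two_def)
  then have "\<exists>p. p \<in> P \<and> p \<notin> Q" "\<exists>q. q \<in> Q \<and> q \<notin> P" by blast+
  then obtain p q where pq: "p \<in> P" "p \<notin> Q" "q \<in> Q" "q \<notin> P" by (elim exE conjE)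
  show ?thesis by (rule that[OF pq trisectionD(6)[OF assms pq]])
qed

lemma trisection_dim:
  assumes "trisection P Q R" "subspace P" "subspace Q" "subspace R" "finite P" "finite Q" "finite R"
  shows "dim P = Suc (dim (P \<inter> Q))" "dim Q = dim P" "dim R = dim P"
proof -
  note i = trisectionD(3-5)[OF assms(1)]
  have s: "subspace (P \<inter> Q)" using assms(2,3) by (rule subspace_inter)
  show "dim P = Suc (dim (P \<inter> Q))" "dim Q = dim P" "dim R = dim P"
    using index_two_dim[OF i(1) s assms(2,5)] index_two_dim[OF i(2) s assms(3,6)]
      index_two_dim[OF i(3) s assms(4,7)] by linarith+
qed

lemma trisection_unique_subset:
  assumes "trisection P Q R" "trisection P Q R'" and P: "subspace P" and R': "subspace R'"
  shows "R \<subseteq> R'"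
proof
  fix r assume r: "r \<in> R"
  obtain p q where pq: "p \<in> P" "p \<notin> Q" "q \<in> Q" "q \<notin> P" "p + q \<in> R"
    by (rule trisection_obtain[OF assms(1)])
  have pq': "p + q \<in> R'" by (rule trisectionD(6)[OF assms(2) pq(1-4)])
  have sub: "P \<inter> Q \<subseteq> R'" using trisectionD(1)[OF assms(2)] by blast
  have notP: "p + q \<notin> P \<inter> Q"
    using subspace_add_iff(1)[OF P pq(1), of q] pq(4) by blast
  show "r \<in> R'"
  proof (cases "r \<in> P \<inter> Q")
    case True
    then show ?thesis using sub by blast
  next
    case False
    have "index_two (P \<inter> Q) R" by (rule trisectionD(5)[OF assms(1)])
    then have "r + (p + q) \<in> P \<inter> Q"
      using r pq(5) notP False unfolding index_two_def by blast
    then have "r + (p + q) \<in> R'" using sub by blast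
    then show ?thesis using subspace_add_iff(2)[OF R' pq'] by blast
  qed
qed

text \<open>In a group of four elements with exponent two, two subgroups of order two determine the
  third. Thus \<open>K (x + y)\<close> is a function of \<open>K x\<close> and
  \<open>K y\<close>.\<close>

lemma trisection_unique:
  assumes "trisection P Q R" "trisection P Q R'" "subspace P" "subspace R" "subspace R'"
  shows "R = R'"
  using trisection_unique_subset[OF assms(1,2,3,5)] trisection_unique_subset[OF assms(2,1,3,4)] ..

lemma trisection_sumset_cases:
  assumes "trisection P Q R" "subspace P" "subspace Q" "t \<in> sumset P Q"
  shows "t \<in> P \<or> t \<in> Q \<or> t \<in> R"
proof -
  obtain p q where pq: "p \<in> P" "q \<in> Q" "t = p + q" using assms(4) by (rule sumsetE)
  consider "p \<in> Q" | "q \<in> P" | "p \<notin> Q" "q \<notin> P" by blast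
  then show ?thesis
  proof cases
    case 1 then show ?thesis using subspace_add[OF assms(3) 1 pq(2)] pq(3) by simp
  next
    case 2 then show ?thesis using subspace_add[OF assms(2) pq(1) 2] pq(3) by simp
  next
    case 3
    then have "t \<in> R" using trisectionD(6)[OF assms(1) pq(1) _ pq(2)] pq(3) by simp
    then show ?thesis by simp
  qed
qed

lemma trisection_subset_sumset:
  assumes "trisection P Q R" "subspace P" "subspace Q"
  shows "R \<subseteq> sumset P Q"
proof
  fix r assume r: "r \<in> R"
  obtain p q where pq: "p \<in> P" "p \<notin> Q" "q \<in> Q" "q \<notin> P" "p + q \<in> R"
    by (rule trisection_obtain[OF assms(1)])
  note s = subspace_sumset[OF assms(2,3)] sumset_superset[OF assms(2,3)]
  have pqs: "p + q \<in> sumset P Q" using pq(1,3) by (rule sumsetI)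
  have notP: "p + q \<notin> P \<inter> Q"
    using subspace_add_iff(1)[OF assms(2) pq(1), of q] pq(4) by blast
  show "r \<in> sumset P Q"
  proof (cases "r \<in> P")
    case True
    then show ?thesis using s(2) by blast
  next
    case False
    have "index_two (P \<inter> Q) R" by (rule trisectionD(5)[OF assms(1)])
    then have "r + (p + q) \<in> P \<inter> Q"
      using r pq(5) notP False unfolding index_two_def by blast
    then have "r + (p + q) \<in> sumset P Q" using s(2) by blast
    then show ?thesis using subspace_add_iff(2)[OF s(1) pqs] by blast
  qed
qed

lemma trisection_index_sumset:
  assumes "trisection P Q R" "subspace P" "subspace Q"
  shows "index_two P (sumset P Q)"
proof -
  note s = subspace_sumset[OF assms(2,3)] sumset_superset[OF assms(2,3)]
  obtain p q where pq: "p \<in> P" "p \<notin> Q" "q \<in> Q" "q \<notin> P" "p + q \<in> R"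
    by (rule trisection_obtain[OF assms(1)])
  have i: "index_two (P \<inter> Q) Q" by (rule trisectionD(4)[OF assms(1)])
  have "u + v \<in> P" if u: "u \<in> sumset P Q" "u \<notin> P" and v: "v \<in> sumset P Q" "v \<notin> P" for u v
  proof -
    obtain a b where a: "a \<in> P" "b \<in> Q" "u = a + b" using u(1) by (rule sumsetE)
    obtain c e where c: "c \<in> P" "e \<in> Q" "v = c + e" using v(1) by (rule sumsetE)
    have "b \<notin> P" using u(2) a subspace_add[OF assms(2) a(1)] by blast
    moreover have "e \<notin> P" using v(2) c subspace_add[OF assms(2) c(1)] by blast
    ultimately have "b + e \<in> P" using i a(2) c(2) unfolding index_two_def by blast
    then have "a + c + (b + e) \<in> P" by (rule subspace_add[OF assms(2) subspace_add[OF assms(2) a(1) c(1)]])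
    then show ?thesis using a(3) c(3) by (simp add: ac_simps)
  qed
  moreover have "P \<subset> sumset P Q" using s pq by blast
  ultimately show ?thesis unfolding index_two_def by blast
qed

text \<open>
  The values other than \<open>c\<close> behave like the nonzero values of a linear map with kernel \<open>Z\<close>
  on a subspace \<open>W\<close>, outside of which the value is always \<open>c\<close>.
\<close>

lemma value_decomposition:
  fixes v :: "'a \<Rightarrow> 'c"
  assumes S: "subspace S" and B: "subspace B" "S \<subseteq> B"
    and shift: "\<And>x s. s \<in> S \<Longrightarrow> v (x + s) = v x"
    and distinct: "\<And>x y. x \<in> B - S \<Longrightarrow> y \<in> B - S \<Longrightarrow> v x \<noteq> c \<Longrightarrow> v y \<noteq> c \<Longrightarrow> v x \<noteq> v y \<Longrightarrow>
      v (x + y) \<noteq> c \<and> v (x + y) \<noteq> v x \<and> v (x + y) \<noteq> v y"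
    and determined: "\<And>x y z. x \<in> B - S \<Longrightarrow> z \<in> B - S \<Longrightarrow> y \<in> B - S \<Longrightarrow> v x = v z \<Longrightarrow>
      v x \<noteq> c \<Longrightarrow> v y \<noteq> c \<Longrightarrow> v x \<noteq> v y \<Longrightarrow> v (x + y) = v (z + y)"
    and same: "\<And>x y. x \<in> B - S \<Longrightarrow> y \<in> B - S \<Longrightarrow> x + y \<notin> S \<Longrightarrow> v x = v y \<Longrightarrow> v x \<noteq> c \<Longrightarrow>
      v (x + y) = c \<or> v (x + y) = v x"
    and ex: "x0 \<in> B - S" "y0 \<in> B - S" "v x0 \<noteq> c" "v y0 \<noteq> c" "v x0 \<noteq> v y0"
  obtains Z W where "subspace Z" "subspace W" "S \<subseteq> Z" "Z \<subseteq> W" "W \<subseteq> B"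
    "\<And>x. x \<in> Z - S \<Longrightarrow> v x = c" "\<And>x. x \<in> B - W \<Longrightarrow> v x = c" "\<And>x. x \<in> W - Z \<Longrightarrow> v x \<noteq> c"
    "\<And>x y. x \<in> W - Z \<Longrightarrow> y \<in> W - Z \<Longrightarrow> x + y \<notin> Z \<Longrightarrow> v x \<noteq> v y"
proof -
  define D where "D = {x \<in> B - S. v x \<noteq> c}"
  have DB: "d \<in> B - S" "v d \<noteq> c" if "d \<in> D" for d using that by (simp_all add: D_def)
  have notS: "x + y \<notin> S" if "v x \<noteq> v y" for x y
  proof
    assume "x + y \<in> S"
    then have "v (x + (x + y)) = v x" by (rule shift)
    then show False using that by simp
  qed
  have D_distinct: "x + y \<in> D" "v (x + y) \<noteq> v x" "v (x + y) \<noteq> v y"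
    if "x \<in> D" "y \<in> D" "v x \<noteq> v y" for x y
  proof -
    note h = distinct[OF DB(1)[OF that(1)] DB(1)[OF that(2)] DB(2)[OF that(1)] DB(2)[OF that(2)] that(3)]
    have "x + y \<in> B" using DB(1)[OF that(1)] DB(1)[OF that(2)] by (intro subspace_add[OF B(1)]) simp_all
    then show "x + y \<in> D" using h notS[OF that(3)] by (simp add: D_def)
    show "v (x + y) \<noteq> v x" "v (x + y) \<noteq> v y" using h by simp_all
  qed
  have x0: "x0 \<in> D" and y0: "y0 \<in> D" unfolding D_def using ex(1-4) by blast+
  have other: "\<exists>r\<in>D. v r \<noteq> v x" for x
  proof (cases "v x0 = v x")
    case True
    then have "v y0 \<noteq> v x" using ex(5) by simp
    then show ?thesis using y0 by (rule bexI)
  next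
    case False
    then show ?thesis using x0 by (rule bexI)
  qed
  \<comment> \<open>\<open>r\<close> equals \<open>y + (y + r)\<close>, and replacing the first
    summand \<open>y\<close> by \<open>x\<close>, which has the same value, does not change the
    value of the sum.\<close>
  have A: "x + y + r \<in> D \<and> v (x + y + r) = v r"
    if x: "x \<in> D" and y: "y \<in> D" and xy: "v x = v y" and r: "r \<in> D" "v r \<noteq> v x" for x y r
  proof -
    have "v y \<noteq> v r" using xy r(2) by simp
    note yr = D_distinct[OF y r(1) this]
    have ne: "v x \<noteq> v (y + r)" using yr(2) xy by simp
    have "v (x + (y + r)) = v (y + (y + r))"
      by (rule determined[OF DB(1)[OF x] DB(1)[OF y] DB(1)[OF yr(1)] xy DB(2)[OF x] DB(2)[OF yr(1)] ne])
    moreover have "x + (y + r) \<in> D" by (rule D_distinct(1)[OF x yr(1) ne])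
    ultimately show ?thesis by (simp add: add.assoc)
  qed
  have main: "v (x + y) = c" "x + y + d \<in> D" "v (x + y + d) = v d"
    if x: "x \<in> D" and y: "y \<in> D" and xy: "v x = v y" and nS: "x + y \<notin> S" and d: "d \<in> D" for x y d
  proof -
    obtain r where r: "r \<in> D" "v r \<noteq> v x" using other by blast
    note Ar = A[OF x y xy r]
    have eq: "x + y + r + r = x + y" by (simp add: add.assoc)
    have "v (x + y) = c \<or> v (x + y) = v (x + y + r)"
      using same[OF DB(1)[OF conjunct1[OF Ar]] DB(1)[OF r(1)]] nS Ar DB(2)[OF r(1)] unfolding eq by simp
    moreover have "v (x + y) = c \<or> v (x + y) = v x"
      by (rule same[OF DB(1)[OF x] DB(1)[OF y] nS xy DB(2)[OF x]])
    ultimately show "v (x + y) = c" using Ar r(2) by auto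
    have "x + y + d \<in> D \<and> v (x + y + d) = v d"
    proof (cases "v d = v x")
      case False
      show ?thesis by (rule A[OF x y xy d False])
    next
      case True
      \<comment> \<open>If \<open>d\<close> has the value of \<open>x\<close>, fact \<open>A\<close>
        does not cover it. It covers \<open>d + r\<close>, whose value differs from that of
        \<open>x\<close>, and afterwards \<open>r\<close> is removed again.\<close>
      then have "v d \<noteq> v r" using r(2) by simp
      note dr = D_distinct[OF d r(1) this]
      have "v (d + r) \<noteq> v x" using dr(2) True by simp
      note Adr = A[OF x y xy dr(1) this]
      have ne: "v (x + y + (d + r)) \<noteq> v r" using Adr dr(3) by simp
      have eqs: "x + y + (d + r) + r = x + y + d" "d + r + r = d" by (simp_all add: ac_simps)
      have "v (x + y + (d + r) + r) = v (d + r + r)"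
        by (rule determined[OF DB(1)[OF conjunct1[OF Adr]] DB(1)[OF dr(1)] DB(1)[OF r(1)]
              conjunct2[OF Adr] DB(2)[OF conjunct1[OF Adr]] DB(2)[OF r(1)] ne])
      moreover have "x + y + (d + r) + r \<in> D" by (rule D_distinct(1)[OF conjunct1[OF Adr] r(1) ne])
      ultimately show ?thesis unfolding eqs by simp
    qed
    then show "x + y + d \<in> D" "v (x + y + d) = v d" by simp_all
  qed
  \<comment> \<open>The translations that preserve \<open>D\<close> and every value on it. Elements
    of \<open>D\<close> with equal values differ by such a translation, which makes the value
    injective modulo \<open>Z\<close>.\<close>
  define Z where "Z = {z \<in> B. \<forall>d\<in>D. z + d \<in> D \<and> v (z + d) = v d}"
  have Z_D: "z + d \<in> D" "v (z + d) = v d" if "z \<in> Z" "d \<in> D" for z d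
    using that by (simp_all add: Z_def)
  have ZB: "Z \<subseteq> B" by (auto simp: Z_def)
  have SZ: "S \<subseteq> Z"
  proof
    fix s assume s: "s \<in> S"
    have "s + d \<in> D \<and> v (s + d) = v d" if d: "d \<in> D" for d
    proof -
      have v: "v (s + d) = v d" using shift[OF s, of d] by (simp add: add.commute)
      have "s + d \<in> B" using s B DB(1)[OF d] by (intro subspace_add[OF B(1)]) auto
      moreover have "s + d \<notin> S" using subspace_add_iff(1)[OF S s] DB(1)[OF d] by simp
      ultimately show ?thesis using v DB(2)[OF d] by (simp add: D_def)
    qed
    then show "s \<in> Z" using s B(2) by (auto simp: Z_def)
  qed
  have subZ: "subspace Z"
  proof (rule subspaceI)
    show "0 \<in> Z" using SZ subspace_0[OF S] by blast
  next
    fix x y assume x: "x \<in> Z" and y: "y \<in> Z"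
    have "x + y + d \<in> D \<and> v (x + y + d) = v d" if d: "d \<in> D" for d
      using Z_D[OF x Z_D(1)[OF y d]] Z_D(2)[OF y d] by (simp add: add.assoc)
    moreover have "x + y \<in> B" using x y ZB by (intro subspace_add[OF B(1)]) auto
    ultimately show "x + y \<in> Z" by (simp add: Z_def)
  qed
  have DD: "x + y \<in> Z" if x: "x \<in> D" and y: "y \<in> D" and xy: "v x = v y" for x y
  proof (cases "x + y \<in> S")
    case True
    then show ?thesis using SZ by blast
  next
    case False
    have "x + y \<in> B" using DB(1)[OF x] DB(1)[OF y] by (intro subspace_add[OF B(1)]) auto
    then show ?thesis using main(2,3)[OF x y xy False] by (simp add: Z_def)
  qed
  have Zc: "v z = c" if z: "z \<in> Z" "z \<notin> S" for z
  proof -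
    obtain d where d: "d \<in> D" using other by blast
    have eq: "z + d + d = z" by (simp add: add.assoc)
    have "v (z + d + d) = c"
      by (rule main(1)[OF Z_D(1)[OF z(1) d] d Z_D(2)[OF z(1) d] _ d]) (simp only: eq z(2) not_False_eq_True)
    then show ?thesis unfolding eq .
  qed
  define W where "W = D \<union> Z"
  have WZ: "x \<in> D" if "x \<in> W - Z" for x using that unfolding W_def by blast
  have subW: "subspace W"
  proof (rule subspaceI)
    show "0 \<in> W" using subspace_0[OF subZ] by (simp add: W_def)
  next
    fix x y assume "x \<in> W" "y \<in> W"
    then consider "x \<in> Z" "y \<in> Z" | "x \<in> Z" "y \<in> D" | "x \<in> D" "y \<in> Z" | "x \<in> D" "y \<in> D"
      by (auto simp: W_def)
    then show "x + y \<in> W"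
    proof cases
      case 1 then show ?thesis using subspace_add[OF subZ 1] by (simp add: W_def)
    next
      case 2 then show ?thesis using Z_D(1)[OF 2] by (simp add: W_def)
    next
      case 3 then show ?thesis using Z_D(1)[OF 3(2,1)] by (simp add: W_def add.commute)
    next
      case 4
      then show ?thesis
      proof (cases "v x = v y")
        case True then show ?thesis using DD[OF 4 True] by (simp add: W_def)
      next
        case False then show ?thesis using D_distinct(1)[OF 4 False] by (simp add: W_def)
      qed
    qed
  qed
  show ?thesis
  proof (rule that[OF subZ subW SZ])
    show "Z \<subseteq> W" by (simp add: W_def)
    show "W \<subseteq> B" using ZB DB(1) by (auto simp: W_def)
    show "v x = c" if "x \<in> Z - S" for x using Zc that by simp
    show "v x = c" if "x \<in> B - W" for x
      using that SZ by (auto simp: W_def D_def)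
    show "v x \<noteq> c" if "x \<in> W - Z" for x using DB(2)[OF WZ[OF that]] .
    show "v x \<noteq> v y" if "x \<in> W - Z" "y \<in> W - Z" "x + y \<notin> Z" for x y
      using DD[OF WZ[OF that(1)] WZ[OF that(2)]] that(3) by blast
  qed
qed

text \<open>A complement modulo \<open>S\<close>: an ordinary complement of \<open>W\<close>,
  enlarged by \<open>S\<close>. The pieces are then unions of cosets of \<open>S\<close>, as
  required for arguments about \<open>K\<close>.\<close>

lemma complement_over_exists:
  assumes S: "subspace S" "S \<subseteq> W" and W: "subspace W" "W \<subseteq> B" and B: "subspace B" "finite B"
  obtains C where "subspace C" "S \<subseteq> C" "C \<subseteq> B" "C \<inter> W = S" "dim B + dim S = dim W + dim C" "sumset W C = B"
proof -
  obtain A where A: "subspace A" "A \<subseteq> B" "A \<inter> W = {0}" "sumset W A = B" "dim B = dim W + dim A"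
    by (rule complement_exists[OF W(1) B(1,2) W(2)])
  have SB: "S \<subseteq> B" using S(2) W(2) by blast
  have fin: "finite S" "finite A" using SB A(2) B(2) finite_subset by blast+
  have SA: "S \<inter> A = {0}" using A(3) S(2) subspace_0[OF S(1)] subspace_0[OF A(1)] by blast
  note sup = sumset_superset[OF S(1) A(1)]
  have sub: "sumset S A \<subseteq> B" by (rule sumset_subset[OF B(1) SB A(2)])
  have "sumset S A \<inter> W \<subseteq> S"
  proof
    fix x assume x: "x \<in> sumset S A \<inter> W"
    then obtain s a where sa: "s \<in> S" "a \<in> A" "x = s + a" by (blast elim: sumsetE)
    have "s \<in> W" using sa(1) S(2) by blast
    then have "a \<in> W" using x sa(3) subspace_add_iff(1)[OF W(1), of s a] by blast
    then have "a \<in> A \<inter> W" using sa(2) by blast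
    then have "a = 0" unfolding A(3) by simp
    then show "x \<in> S" using sa by simp
  qed
  then have int: "sumset S A \<inter> W = S" using sup(1) S(2) by blast
  have "dim (sumset S A) = dim S + dim A" by (rule dim_sumset[OF S(1) A(1) fin SA])
  then have dim: "dim B + dim S = dim W + dim (sumset S A)" using A(5) by simp
  have "B \<subseteq> sumset W (sumset S A)"
  proof
    fix b assume "b \<in> B"
    then obtain w a where wa: "w \<in> W" "a \<in> A" "b = w + a" unfolding A(4)[symmetric] by (rule sumsetE)
    have "a \<in> sumset S A" using wa(2) sup(2) by blast
    then show "b \<in> sumset W (sumset S A)" unfolding wa(3) by (rule sumsetI[OF wa(1)])
  qed
  moreover have "sumset W (sumset S A) \<subseteq> B" by (rule sumset_subset[OF B(1) W(2) sub])
  ultimately have "sumset W (sumset S A) = B" by blast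
  then show ?thesis by (rule that[OF subspace_sumset[OF S(1) A(1)] sup(1) sub int dim])
qed

end

context claw_free_config
begin

section \<open>Comparing the stabilizers of two cosets\<close>

lemma K_eq_if_subset: "K x \<subseteq> K y \<Longrightarrow> dim (K y) \<le> dim (K x) \<Longrightarrow> K x = K y"
  by (rule subspace_eq_if_dim_ge[OF subspace_K subspace_K finite_K])

lemma K_index_dim: "index_two (K x) (K y) \<Longrightarrow> dim (K y) = Suc (dim (K x))"
  by (rule index_two_dim[OF _ subspace_K subspace_K finite_K])

lemmas K_trisection_dim = trisection_dim[OF _ subspace_K subspace_K subspace_K finite_K finite_K finite_K]

text \<open>The index-two alternatives are turned into equations between dimensions, so that
  arithmetic eliminates most cases in later uses.\<close>

lemma K_triangle_cases:
  assumes "x \<in> V" "y \<in> V" "x \<notin> S" "y \<notin> S" "x + y \<notin> S"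
  obtains "K x = K y" "K (x + y) \<subseteq> K x" | "K x = K (x + y)" "K y \<subseteq> K x" | "K y = K (x + y)" "K x \<subseteq> K y"
    | "K x = K y" "dim (K (x + y)) = Suc (dim (K x))"
    | "K x = K (x + y)" "K x \<subseteq> K y" "dim (K y) = Suc (dim (K x))"
    | "K y = K (x + y)" "K y \<subseteq> K x" "dim (K x) = Suc (dim (K y))"
    | "trisection (K x) (K y) (K (x + y))"
proof -
  have *: "index_two (K u) (K v) \<Longrightarrow> K u \<subseteq> K v" for u v by (simp add: index_two_def psubset_imp_subset)
  from triangle_type_K[OF assms]
  consider "K x = K y" "K (x + y) \<subseteq> K x" | "K x = K (x + y)" "K y \<subseteq> K x"
    | "K y = K (x + y)" "K x \<subseteq> K y" | "K x = K y" "index_two (K x) (K (x + y))"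
    | "K x = K (x + y)" "index_two (K x) (K y)" | "K y = K (x + y)" "index_two (K y) (K x)"
    | "trisection (K x) (K y) (K (x + y))"
    unfolding triangle_type_def by (elim disjE conjE)
  then show ?thesis
  proof cases
    case 1 then show ?thesis by (rule that(1))
  next
    case 2 then show ?thesis by (rule that(2))
  next
    case 3 then show ?thesis by (rule that(3))
  next
    case 4 then show ?thesis by (intro that(4) K_index_dim)
  next
    case 5 then show ?thesis by (intro that(5) K_index_dim *)
  next
    case 6 then show ?thesis by (intro that(6) K_index_dim *)
  next
    case 7 then show ?thesis by (rule that(7))
  qed
qed

lemma add_notin_S: "K x \<noteq> K y \<Longrightarrow> x + y \<notin> S"
  using K_eq_if_coset by blast

text \<open>A trisection forces equal dimensions, and in all other triangle types the stabilizers of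
  \<open>x\<close> and \<open>y\<close> are comparable.\<close>

lemma K_subset_if_dim_less:
  assumes "x \<in> V" "y \<in> V" "x \<notin> S" "y \<notin> S" "dim (K x) < dim (K y)"
  shows "K x \<subseteq> K y"
proof -
  have "K x \<noteq> K y" using assms(5) by auto
  then have "x + y \<notin> S" by (rule add_notin_S)
  from assms(1-4) this show ?thesis
  proof (cases rule: K_triangle_cases)
    case 1 then show ?thesis by simp
  next
    case 2 then have "dim (K y) \<le> dim (K x)" by (intro subspace_dim_mono[OF subspace_K subspace_K finite_K])
    then show ?thesis using assms(5) by simp
  next
    case 3 then show ?thesis by simp
  next
    case 4 then show ?thesis by simp
  next
    case 5 then show ?thesis by simp
  next
    case 6 then show ?thesis using assms(5) by simp
  next
    case 7 then show ?thesis using K_trisection_dim(2)[OF 7] assms(5) by simp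
  qed
qed

lemma trisection_if_dim_eq:
  assumes "x \<in> V" "y \<in> V" "x \<notin> S" "y \<notin> S" "dim (K x) = dim (K y)" "K x \<noteq> K y"
  shows "trisection (K x) (K y) (K (x + y))"
proof -
  have "x + y \<notin> S" by (rule add_notin_S) fact
  from assms(1-4) this show ?thesis
  proof (cases rule: K_triangle_cases)
    case 1 then show ?thesis using assms(6) by simp
  next
    case 2 then show ?thesis using K_eq_if_subset[of y x] assms(5,6) by simp
  next
    case 3 then show ?thesis using K_eq_if_subset[of x y] assms(5,6) by simp
  next
    case 4 then show ?thesis using assms(6) by simp
  next
    case 5 then show ?thesis using assms(5) by simp
  next
    case 6 then show ?thesis using assms(5) by simp
  next
    case 7 then show ?thesis .
  qed
qed

lemma K_add_same:
  assumes "x \<in> V" "y \<in> V" "x \<notin> S" "y \<notin> S" "x + y \<notin> S" "K x = K y" "dim (K (x + y)) = dim (K x)"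
  shows "K (x + y) = K x"
  using assms(1-5)
proof (cases rule: K_triangle_cases)
  case 1 then show ?thesis using K_eq_if_subset[of "x + y" x] assms(7) by simp
next
  case 2 then show ?thesis by simp
next
  case 3 then show ?thesis using assms(6) by simp
next
  case 4 then show ?thesis using assms(7) by simp
next
  case 5 then show ?thesis by simp
next
  case 6 then show ?thesis using assms(6) by simp
next
  case 7
  then show ?thesis using trisectionD(3)[OF 7] assms(6) by (simp add: index_two_def)
qed

lemma trisection_if_incomparable:
  assumes "x \<in> V" "y \<in> V" "x \<notin> S" "y \<notin> S" "\<not> K x \<subseteq> K y" "\<not> K y \<subseteq> K x"
  shows "trisection (K x) (K y) (K (x + y))"
proof -
  have "K x \<noteq> K y" using assms(5) by auto
  moreover have "dim (K x) = dim (K y)"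
    using K_subset_if_dim_less[OF assms(1-4)] K_subset_if_dim_less[OF assms(2,1,4,3)] assms(5,6)
    by (meson linorder_neqE_nat)
  ultimately show ?thesis by (intro trisection_if_dim_eq assms)
qed

text \<open>
  Pairwise adjacent subspaces, at least three of them independent, either all contain a common
  subspace of index two or all have index two in a common subspace.
\<close>

lemma dim_le_if_trisections:
  assumes B: "subspace B" "S \<subseteq> B" "B \<subseteq> V"
    and tri: "\<And>x y. x \<in> B \<Longrightarrow> y \<in> B \<Longrightarrow> x \<notin> S \<Longrightarrow> y \<notin> S \<Longrightarrow> x + y \<notin> S \<Longrightarrow>
      trisection (K x) (K y) (K (x + y))"
    and small: "\<And>W. eflat W \<Longrightarrow> W \<subseteq> B \<Longrightarrow> dim W \<le> w"
    and top: "\<And>T. subspace T \<Longrightarrow> T \<subseteq> S \<Longrightarrow> (\<And>x. x \<in> B \<Longrightarrow> x \<notin> S \<Longrightarrow> index_two (K x) T) \<Longrightarrow>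
      dim B \<le> dim S + d"
  shows "dim B \<le> dim S + (w + d + 2)"
proof (rule ccontr)
  assume "\<not> ?thesis"
  then have big: "dim S + (w + d + 2) < dim B" by simp
  have BV: "b \<in> V" if "b \<in> B" for b using that B(3) by blast
  have finB: "finite B" using B(3) V(2) by (rule finite_subset)
  \<comment> \<open>The summand 2 in the bound leaves room for \<open>x\<close> and \<open>y\<close>
    independent modulo \<open>S\<close>.\<close>
  have pick: "\<exists>x. x \<in> B \<and> x \<notin> C" if "subspace C" "finite C" "dim C \<le> dim S + 2" for C
  proof (rule ccontr)
    assume "\<not> ?thesis"
    then have "B \<subseteq> C" by blast
    then have "dim B \<le> dim C" by (rule subspace_dim_mono[OF B(1) that(1,2)])
    then show False using that(3) big by simp
  qed
  obtain x where x: "x \<in> B" "x \<notin> S" using pick[OF S(1) finite_S] by auto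
  define Cx where "Cx = ext x S"
  have Cx: "subspace Cx" "finite Cx" "dim Cx = Suc (dim S)"
    using subspace_ext[OF S(1)] dim_ext[OF S(1) finite_S x(2)] finite_S by (simp_all add: Cx_def, simp add: ext_def)
  obtain y where y: "y \<in> B" "y \<notin> Cx" using pick[OF Cx(1,2)] Cx(3) by auto
  define C where "C = ext y Cx"
  have C: "subspace C" "finite C" "dim C = dim S + 2"
    using subspace_ext[OF Cx(1)] dim_ext[OF Cx(1,2) y(2)] Cx(2,3) by (simp_all add: C_def, simp add: ext_def)
  have memC: "u \<in> C \<longleftrightarrow> u \<in> S \<or> x + u \<in> S \<or> y + u \<in> S \<or> x + y + u \<in> S" for u
    by (simp add: C_def Cx_def mem_ext add.assoc)
  have yS: "y \<notin> S" "x + y \<notin> S" using y(2) by (simp_all add: Cx_def mem_ext)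
  have xyB: "x + y \<in> B" by (rule subspace_add[OF B(1) x(1) y(1)])
  define P where "P = K x"
  define Q where "Q = K y"
  define R where "R = K (x + y)"
  define K0 where "K0 = P \<inter> Q"
  define T where "T = sumset P Q"
  have PQR: "trisection P Q R" unfolding P_def Q_def R_def by (rule tri[OF x(1) y(1) x(2) yS])
  have sub: "subspace P" "subspace Q" "subspace R" unfolding P_def Q_def R_def by (rule subspace_K)+
  have K0: "subspace K0" unfolding K0_def by (rule subspace_inter[OF sub(1,2)])
  have "finite K0" unfolding K0_def P_def using finite_K by blast
  moreover have "K0 \<subseteq> P" "K0 \<subseteq> Q" "K0 \<subseteq> R"
    using trisectionD(1,2)[OF PQR] unfolding K0_def by blast+
  ultimately have K0S: "K0 \<subseteq> P" "K0 \<subseteq> Q" "K0 \<subseteq> R" "finite K0" by simp_all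
  have T: "subspace T" "P \<subseteq> T" "Q \<subseteq> T" "R \<subseteq> T"
    unfolding T_def by (rule subspace_sumset[OF sub(1,2)] sumset_superset[OF sub(1,2)] trisection_subset_sumset[OF PQR sub(1,2)])+
  have TS: "T \<subseteq> S" unfolding T_def P_def Q_def by (rule sumset_subset[OF S(1) K_subset K_subset])
  have finT: "finite T" using TS finite_S by (rule finite_subset)
  have dT: "dim T = Suc (dim P)"
    unfolding T_def by (rule index_two_dim[OF trisection_index_sumset[OF PQR sub(1,2)] sub(1) T(1)[unfolded T_def] finT[unfolded T_def]])
  have dK0: "dim P = Suc (dim K0)"
    using K_trisection_dim(1)[OF PQR[unfolded P_def Q_def R_def]] by (simp add: P_def Q_def K0_def)
  have dimK: "dim (K u) = dim P" if u: "u \<in> B" "u \<notin> S" for u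
  proof (cases "x + u \<in> S")
    case True
    then show ?thesis using K_eq_if_coset[of x u] by (simp add: P_def)
  next
    case False
    then show ?thesis using K_trisection_dim(2)[OF tri[OF x(1) u(1) x(2) u(2) False]] by (simp add: P_def)
  qed
  have inC: "K u = P \<or> K u = Q \<or> K u = R" if "u \<in> C" "u \<notin> S" for u
    using that memC K_eq_if_coset[of x u] K_eq_if_coset[of y u] K_eq_if_coset[of "x + y" u]
    by (auto simp: P_def Q_def R_def)
  have int: "dim (K u \<inter> K z) = dim K0" if "u \<in> B" "z \<in> B" "u \<notin> S" "z \<notin> S" "u + z \<notin> S" for u z
    using K_trisection_dim(1)[OF tri[OF that]] dimK[OF that(1,3)] dK0 by simp
  have int_eq: "K u \<inter> K z = K0" if uz: "u \<in> B" "z \<in> B" "u \<notin> S" "z \<notin> S" "u + z \<notin> S"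
    and sub: "K u \<inter> K z \<subseteq> K0 \<or> K0 \<subseteq> K u \<inter> K z" for u z
  proof -
    have s: "subspace (K u \<inter> K z)" by (rule subspace_inter[OF subspace_K subspace_K])
    have f: "finite (K u \<inter> K z)" using finite_K by blast
    show ?thesis using sub
    proof
      assume "K u \<inter> K z \<subseteq> K0"
      then show ?thesis by (rule subspace_eq_if_dim_ge[OF s K0 K0S(4)]) (simp add: int[OF uz])
    next
      assume "K0 \<subseteq> K u \<inter> K z"
      then have "K0 = K u \<inter> K z" by (rule subspace_eq_if_dim_ge[OF K0 s f]) (simp add: int[OF uz])
      then show ?thesis ..
    qed
  qed
  have out: "z \<notin> S" "x + z \<notin> S" "y + z \<notin> S" "x + y + z \<notin> S" if "z \<notin> C" for z
    using that memC by blast+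
  \<comment> \<open>\<open>P \<inter> K z\<close> and \<open>Q \<inter> K z\<close> have index two
    in \<open>K z\<close>. If they coincide, they equal \<open>K0\<close> by dimension; otherwise
    one has an element outside the other, and together they generate \<open>K z\<close> inside
    \<open>T\<close>.\<close>
  have alt: "K0 \<subseteq> K z \<or> K z \<subseteq> T" if z: "z \<in> B" "z \<notin> C" for z
  proof -
    note o = out[OF z(2)]
    have ix: "index_two (P \<inter> K z) (K z)" "index_two (Q \<inter> K z) (K z)"
      using trisectionD(4)[OF tri[OF x(1) z(1) x(2) o(1,2)]] trisectionD(4)[OF tri[OF y(1) z(1) yS(1) o(1,3)]]
      by (simp_all add: P_def Q_def)
    have helper: "K z \<subseteq> T" if "index_two (Q' \<inter> K z) (K z)" "u \<in> K z" "u \<in> T" "u \<notin> Q'" "Q' \<subseteq> T" for Q' u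
    proof
      fix v assume v: "v \<in> K z"
      show "v \<in> T"
      proof (cases "v \<in> Q'")
        case True
        then show ?thesis using that(5) by blast
      next
        case False
        then have "u + v \<in> Q' \<inter> K z" using that(1,2,4) v unfolding index_two_def by blast
        then have "u + v \<in> T" using that(5) by blast
        then show ?thesis using subspace_add_iff(1)[OF T(1) that(3)] by blast
      qed
    qed
    show ?thesis
    proof (cases "P \<inter> K z = Q \<inter> K z")
      case True
      then have "P \<inter> K z \<subseteq> K0" unfolding K0_def by blast
      then have "P \<inter> K z = K0" using int_eq[OF x(1) z(1) x(2) o(1,2)] by (simp add: P_def)
      then show ?thesis by blast
    next
      case False
      then consider u where "u \<in> K z" "u \<in> P" "u \<notin> Q" | u where "u \<in> K z" "u \<in> Q" "u \<notin> P" by blast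
      then show ?thesis
      proof cases
        case 1
        then have "K z \<subseteq> T" using helper[OF ix(2)] T(2,3) by blast
        then show ?thesis ..
      next
        case 2
        then have "K z \<subseteq> T" using helper[OF ix(1)] T(2,3) by blast
        then show ?thesis ..
      qed
    qed
  qed
  \<comment> \<open>\<open>P\<close>, \<open>Q\<close> and \<open>R\<close> cover \<open>T\<close>,
    and each of them meets \<open>K z\<close> only in \<open>K0\<close>, so no room is left in
    \<open>T\<close> for the rest of \<open>K z\<close>.\<close>
  have not_both: False if z: "z \<in> B" "z \<notin> C" and both: "K0 \<subseteq> K z" "K z \<subseteq> T" for z
  proof -
    note o = out[OF z(2)]
    have "K0 \<noteq> K z" using dimK[OF z(1) o(1)] dK0 by auto
    then obtain u where u: "u \<in> K z" "u \<notin> K0" using both(1) by blast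
    have "u \<in> P \<or> u \<in> Q \<or> u \<in> R"
      by (rule trisection_sumset_cases[OF PQR sub(1,2)]) (use u both T_def in blast)
    moreover have "P \<inter> K z = K0" unfolding P_def
      by (rule int_eq[OF x(1) z(1) x(2) o(1,2)]) (use both K0S P_def in blast)
    moreover have "Q \<inter> K z = K0" unfolding Q_def
      by (rule int_eq[OF y(1) z(1) yS(1) o(1,3)]) (use both K0S Q_def in blast)
    moreover have "R \<inter> K z = K0" unfolding R_def
      by (rule int_eq[OF xyB z(1) yS(2) o(1,4)]) (use both K0S R_def in blast)
    ultimately show False using u by blast
  qed
  \<comment> \<open>The two kinds cannot mix: a \<open>K z1\<close> containing \<open>K0\<close> but
    not contained in \<open>T\<close> meets \<open>T\<close> exactly in \<open>K0\<close>. A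
    \<open>K z2\<close> inside \<open>T\<close> then meets \<open>K z1\<close> in \<open>K0\<close>,
    so it contains \<open>K0\<close>, against \<open>not_both\<close>.\<close>
  have uniform: False if z1: "z1 \<in> B" "z1 \<notin> C" "K0 \<subseteq> K z1" and z2: "z2 \<in> B" "z2 \<notin> C" "K z2 \<subseteq> T" for z1 z2
  proof (cases "z1 + z2 \<in> S")
    case True
    then have "K z1 = K z2" by (rule K_eq_if_coset)
    then show False using not_both[OF z1] z2(3) by simp
  next
    case False
    note o1 = out[OF z1(2)] and o2 = out[OF z2(2)]
    have s: "subspace (K z1 \<inter> T)" by (rule subspace_inter[OF subspace_K T(1)])
    have f: "finite (K z1 \<inter> T)" using finT by blast
    have "K z1 \<inter> T \<subset> K z1" using not_both[OF z1] by blast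
    then have "dim (K z1 \<inter> T) < dim (K z1)" by (rule subspace_psubset_dim[OF s subspace_K finite_K])
    then have "dim (K z1 \<inter> T) \<le> dim K0" using dimK[OF z1(1) o1(1)] dK0 by simp
    moreover have "K0 \<subseteq> K z1 \<inter> T" using z1(3) K0S(1) T(2) by blast
    ultimately have "K0 = K z1 \<inter> T" by (intro subspace_eq_if_dim_ge[OF K0 s f])
    then have "K z1 \<inter> K z2 \<subseteq> K0" using z2(3) by blast
    then have "K z1 \<inter> K z2 = K0" using int_eq[OF z1(1) z2(1) o1(1) o2(1) False] by blast
    then show False using not_both[OF z2(1,2) _ z2(3)] by blast
  qed
  show False
  proof (cases "\<forall>z. z \<in> B \<longrightarrow> z \<notin> C \<longrightarrow> K0 \<subseteq> K z")
    case True
    have K0K: "K0 \<subseteq> K u" if u: "u \<in> B" "u \<notin> S" for u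
      using True u(1) inC[OF _ u(2)] K0S by blast
    have inter: "K u \<inter> K z = K0" if "u \<in> B" "z \<in> B" "u \<notin> S" "z \<notin> S" "u + z \<notin> S" for u z
      by (rule int_eq[OF that]) (use K0K that in blast)
    have "\<exists>W. eflat W \<and> W \<subseteq> B \<and> dim B = dim W + dim S"
    proof (rule eflat_exists_if_star[OF B K0])
      fix u assume u: "u \<in> B" "u \<notin> S"
      show "index_two K0 (K u)"
        by (rule index_two_if_dim[OF K0K[OF u] K0 subspace_K finite_K]) (simp add: dimK[OF u] dK0)
    next
      fix u z assume uz: "u \<in> B" "z \<in> B" "u \<notin> S" "z \<notin> S" "u + z \<notin> S"
      show eq: "K u \<inter> K z = K0" by (rule inter[OF uz])
      fix p q assume p: "p \<in> K u - K0" and q: "q \<in> K z - K0"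
      then have n: "p \<notin> K z" "q \<notin> K u" using eq by blast+
      have "p + q \<in> K (u + z)"
        using trisectionD(6)[OF tri[OF uz]] p q n by blast
      moreover have "p + q \<notin> K0"
      proof
        assume "p + q \<in> K0"
        then have "p + q \<in> K u" using K0K[OF uz(1,3)] by blast
        moreover have "p \<in> K u" using p by blast
        ultimately have "q \<in> K u" using subspace_add_iff(1)[OF subspace_K] by blast
        then show False using n by blast
      qed
      ultimately show "p + q \<in> K (u + z) - K0" by simp
    qed
    then obtain W where W: "eflat W" "W \<subseteq> B" "dim B = dim W + dim S" by blast
    then show False using small[OF W(1,2)] big by simp
  next
    case False
    then obtain z1 where z1: "z1 \<in> B" "z1 \<notin> C" "\<not> K0 \<subseteq> K z1" by blast
    then have z1T: "K z1 \<subseteq> T" using alt by blast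
    have KT: "K u \<subseteq> T" if u: "u \<in> B" "u \<notin> S" for u
    proof (cases "u \<in> C")
      case True
      then show ?thesis using inC[OF _ u(2)] T by blast
    next
      case False
      then show ?thesis using alt[OF u(1)] uniform[OF u(1) False _ z1(1,2) z1T] by blast
    qed
    have "dim B \<le> dim S + d"
    proof (rule top[OF T(1) TS])
      fix u assume u: "u \<in> B" "u \<notin> S"
      show "index_two (K u) T"
        by (rule index_two_if_dim[OF KT[OF u] subspace_K T(1) finT]) (simp add: dimK[OF u] dT)
    qed
    then show False using big by simp
  qed
qed

text \<open>Incomparable \<open>P\<close> and \<open>Q\<close> have the same dimension. A stabilizer
  of the other dimension contains both or is contained in both, and by dimension it is
  \<open>sumset P Q\<close> or \<open>P \<inter> Q\<close>, so there is only one exceptional value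
  \<open>c\<close>. Modulo \<open>S\<close>, the complement of \<open>W\<close> and the space
  \<open>Z\<close>, where \<open>K\<close> is constantly \<open>c\<close>, contribute at most
  \<open>w\<close> each, and the complement of \<open>Z\<close> in \<open>W\<close>, where only
  trisections occur, at most \<open>w + d + 2\<close>.\<close>

lemma dim_le_if_incomparable:
  assumes B: "subspace B" "S \<subseteq> B" "B \<subseteq> V"
    and two_dims: "\<And>x. x \<in> B \<Longrightarrow> x \<notin> S \<Longrightarrow> dim (K x) = j \<or> dim (K x) = Suc j"
    and x0: "x0 \<in> B" "x0 \<notin> S" and y0: "y0 \<in> B" "y0 \<notin> S"
    and inc: "\<not> K x0 \<subseteq> K y0" "\<not> K y0 \<subseteq> K x0"
    and small: "\<And>W. eflat W \<Longrightarrow> W \<subseteq> B \<Longrightarrow> dim W \<le> w"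
    and top: "\<And>C T. subspace C \<Longrightarrow> S \<subseteq> C \<Longrightarrow> C \<subseteq> V \<Longrightarrow> subspace T \<Longrightarrow> T \<subseteq> S \<Longrightarrow>
      (\<And>x. x \<in> C \<Longrightarrow> x \<notin> S \<Longrightarrow> index_two (K x) T) \<Longrightarrow>
      (\<And>x y. x \<in> C \<Longrightarrow> y \<in> C \<Longrightarrow> x \<notin> S \<Longrightarrow> y \<notin> S \<Longrightarrow> x + y \<notin> S \<Longrightarrow>
        trisection (K x) (K y) (K (x + y))) \<Longrightarrow> dim C \<le> dim S + d"
  shows "dim B \<le> dim S + (3 * w + d + 2)"
proof -
  have BV: "b \<in> V" if "b \<in> B" for b using that B(3) by blast
  have finB: "finite B" using B(3) V(2) by (rule finite_subset)
  define P where "P = K x0"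
  define Q where "Q = K y0"
  have PQR: "trisection P Q (K (x0 + y0))"
    unfolding P_def Q_def by (rule trisection_if_incomparable[OF BV[OF x0(1)] BV[OF y0(1)] x0(2) y0(2) inc])
  have sub: "subspace P" "subspace Q" unfolding P_def Q_def by (rule subspace_K)+
  have dQ: "dim (K y0) = dim P"
    using K_trisection_dim(2)[OF PQR[unfolded P_def Q_def]] by (simp add: P_def)
  define c where "c = (if dim P = j then sumset P Q else P \<inter> Q)"
  have TS: "sumset P Q \<subseteq> S" unfolding P_def Q_def by (rule sumset_subset[OF S(1) K_subset K_subset])
  have finT: "finite (sumset P Q)" using TS finite_S by (rule finite_subset)
  have dT: "dim (sumset P Q) = Suc (dim P)"
    by (rule index_two_dim[OF trisection_index_sumset[OF PQR sub] sub(1) subspace_sumset[OF sub] finT])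
  have dPQ: "dim P = Suc (dim (P \<inter> Q))"
    using K_trisection_dim(1)[OF PQR[unfolded P_def Q_def]] by (simp add: P_def Q_def)
  have sPQ: "subspace (P \<inter> Q)" by (rule subspace_inter[OF sub])
  have fPQ: "finite (P \<inter> Q)" unfolding P_def using finite_K by blast
  have dP: "dim P = j \<or> dim P = Suc j" using two_dims[OF x0] by (simp add: P_def)
  have c_iff: "K x = c \<longleftrightarrow> dim (K x) \<noteq> dim P" if x: "x \<in> B" "x \<notin> S" for x
  proof
    assume "K x = c"
    then show "dim (K x) \<noteq> dim P" using dT dPQ by (auto simp: c_def split: if_splits)
  next
    assume ne: "dim (K x) \<noteq> dim P"
    show "K x = c"
    proof (cases "dim P = j")
      case True
      then have dx: "dim (K x) = Suc j" using ne two_dims[OF x] by simp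
      have "P \<subseteq> K x" unfolding P_def
        by (rule K_subset_if_dim_less[OF BV[OF x0(1)] BV[OF x(1)] x0(2) x(2)]) (use dx True P_def in simp)
      moreover have "Q \<subseteq> K x" unfolding Q_def
        by (rule K_subset_if_dim_less[OF BV[OF y0(1)] BV[OF x(1)] y0(2) x(2)]) (use dx True dQ in simp)
      ultimately have "sumset P Q \<subseteq> K x" by (rule sumset_subset[OF subspace_K])
      then have "sumset P Q = K x"
        by (rule subspace_eq_if_dim_ge[OF subspace_sumset[OF sub] subspace_K finite_K]) (simp add: dT dx True)
      then show ?thesis using True by (simp add: c_def)
    next
      case False
      then have dPj: "dim P = Suc j" using dP by simp
      then have dx: "dim (K x) = j" using ne two_dims[OF x] by simp
      have "K x \<subseteq> P" unfolding P_def
        by (rule K_subset_if_dim_less[OF BV[OF x(1)] BV[OF x0(1)] x(2) x0(2)]) (use dx dPj P_def in simp)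
      moreover have "K x \<subseteq> Q" unfolding Q_def
        by (rule K_subset_if_dim_less[OF BV[OF x(1)] BV[OF y0(1)] x(2) y0(2)]) (use dx dPj dQ in simp)
      ultimately have "K x \<subseteq> P \<inter> Q" by blast
      then have "K x = P \<inter> Q"
        by (rule subspace_eq_if_dim_ge[OF subspace_K sPQ fPQ]) (use dPQ dPj dx in simp)
      then show ?thesis using False by (simp add: c_def)
    qed
  qed
  have tri: "trisection (K x) (K y) (K (x + y))"
    if x: "x \<in> B" "x \<notin> S" "K x \<noteq> c" and y: "y \<in> B" "y \<notin> S" "K y \<noteq> c" and ne: "K x \<noteq> K y" for x y
    by (rule trisection_if_dim_eq[OF BV[OF x(1)] BV[OF y(1)] x(2) y(2) _ ne])
      (use c_iff[OF x(1,2)] c_iff[OF y(1,2)] x(3) y(3) in simp)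
  obtain Z W where Z: "subspace Z" and W: "subspace W" "S \<subseteq> Z" "Z \<subseteq> W" "W \<subseteq> B"
    and Zc: "\<And>x. x \<in> Z - S \<Longrightarrow> K x = c" and BWc: "\<And>x. x \<in> B - W \<Longrightarrow> K x = c"
    and WZc: "\<And>x. x \<in> W - Z \<Longrightarrow> K x \<noteq> c"
    and inj: "\<And>x y. x \<in> W - Z \<Longrightarrow> y \<in> W - Z \<Longrightarrow> x + y \<notin> Z \<Longrightarrow> K x \<noteq> K y"
  proof (rule value_decomposition[OF S(1) B(1,2), of K c x0 y0])
    show "K (x + s) = K x" if "s \<in> S" for x s using that by (rule K_shift)
  next
    fix x y assume x: "x \<in> B - S" and y: "y \<in> B - S" and c: "K x \<noteq> c" "K y \<noteq> c" "K x \<noteq> K y"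
    have t: "trisection (K x) (K y) (K (x + y))" by (rule tri) (use x y c in blast)+
    have d: "dim (K (x + y)) = dim (K x)" by (rule K_trisection_dim(3)[OF t])
    have xy: "x + y \<in> B" "x + y \<notin> S" using subspace_add[OF B(1)] x y add_notin_S[OF c(3)] by blast+
    have "dim (K x) = dim P" using c_iff[of x] x c(1) by blast
    then have "K (x + y) \<noteq> c" using c_iff[OF xy] d by simp
    moreover have "K (x + y) \<noteq> K x"
    proof
      assume eq: "K (x + y) = K x"
      have "index_two (K x \<inter> K y) (K x)" by (rule trisectionD(3)[OF t])
      then have "K x \<inter> K y \<noteq> K x" by (simp add: index_two_def psubset_eq)
      then show False using trisectionD(1)[OF t] eq by simp
    qed
    moreover have "K (x + y) \<noteq> K y"
    proof
      assume eq: "K (x + y) = K y"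
      have "index_two (K x \<inter> K y) (K y)" by (rule trisectionD(4)[OF t])
      then have "K x \<inter> K y \<noteq> K y" by (simp add: index_two_def psubset_eq)
      then show False using trisectionD(2)[OF t] eq by simp
    qed
    ultimately show "K (x + y) \<noteq> c \<and> K (x + y) \<noteq> K x \<and> K (x + y) \<noteq> K y" by simp
  next
    fix x y z assume *: "x \<in> B - S" "z \<in> B - S" "y \<in> B - S" "K x = K z" "K x \<noteq> c" "K y \<noteq> c" "K x \<noteq> K y"
    have "trisection (K x) (K y) (K (x + y))" by (rule tri) (use * in blast)+
    moreover have "trisection (K z) (K y) (K (z + y))" by (rule tri) (use * in auto)
    then have "trisection (K x) (K y) (K (z + y))" using *(4) by simp
    ultimately show "K (x + y) = K (z + y)" by (rule trisection_unique[OF _ _ subspace_K subspace_K subspace_K])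
  next
    fix x y assume x: "x \<in> B - S" and y: "y \<in> B - S" and *: "x + y \<notin> S" "K x = K y" "K x \<noteq> c"
    have xy: "x + y \<in> B" using subspace_add[OF B(1)] x y by blast
    show "K (x + y) = c \<or> K (x + y) = K x"
    proof (cases "K (x + y) = c")
      case False
      then have "dim (K (x + y)) = dim P" using c_iff[OF xy *(1)] by blast
      moreover have "dim (K x) = dim P" using c_iff[of x] x *(3) by blast
      ultimately have "K (x + y) = K x" using x y * BV by (intro K_add_same) auto
      then show ?thesis ..
    qed simp
  next
    show "x0 \<in> B - S" "y0 \<in> B - S" using x0 y0 by simp_all
    show "K x0 \<noteq> c" "K y0 \<noteq> c" using c_iff[OF x0] c_iff[OF y0] dQ by (simp_all add: P_def)
    show "K x0 \<noteq> K y0" using inc by auto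
  qed (rule that; assumption)
  have SW: "S \<subseteq> W" using W(2,3) by blast
  have finW: "finite W" using W(4) finB by (rule finite_subset)
  have ZB: "Z \<subseteq> B" using W(3,4) by blast
  have const: "dim C \<le> w + dim S"
    if C: "subspace C" "S \<subseteq> C" "C \<subseteq> B" and c: "\<And>x. x \<in> C \<Longrightarrow> x \<notin> S \<Longrightarrow> K x = c" for C
  proof -
    have "C \<subseteq> V" using C(3) B(3) by blast
    then obtain F where F: "eflat F" "F \<subseteq> C" "dim C = dim F + dim S"
      using eflat_exists_if_K_const[OF C(1,2) _ c] by blast
    then show ?thesis using small[of F] C(3) by simp
  qed
  obtain B1 where B1: "subspace B1" "S \<subseteq> B1" "B1 \<subseteq> B" "B1 \<inter> W = S" "dim B + dim S = dim W + dim B1"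
    by (rule complement_over_exists[OF S(1) SW W(1,4) B(1) finB])
  have "dim B1 \<le> w + dim S" by (rule const[OF B1(1-3)]) (rule BWc, use B1(3,4) in blast)
  moreover have "dim Z \<le> w + dim S" by (rule const[OF Z W(2) ZB]) (rule Zc, blast)
  moreover obtain B3 where B3: "subspace B3" "S \<subseteq> B3" "B3 \<subseteq> W" "B3 \<inter> Z = S" "dim W + dim S = dim Z + dim B3"
    by (rule complement_over_exists[OF S(1) W(2) Z W(3) W(1) finW])
  have B3B: "B3 \<subseteq> B" "B3 \<subseteq> V" using B3(3) W(4) B(3) by blast+
  have B3Z: "x \<in> W - Z" if "x \<in> B3" "x \<notin> S" for x using that B3(3,4) by blast
  have tri3: "trisection (K x) (K y) (K (x + y))"
    if x: "x \<in> B3" and y: "y \<in> B3" and nS: "x \<notin> S" "y \<notin> S" "x + y \<notin> S" for x y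
  proof -
    have "x + y \<in> B3" by (rule subspace_add[OF B3(1) x y])
    then have "x + y \<notin> Z" using B3(4) nS(3) by blast
    then have "K x \<noteq> K y" by (rule inj[OF B3Z[OF x nS(1)] B3Z[OF y nS(2)]])
    moreover have "K x \<noteq> c" "K y \<noteq> c" using WZc B3Z x y nS by blast+
    ultimately show ?thesis using x y nS B3B(1) by (intro tri) auto
  qed
  have "dim B3 \<le> dim S + (w + d + 2)"
  proof (rule dim_le_if_trisections[OF B3(1,2) B3B(2)])
    show "trisection (K x) (K y) (K (x + y))" if "x \<in> B3" "y \<in> B3" "x \<notin> S" "y \<notin> S" "x + y \<notin> S" for x y
      using that by (rule tri3)
  next
    fix F assume "eflat F" "F \<subseteq> B3"
    then show "dim F \<le> w" using small[of F] B3B(1) by simp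
  next
    fix T assume "subspace T" "T \<subseteq> S" "\<And>x. x \<in> B3 \<Longrightarrow> x \<notin> S \<Longrightarrow> index_two (K x) T"
    then show "dim B3 \<le> dim S + d" using tri3 by (intro top[OF B3(1,2) B3B(2)])
  qed
  ultimately show ?thesis using B1(5) B3(5) by simp
qed

text \<open>If all stabilizers are comparable, those of equal dimension coincide, so there is at
  most one value for each of the two dimensions. Otherwise \<open>dim_le_if_incomparable\<close>
  applies.\<close>

lemma level_dim_le:
  assumes B: "subspace B" "S \<subseteq> B" "B \<subseteq> V"
    and two_dims: "\<And>x. x \<in> B \<Longrightarrow> x \<notin> S \<Longrightarrow> dim (K x) = j \<or> dim (K x) = Suc j"
    and small: "\<And>W. eflat W \<Longrightarrow> W \<subseteq> B \<Longrightarrow> dim W \<le> w"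
    and top: "\<And>C T. subspace C \<Longrightarrow> S \<subseteq> C \<Longrightarrow> C \<subseteq> V \<Longrightarrow> subspace T \<Longrightarrow> T \<subseteq> S \<Longrightarrow>
      (\<And>x. x \<in> C \<Longrightarrow> x \<notin> S \<Longrightarrow> index_two (K x) T) \<Longrightarrow>
      (\<And>x y. x \<in> C \<Longrightarrow> y \<in> C \<Longrightarrow> x \<notin> S \<Longrightarrow> y \<notin> S \<Longrightarrow> x + y \<notin> S \<Longrightarrow>
        trisection (K x) (K y) (K (x + y))) \<Longrightarrow> dim C \<le> dim S + d"
  shows "dim B \<le> dim S + max (Suc w * 2 ^ Suc w + w) (3 * w + d + 2)"
proof (cases "\<forall>x\<in>B - S. \<forall>y\<in>B - S. K x \<subseteq> K y \<or> K y \<subseteq> K x")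
  case False
  then obtain x0 y0 where xy: "x0 \<in> B" "x0 \<notin> S" "y0 \<in> B" "y0 \<notin> S" "\<not> K x0 \<subseteq> K y0" "\<not> K y0 \<subseteq> K x0"
    by blast
  have "dim B \<le> dim S + (3 * w + d + 2)"
    by (rule dim_le_if_incomparable[OF B _ xy]) (fact two_dims small top)+
  then show ?thesis by simp
next
  case True
  then have comparable: "K x \<subseteq> K y \<or> K y \<subseteq> K x" if "x \<in> B" "x \<notin> S" "y \<in> B" "y \<notin> S" for x y
    using that by blast
  have eq: "K x = K y" if "x \<in> B" "x \<notin> S" "y \<in> B" "y \<notin> S" "dim (K x) = dim (K y)" for x y
    using comparable[OF that(1-4)] K_eq_if_subset[of x y] K_eq_if_subset[of y x] that(5) by auto
  show ?thesis
  proof (cases "\<exists>x y. x \<in> B \<and> x \<notin> S \<and> y \<in> B \<and> y \<notin> S \<and> dim (K x) = j \<and> dim (K y) = Suc j")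
    case True
    then obtain x y where x: "x \<in> B" "x \<notin> S" "dim (K x) = j" and y: "y \<in> B" "y \<notin> S" "dim (K y) = Suc j"
      by blast
    have "K x \<subseteq> K y"
    proof (rule disjE[OF comparable[OF x(1,2) y(1,2)]])
      assume "K y \<subseteq> K x"
      then have "dim (K y) \<le> dim (K x)" by (rule subspace_dim_mono[OF subspace_K subspace_K finite_K])
      then show ?thesis using x y by simp
    qed
    then have i: "index_two (K x) (K y)"
      by (rule index_two_if_dim[OF _ subspace_K subspace_K finite_K]) (simp add: x y)
    have two: "K z = K x \<or> K z = K y" if "z \<in> B" "z \<notin> S" for z
      using two_dims[OF that] eq[OF that x(1,2)] eq[OF that y(1,2)] x(3) y(3) by auto
    have "dim B \<le> dim S + (Suc w * 2 ^ Suc w + w)"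
      by (rule dim_le_if_two_values[OF B subspace_K subspace_K K_subset i]) (fact two small)+
    then show ?thesis by simp
  next
    case no: False
    have const: "K x = K y" if "x \<in> B" "x \<notin> S" "y \<in> B" "y \<notin> S" for x y
    proof (rule eq[OF that])
      show "dim (K x) = dim (K y)"
      proof (rule ccontr)
        assume "dim (K x) \<noteq> dim (K y)"
        then have "dim (K x) = j \<and> dim (K y) = Suc j \<or> dim (K y) = j \<and> dim (K x) = Suc j"
          using two_dims[OF that(1,2)] two_dims[OF that(3,4)] by linarith
        then show False using no that by blast
      qed
    qed
    have "\<exists>L. \<forall>x. x \<in> B \<longrightarrow> x \<notin> S \<longrightarrow> K x = L"
    proof (cases "\<exists>y. y \<in> B \<and> y \<notin> S")
      case True
      then obtain y where y: "y \<in> B" "y \<notin> S" by blast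
      have "\<forall>x. x \<in> B \<longrightarrow> x \<notin> S \<longrightarrow> K x = K y" using const[OF _ _ y] by blast
      then show ?thesis by (rule exI)
    qed blast
    then obtain L where L: "\<And>x. x \<in> B \<Longrightarrow> x \<notin> S \<Longrightarrow> K x = L" by blast
    have "\<exists>W. eflat W \<and> W \<subseteq> B \<and> dim B = dim W + dim S"
      by (rule eflat_exists_if_K_const[OF B]) (rule L)
    then obtain W where "eflat W" "W \<subseteq> B" "dim B = dim W + dim S" by blast
    then show ?thesis using small[of W] by simp
  qed
qed

end

section \<open>The filtration by dimension of the stabilizers\<close>

text \<open>The formula would give 4 at 0 and spoil superadditivity, hence the case distinction. The
  factor \<open>w + 2\<close> in place of \<open>Suc w\<close> absorbs the additional
  \<open>w\<close> in the bound for two values; the additive term \<open>w * (d + 4)\<close> covers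
  the part \<open>3 * w + d\<close> of the other bound.\<close>

definition level_bound :: "nat \<Rightarrow> nat \<Rightarrow> nat" where
  "level_bound d w = (if w = 0 then 0 else (w + 2) * 2 ^ (w + 1) + w * (d + 4))"

text \<open>Flats from different levels add up, and the bounds have to follow. For positive
  \<open>v\<close> and \<open>w\<close> both powers are at most \<open>2 ^ (v + w)\<close>, and
  \<open>v + w + 4\<close> is at most twice \<open>v + w + 2\<close>.\<close>

lemma level_bound_add: "level_bound d v + level_bound d w \<le> level_bound d (v + w)"
proof (cases "v = 0 \<or> w = 0")
  case False
  then have vw: "1 \<le> v" "1 \<le> w" by simp_all
  have "(2::nat) ^ (v + 1) \<le> 2 ^ (v + w)" "(2::nat) ^ (w + 1) \<le> 2 ^ (v + w)"
    using vw by (intro power_increasing; simp)+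
  then have "(v + 2) * 2 ^ (v + 1) + (w + 2) * 2 ^ (w + 1) \<le> (v + 2) * 2 ^ (v + w) + (w + 2) * 2 ^ (v + w)"
    by (intro add_mono mult_le_mono2)
  also have "\<dots> = (v + w + 4) * 2 ^ (v + w)" by (simp add: algebra_simps)
  also have "\<dots> \<le> (2 * (v + w + 2)) * 2 ^ (v + w)" by (rule mult_le_mono1) simp
  also have "\<dots> = (v + w + 2) * 2 ^ (v + w + 1)" by simp
  finally show ?thesis using False by (simp add: level_bound_def add_mult_distrib)
qed (auto simp: level_bound_def)

lemma level_bound_ge:
  assumes "1 \<le> w"
  shows "max (Suc w * 2 ^ Suc w + w) (3 * w + d + 2) \<le> level_bound d w"
proof -
  have "w \<le> 2 ^ Suc w" using less_exp[of "Suc w"] by linarith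
  moreover have "d \<le> w * d" using assms by simp
  moreover have "2 \<le> (2::nat) ^ Suc w" by simp
  moreover have "(w + 2) * 2 ^ (w + 1) = Suc w * 2 ^ Suc w + 2 ^ Suc w" by simp
  moreover have "w * (d + 4) = w * d + 4 * w" by (simp add: algebra_simps)
  ultimately have "Suc w * 2 ^ Suc w + w \<le> (w + 2) * 2 ^ (w + 1) + w * (d + 4)"
    "3 * w + d + 2 \<le> (w + 2) * 2 ^ (w + 1) + w * (d + 4)" by linarith+
  then show ?thesis using assms by (simp add: level_bound_def)
qed

lemma level_bound_mono: "v \<le> w \<Longrightarrow> level_bound d v \<le> level_bound d w"
  using level_bound_add[of d v "w - v"] by simp

context claw_free_config
begin

text \<open>Adding vectors whose stabilizers have dimension below \<open>j\<close> can raise the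
  dimension to \<open>j\<close>, but not further. So stabilizers have dimension at most
  \<open>j\<close> on \<open>fil j\<close> off \<open>S\<close>, and at least \<open>j\<close>
  outside \<open>fil j\<close>; between two consecutive steps only \<open>j\<close> and
  \<open>Suc j\<close> occur.\<close>

definition fil :: "nat \<Rightarrow> 'a set" where
  "fil j = span (S \<union> {x \<in> V - S. dim (K x) < j})"

lemma subspace_fil: "subspace (fil j)"
  by (simp add: fil_def)

lemma fil_subset: "fil j \<subseteq> V"
  unfolding fil_def using S(2) by (intro span_minimal[OF _ V(1)]) blast

lemma S_subset_fil: "S \<subseteq> fil j"
  unfolding fil_def using span_superset by blast

lemma in_fil: "x \<in> V \<Longrightarrow> x \<notin> S \<Longrightarrow> dim (K x) < j \<Longrightarrow> x \<in> fil j"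
  unfolding fil_def by (rule span_base) blast

lemma fil_mono: "fil j \<subseteq> fil (Suc j)"
  unfolding fil_def by (intro span_mono) auto

lemma fil_0: "fil 0 = S"
  unfolding fil_def using S(1) by simp

lemma fil_top: "fil (Suc (dim S)) = V"
proof
  show "V \<subseteq> fil (Suc (dim S))"
  proof
    fix x assume x: "x \<in> V"
    show "x \<in> fil (Suc (dim S))"
    proof (cases "x \<in> S")
      case True then show ?thesis using S_subset_fil by blast
    next
      case False
      have "dim (K x) \<le> dim S" by (rule subspace_dim_mono[OF subspace_K S(1) finite_S K_subset])
      then show ?thesis by (intro in_fil[OF x False]) simp
    qed
  qed
qed (rule fil_subset)

lemma fil_induct [consumes 1, case_names zero S add]:
  assumes "x \<in> fil j" "P 0" "\<And>s y. s \<in> S \<Longrightarrow> y \<in> fil j \<Longrightarrow> P y \<Longrightarrow> P (s + y)"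
    "\<And>a y. a \<in> V \<Longrightarrow> a \<notin> S \<Longrightarrow> dim (K a) < j \<Longrightarrow> y \<in> fil j \<Longrightarrow> P y \<Longrightarrow> P (a + y)"
  shows "P x"
proof -
  have "x \<in> fil j \<and> P x"
    using assms(1) unfolding fil_def
  proof (induction rule: span_induct_alt)
    case base
    show ?case using assms(2) by (simp add: span_zero)
  next
    case (step c a y)
    have y: "y \<in> fil j" "P y" using step.IH by (simp_all add: fil_def)
    show ?case
    proof (cases "c = 0")
      case True
      then show ?thesis using y by (simp add: fil_def)
    next
      case False
      have a: "a \<in> fil j" unfolding fil_def using step.hyps by (rule span_base)
      have "a + y \<in> fil j" by (rule subspace_add[OF subspace_fil a y(1)])
      moreover have "P (a + y)"
      proof (cases "a \<in> S")
        case True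
        then show ?thesis using y by (rule assms(3))
      next
        case False
        then have "a \<in> V" "dim (K a) < j" using step.hyps by simp_all
        then show ?thesis using False y by (intro assms(4))
      qed
      ultimately show ?thesis using False by (simp add: fil_def)
    qed
  qed
  then show ?thesis ..
qed

lemma K_shift_left: "s \<in> S \<Longrightarrow> K (s + x) = K x"
  using K_shift[of s x] by (simp add: add.commute)

text \<open>When a generator \<open>a\<close> is added to \<open>y\<close>, the new stabilizer is no
  larger than that of \<open>a\<close> or of \<open>y\<close>, with one exception:
  \<open>K a = K y\<close> of index two in \<open>K (a + y)\<close>. There
  \<open>dim (K a) < j\<close> still bounds the dimension by \<open>j\<close>.\<close>

lemma dim_K_le_if_fil:
  assumes "x \<in> fil j"
  shows "x \<notin> S \<longrightarrow> dim (K x) \<le> j"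
  using assms
proof (induction rule: fil_induct)
  case zero
  show ?case using zero_S by simp
next
  case (S s y)
  then show ?case using K_shift_left[of s y] S_add_iff(1)[of s y] by simp
next
  case (add a y)
  show ?case
  proof
    assume nS: "a + y \<notin> S"
    show "dim (K (a + y)) \<le> j"
    proof (cases "y \<in> S")
      case True
      then show ?thesis using K_shift[of y a] add.hyps(3) by simp
    next
      case False
      have y: "dim (K y) \<le> j" "y \<in> V" using False add.IH add.hyps(4) fil_subset by auto
      from add.hyps(1) y(2) add.hyps(2) False nS show ?thesis
      proof (cases rule: K_triangle_cases)
        case 1
        then have "dim (K (a + y)) \<le> dim (K a)" by (intro subspace_dim_mono[OF subspace_K subspace_K finite_K])
        then show ?thesis using add.hyps(3) by simp
      next
        case 7
        then show ?thesis using K_trisection_dim(3)[OF 7] add.hyps(3) by simp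
      qed (use add.hyps(3) y(1) in simp_all)
    qed
  qed
qed

text \<open>Stabilizers of generators have dimension below \<open>j\<close>, those outside
  \<open>fil j\<close> at least \<open>j\<close>. This gap leaves only triangle types with
  \<open>K (a + x) = K x\<close>.\<close>

lemma K_add_fil:
  assumes "y \<in> fil j" "x \<in> V" "x \<notin> fil j"
  shows "K (x + y) = K x"
proof -
  have "\<forall>x. x \<in> V \<longrightarrow> x \<notin> fil j \<longrightarrow> K (x + y) = K x"
    using assms(1)
  proof (induction rule: fil_induct)
    case zero
    show ?case by simp
  next
    case (S s y)
    show ?case
    proof (intro allI impI)
      fix x assume "x \<in> V" "x \<notin> fil j"
      then have "K (x + y) = K x" using S.IH by blast
      then show "K (x + (s + y)) = K x"
        using K_shift[OF S.hyps(1), of "x + y"] by (simp add: ac_simps)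
    qed
  next
    case (add a y)
    have a: "a \<in> fil j" by (rule in_fil) fact+
    show ?case
    proof (intro allI impI)
      fix x assume x: "x \<in> V" "x \<notin> fil j"
      have ax: "a + x \<in> V" "a + x \<notin> fil j"
        using subspace_add[OF V(1) add.hyps(1) x(1)] subspace_add_iff(1)[OF subspace_fil a, of x] x(2) by simp_all
      have nS: "x \<notin> S" "a + x \<notin> S" using x(2) ax(2) S_subset_fil by blast+
      have dx: "j \<le> dim (K x)" "j \<le> dim (K (a + x))"
        using in_fil[OF x(1) nS(1), of j] in_fil[OF ax(1) nS(2), of j] x(2) ax(2) by (meson not_le)+
      from add.hyps(1) x(1) add.hyps(2) nS have "K (a + x) = K x"
      proof (cases rule: K_triangle_cases)
        case 7
        then show ?thesis using K_trisection_dim(2)[OF 7] add.hyps(3) dx by simp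
      qed (use add.hyps(3) dx in simp_all)
      moreover have "K (a + x + y) = K (a + x)" using add.IH ax by blast
      ultimately show "K (x + (a + y)) = K x" by (simp add: ac_simps)
    qed
  qed
  then show ?thesis using assms(2,3) by blast
qed

text \<open>Together with \<open>K_add_fil\<close> this supplies the hypotheses of
  \<open>sum_in_E\<close> for a point of \<open>E\<close> in \<open>fil j\<close> and one outside,
  so flats of different levels add up inside \<open>E\<close>.\<close>

lemma K_subset_fil:
  assumes "y \<in> fil j" "y \<notin> S" "x \<in> V" "x \<notin> fil j"
  shows "K y \<subseteq> K x"
proof -
  have eq: "K (y + x) = K x" using K_add_fil[OF assms(1,3,4)] by (simp add: add.commute)
  have nS: "x \<notin> S" "y + x \<notin> S"
    using assms(4) S_subset_fil[of j] subspace_add_iff(1)[OF subspace_fil assms(1), of x] by blast+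
  have d: "dim (K y) \<le> j" using dim_K_le_if_fil[OF assms(1)] assms(2) by simp
  have dx: "j \<le> dim (K x)" using in_fil[OF assms(3) nS(1), of j] assms(4) by (meson not_le)
  have "y \<in> V" using assms(1) fil_subset by blast
  from this assms(3,2) nS show ?thesis
  proof (cases rule: K_triangle_cases)
    case 7
    have "index_two (K y \<inter> K x) (K x)" "K y \<inter> K x = K x"
      using trisectionD(4,2)[OF 7] eq by simp_all
    then show ?thesis by (simp add: index_two_def)
  next
    case 6
    then show ?thesis using d dx by simp
  qed (use eq in simp_all)
qed

text \<open>The flat grows along the filtration. A step with \<open>C \<subseteq> S\<close> changes
  neither the dimension nor the flat. Any other step offers at least the one-dimensional flat
  \<open>ext e {0}\<close>, so \<open>level_bound_ge\<close> applies, and superadditivity accounts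
  for the sum of the flats. The number of levels does not enter.\<close>

lemma dim_V_le:
  assumes small: "\<And>W. eflat W \<Longrightarrow> dim W \<le> k"
    and top: "\<And>C T. subspace C \<Longrightarrow> S \<subseteq> C \<Longrightarrow> C \<subseteq> V \<Longrightarrow> subspace T \<Longrightarrow> T \<subseteq> S \<Longrightarrow>
      (\<And>x. x \<in> C \<Longrightarrow> x \<notin> S \<Longrightarrow> index_two (K x) T) \<Longrightarrow>
      (\<And>x y. x \<in> C \<Longrightarrow> y \<in> C \<Longrightarrow> x \<notin> S \<Longrightarrow> y \<notin> S \<Longrightarrow> x + y \<notin> S \<Longrightarrow>
        trisection (K x) (K y) (K (x + y))) \<Longrightarrow> dim C \<le> dim S + d"
  shows "dim V \<le> dim S + level_bound d k"
proof -
  have "\<exists>W. eflat W \<and> W \<subseteq> fil j \<and> dim (fil j) \<le> dim S + level_bound d (dim W)" for j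
  proof (induction j)
    case 0
    show ?case using eflat_zero zero_S by (intro exI[of _ "{0}"]) (simp add: fil_0)
  next
    case (Suc j)
    then obtain W where W: "eflat W" "W \<subseteq> fil j" "dim (fil j) \<le> dim S + level_bound d (dim W)" by blast
    have finF: "finite (fil (Suc j))" using fil_subset V(2) by (rule finite_subset)
    obtain C where C: "subspace C" "S \<subseteq> C" "C \<subseteq> fil (Suc j)" "C \<inter> fil j = S"
      "dim (fil (Suc j)) + dim S = dim (fil j) + dim C"
      by (rule complement_over_exists[OF S(1) S_subset_fil subspace_fil fil_mono subspace_fil finF])
    have CV: "C \<subseteq> V" using C(3) fil_subset by blast
    have Cfil: "x \<notin> fil j" if "x \<in> C" "x \<notin> S" for x using that C(4) by blast
    define w where "w = Max (dim ` {X. eflat X \<and> X \<subseteq> C})"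
    have "finite {X. eflat X \<and> X \<subseteq> C}"
      using V(2) CV by (intro finite_subset[OF _ finite_Pow_iff[THEN iffD2]]) auto
    then have fin: "finite (dim ` {X. eflat X \<and> X \<subseteq> C})" by (rule finite_imageI)
    have "{0} \<in> {X. eflat X \<and> X \<subseteq> C}" using eflat_zero subspace_0[OF C(1)] by simp
    then have "w \<in> dim ` {X. eflat X \<and> X \<subseteq> C}" unfolding w_def using fin by (intro Max_in) auto
    then obtain X where X: "eflat X" "X \<subseteq> C" "dim X = w" by auto
    have max: "dim X \<le> w" if "eflat X" "X \<subseteq> C" for X
      unfolding w_def using fin that by (intro Max_ge) auto
    have dC: "dim C \<le> dim S + max (Suc w * 2 ^ Suc w + w) (3 * w + d + 2)"
    proof (rule level_dim_le[OF C(1,2) CV, of j])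
      fix x assume x: "x \<in> C" "x \<notin> S"
      have "j \<le> dim (K x)" using in_fil[OF _ x(2), of j] x(1) CV Cfil[OF x] by (meson not_le subsetD)
      moreover have "dim (K x) \<le> Suc j" using dim_K_le_if_fil[of x "Suc j"] x C(3) by blast
      ultimately show "dim (K x) = j \<or> dim (K x) = Suc j" by linarith
    qed (fact max top)+
    show ?case
    proof (cases "C \<subseteq> S")
      case True
      then have "C = S" using C(2) by blast
      then have "dim (fil (Suc j)) = dim (fil j)" using C(5) by simp
      then show ?thesis using W fil_mono by (intro exI[of _ W]) auto
    next
      case False
      then obtain x where x: "x \<in> C" "x \<notin> S" by blast
      obtain e where e: "e \<in> E" "x + e \<in> S" using coset_meets_E[of x] x CV by blast
      have "x + e \<in> C" using e(2) C(2) by blast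
      then have eC: "e \<in> C" by (simp add: subspace_add_iff[OF C(1) x(1)])
      have sub0: "subspace {0}" by (simp add: subspace_iff)
      have "eflat (ext e {0})" by (rule eflat_extI[OF eflat_zero e(1)]) simp
      moreover have "ext e {0} \<subseteq> C"
        using eC subspace_0[OF C(1)] by (intro ext_subset[OF C(1)]) simp_all
      ultimately have "dim (ext e {0}) \<le> w" by (rule max)
      moreover have "e \<noteq> 0" using e(1) zero_not_E by auto
      then have "dim (ext e {0}) = Suc (dim {0})" by (intro dim_ext[OF sub0]) simp_all
      ultimately have "1 \<le> w" by simp
      then have dC': "dim C \<le> dim S + level_bound d w" using dC level_bound_ge[of w d] by linarith
      have subW: "subspace W" "subspace X" using W(1) X(1) by (simp_all add: eflat_def)
      have "W \<inter> X \<subseteq> S" using W(2) X(2) C(4) by blast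
      then have WX: "W \<inter> X = {0}"
        using eflat_int_S[OF W(1)] subspace_0[OF subW(1)] subspace_0[OF subW(2)] by blast
      have "dim (sumset W X) = dim W + w"
        using dim_sumset[OF subW eflat_finite[OF W(1)] eflat_finite[OF X(1)] WX] X(3) by simp
      moreover have "eflat (sumset W X)"
        unfolding eflat_def
      proof
        show "subspace (sumset W X)" by (rule subspace_sumset[OF subW])
        show "sumset W X - {0} \<subseteq> E"
        proof
          fix z assume z: "z \<in> sumset W X - {0}"
          then obtain a b where ab: "a \<in> W" "b \<in> X" "z = a + b" by (blast elim: sumsetE)
          show "z \<in> E"
          proof (cases "a = 0 \<or> b = 0")
            case True
            then show ?thesis using z ab W(1) X(1) by (auto simp: eflat_def)
          next
            case False
            then have abE: "a \<in> E" "b \<in> E" using ab W(1) X(1) by (auto simp: eflat_def)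
            have a: "a \<in> fil j" using ab(1) W(2) by blast
            have b: "b \<in> V" "b \<notin> fil j"
              using ab(2) X(2) CV Cfil[of b] E_notin_S[OF abE(2)] by blast+
            have "a + b \<notin> fil j" using b(2) subspace_add_iff(1)[OF subspace_fil a] by simp
            then have nS: "a + b \<notin> S" using S_subset_fil by blast
            have "K (a + b) = K b" using K_add_fil[OF a b] by (simp add: add.commute)
            then show ?thesis unfolding ab(3)
              using K_subset_fil[OF a E_notin_S[OF abE(1)] b] by (intro sum_in_E[OF abE nS]) simp_all
          qed
        qed
      qed
      moreover have "sumset W X \<subseteq> fil (Suc j)"
        using W(2) X(2) fil_mono[of j] C(3) by (intro sumset_subset[OF subspace_fil]) blast+
      moreover have "dim (fil (Suc j)) \<le> dim S + level_bound d (dim W + w)"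
        using C(5) W(3) dC' level_bound_add[of d "dim W" w] by linarith
      ultimately show ?thesis by (intro exI[of _ "sumset W X"]) simp
    qed
  qed
  then obtain W where W: "eflat W" "dim (fil (Suc (dim S))) \<le> dim S + level_bound d (dim W)" by blast
  have "level_bound d (dim W) \<le> level_bound d k" by (rule level_bound_mono[OF small[OF W(1)]])
  then show ?thesis using W(2) unfolding fil_top by simp
qed

end

section \<open>Embedding an even-plane matroid\<close>

context binary_space
begin

section \<open>Functionals and pairings over the two-element field\<close>

definition additive_on :: "'a set \<Rightarrow> ('a \<Rightarrow> bool) \<Rightarrow> bool" where
  "additive_on T g \<longleftrightarrow> (\<forall>s\<in>T. \<forall>t\<in>T. g (s + t) \<longleftrightarrow> g s \<noteq> g t)"

lemma additive_onD: "additive_on T g \<Longrightarrow> s \<in> T \<Longrightarrow> t \<in> T \<Longrightarrow> g (s + t) \<longleftrightarrow> g s \<noteq> g t"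
  by (simp add: additive_on_def)

lemma additive_on_zero:
  assumes "additive_on T g" "0 \<in> T"
  shows "\<not> g 0"
  using additive_onD[OF assms(1) assms(2) assms(2)] by simp

text \<open>Translation by \<open>u\<close> permutes \<open>T\<close> and flips every sign.\<close>

lemma sum_signs_eq_0:
  fixes g :: "'a \<Rightarrow> bool"
  assumes "subspace T" "finite T" "additive_on T g"
    and "u \<in> T" "g u"
  shows "(\<Sum>t\<in>T. if g t then -1 else 1 :: real) = 0"
proof -
  define f where "f t = (if g t then -1 else 1 :: real)" for t
  have "sum f T = sum (\<lambda>t. f (u + t)) T"
  proof (rule sum.reindex_bij_witness[of _ "(+) u" "(+) u"])
    show "u + t \<in> T" "u + t \<in> T" if "t \<in> T" for t
      using subspace_add[OF assms(1,4) that] by simp_all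
  qed simp_all
  also have "\<dots> = sum (\<lambda>t. - f t) T"
    using additive_onD[OF assms(3,4)] assms(5) by (intro sum.cong) (simp_all add: f_def)
  also have "\<dots> = - sum f T" by (rule sum_negf)
  finally show ?thesis by (simp add: f_def)
qed

text \<open>
  Counting with characters: the number of \<open>t\<close> that represent a given functional \<open>mu\<close> is
  \<open>card T / card A\<close>.
\<close>

lemma functional_represented:
  assumes A: "subspace A" "finite A" and T: "subspace T" "finite T"
    and left: "\<And>t. t \<in> T \<Longrightarrow> additive_on A (\<lambda>a. p a t)"
    and right: "\<And>a. a \<in> A \<Longrightarrow> additive_on T (p a)"
    and nondegenerate: "\<And>a. a \<in> A \<Longrightarrow> a \<noteq> 0 \<Longrightarrow> \<exists>t\<in>T. p a t"
    and mu: "additive_on A mu"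
  shows "\<exists>t\<in>T. \<forall>a\<in>A. p a t \<longleftrightarrow> mu a"
proof (rule ccontr)
  assume "\<not> ?thesis"
  then have no: "\<exists>a\<in>A. p a t \<noteq> mu a" if "t \<in> T" for t using that by blast
  define sg where "sg b = (if b then -1 else 1 :: real)" for b :: bool
  have sg: "sg (b \<noteq> c) = sg b * sg c" for b c by (simp add: sg_def)
  have A0: "0 \<in> A" by (rule subspace_0[OF A(1)])
  have "(\<Sum>a\<in>A. sg (p a t \<noteq> mu a)) = 0" if t: "t \<in> T" for t
  proof -
    obtain a where a: "a \<in> A" "p a t \<noteq> mu a" using no[OF t] by blast
    have "additive_on A (\<lambda>a. p a t \<noteq> mu a)"
      using left[OF t] mu unfolding additive_on_def by blast
    then show ?thesis unfolding sg_def using a by (rule sum_signs_eq_0[OF A])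
  qed
  then have "0 = (\<Sum>t\<in>T. \<Sum>a\<in>A. sg (p a t \<noteq> mu a))" by simp
  also have "\<dots> = (\<Sum>a\<in>A. \<Sum>t\<in>T. sg (p a t \<noteq> mu a))" by (rule sum.swap)
  also have "\<dots> = (\<Sum>a\<in>A. sg (mu a) * (\<Sum>t\<in>T. sg (p a t)))"
    by (simp only: sg sum_distrib_left mult.commute)
  also have "\<dots> = (\<Sum>a\<in>A. if a = 0 then real (card T) else 0)"
  proof (rule sum.cong[OF refl])
    fix a assume a: "a \<in> A"
    show "sg (mu a) * (\<Sum>t\<in>T. sg (p a t)) = (if a = 0 then real (card T) else 0)"
    proof (cases "a = 0")
      case True
      have "(\<Sum>t\<in>T. sg (p 0 t)) = (\<Sum>t\<in>T. 1)"
        using additive_on_zero[OF left A0] by (intro sum.cong) (simp_all add: sg_def)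
      moreover have "sg (mu 0) = 1" using additive_on_zero[OF mu A0] by (simp add: sg_def)
      ultimately show ?thesis using True by simp
    next
      case False
      obtain u where u: "u \<in> T" "p a u" using nondegenerate[OF a False] by blast
      have "(\<Sum>t\<in>T. sg (p a t)) = 0" unfolding sg_def
        by (rule sum_signs_eq_0[OF T right[OF a] u])
      then show ?thesis using False by simp
    qed
  qed
  also have "\<dots> = real (card T)" using A(2) A0 by simp
  finally have "card T = 0" by simp
  then show False using T subspace_0[OF T(1)] by auto
qed

lemma index_two_add_iff:
  assumes "index_two P T" "subspace P" "s \<in> T" "t \<in> T"
  shows "s + t \<in> P \<longleftrightarrow> (s \<in> P \<longleftrightarrow> t \<in> P)"
proof (cases "s \<in> P \<or> t \<in> P")
  case True
  then show ?thesis using subspace_add_iff[OF assms(2)] by blast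
next
  case False
  then have "s + t \<in> P" using assms(1,3,4) by (simp add: index_two_def)
  then show ?thesis using False by blast
qed

text \<open>The exclusive or of \<open>f\<close> over the seven points of the plane. If
  \<open>f 0\<close> is false, this is the third difference of \<open>f\<close> at 0, whose
  vanishing characterizes quadratic behaviour.\<close>

definition plane_parity :: "('a \<Rightarrow> bool) \<Rightarrow> 'a \<Rightarrow> 'a \<Rightarrow> 'a \<Rightarrow> bool" where
  "plane_parity f x y z \<longleftrightarrow>
    (f x \<noteq> (f y \<noteq> (f (x + y) \<noteq> (f z \<noteq> (f (x + z) \<noteq> (f (y + z) \<noteq> f (x + y + z)))))))"

lemma plane_parity_swap: "plane_parity f x y z \<longleftrightarrow> plane_parity f y x z"
  "plane_parity f x y z \<longleftrightarrow> plane_parity f x z y"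
proof -
  have eqs: "y + x = x + y" "z + y = y + z" "x + z + y = x + y + z" by (simp_all add: ac_simps)
  show "plane_parity f x y z \<longleftrightarrow> plane_parity f y x z" "plane_parity f x y z \<longleftrightarrow> plane_parity f x z y"
    unfolding plane_parity_def eqs by blast+
qed

end

text \<open>Abstraction of a lift whose stabilizers all have index two in \<open>T\<close>:
  \<open>f\<close> is membership in \<open>E\<close>, and \<open>p h t\<close> says that shifting by
  \<open>t\<close> changes membership of \<open>h\<close>. No nonzero class of \<open>H\<close>
  modulo \<open>T\<close> is orthogonal to \<open>T\<close>, and \<open>f_claw\<close> is
  claw-freeness for triples independent modulo \<open>T\<close>.\<close>

locale quadratic_config = binary_space scale
  for scale :: "bit \<Rightarrow> 'a::ab_group_add \<Rightarrow> 'a" +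
  fixes H T :: "'a set" and p :: "'a \<Rightarrow> 'a \<Rightarrow> bool" and f :: "'a \<Rightarrow> bool"
  assumes H: "subspace H" "finite H" and T: "subspace T" "T \<subseteq> H"
    and left: "\<And>t. t \<in> T \<Longrightarrow> additive_on H (\<lambda>h. p h t)"
    and right: "\<And>h. h \<in> H \<Longrightarrow> additive_on T (p h)"
    and nondegenerate: "\<And>h. h \<in> H \<Longrightarrow> h \<notin> T \<Longrightarrow> \<exists>t\<in>T. p h t"
    and f_shift: "\<And>h t. h \<in> H \<Longrightarrow> t \<in> T \<Longrightarrow> f (h + t) \<longleftrightarrow> f h \<noteq> p h t"
    and f_zero: "\<not> f 0"
    and f_claw: "\<And>x y z. x \<in> H \<Longrightarrow> y \<in> H \<Longrightarrow> z \<in> H \<Longrightarrow> x \<notin> T \<Longrightarrow> y \<notin> T \<Longrightarrow> z \<notin> T \<Longrightarrow>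
      x + y \<notin> T \<Longrightarrow> x + z \<notin> T \<Longrightarrow> y + z \<notin> T \<Longrightarrow> x + y + z \<notin> T \<Longrightarrow>
      f x \<Longrightarrow> f y \<Longrightarrow> f z \<Longrightarrow> \<not> f (x + y) \<Longrightarrow> \<not> f (x + z) \<Longrightarrow> \<not> f (y + z) \<Longrightarrow> f (x + y + z)"
begin

lemma H_add: "x \<in> H \<Longrightarrow> y \<in> H \<Longrightarrow> x + y \<in> H"
  by (rule subspace_add[OF H(1)])

lemma T_add: "x \<in> T \<Longrightarrow> y \<in> T \<Longrightarrow> x + y \<in> T"
  by (rule subspace_add[OF T(1)])

lemma zero_H: "0 \<in> H" and zero_T: "0 \<in> T"
  by (rule subspace_0[OF H(1)] subspace_0[OF T(1)])+

lemma p_left: "x \<in> H \<Longrightarrow> y \<in> H \<Longrightarrow> t \<in> T \<Longrightarrow> p (x + y) t \<longleftrightarrow> p x t \<noteq> p y t"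
  using additive_onD[OF left] by blast

lemma p_right: "x \<in> H \<Longrightarrow> s \<in> T \<Longrightarrow> t \<in> T \<Longrightarrow> p x (s + t) \<longleftrightarrow> p x s \<noteq> p x t"
  using additive_onD[OF right] by blast

lemma p_zero_right: "x \<in> H \<Longrightarrow> \<not> p x 0"
  using additive_on_zero[OF right zero_T] by blast

lemma p_right_if:
  assumes "x \<in> H" "s \<in> T" "t \<in> T"
  shows "p x (s + (if b then t else 0)) \<longleftrightarrow> p x s \<noteq> (b \<and> p x t)"
  using p_right[OF assms] by (cases b) simp_all

lemma p_left_if:
  assumes "x \<in> H" "y \<in> H" "t \<in> T"
  shows "p (x + (if b then y else 0)) t \<longleftrightarrow> p x t \<noteq> (b \<and> p y t)"
  using p_left[OF assms] by (cases b) simp_all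

lemma T_add_if: "s \<in> T \<Longrightarrow> t \<in> T \<Longrightarrow> s + (if b then t else 0) \<in> T"
  using T_add by simp

lemma H_add_if: "x \<in> H \<Longrightarrow> y \<in> H \<Longrightarrow> x + (if b then y else 0) \<in> H"
  using H_add by simp

text \<open>The functional \<open>p z\<close> is neither zero, witnessed by \<open>u\<close>, nor
  equal to \<open>p y\<close>, witnessed by \<open>v\<close>. One of \<open>u\<close>,
  \<open>v\<close>, \<open>u + v\<close> then has both properties.\<close>

lemma separate_two:
  assumes "y \<in> H" "z \<in> H" "z \<notin> T" "y + z \<notin> T"
  obtains t where "t \<in> T" "p z t" "\<not> p y t"
proof -
  obtain u where u: "u \<in> T" "p z u" using nondegenerate[OF assms(2,3)] by blast
  obtain v where v: "v \<in> T" "p (y + z) v" using nondegenerate[OF H_add[OF assms(1,2)] assms(4)] by blast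
  have v': "p y v \<noteq> p z v" using p_left[OF assms(1,2) v(1)] v(2) by simp
  consider "\<not> p y u" | "p z v" | "p y u" "\<not> p z v" by blast
  then show ?thesis
  proof cases
    case 1 then show ?thesis using that[OF u] by blast
  next
    case 2 then show ?thesis using that[OF v(1)] v' by blast
  next
    case 3
    have "p z (u + v)" "\<not> p y (u + v)"
      using 3 v' u(2) p_right[OF assms(2) u(1) v(1)] p_right[OF assms(1) u(1) v(1)] by simp_all
    then show ?thesis by (rule that[OF T_add[OF u(1) v(1)]])
  qed
qed

lemma separate_three:
  assumes "x \<in> H" "y \<in> H" "z \<in> H" "x \<notin> T" "y \<notin> T" "z \<notin> T"
    and "x + y \<notin> T" "x + z \<notin> T" "y + z \<notin> T" "x + y + z \<notin> T"
  obtains t where "t \<in> T" "p x t" "\<not> p y t" "\<not> p z t"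
proof -
  have "z + y \<notin> T" using assms(9) by (simp add: add.commute)
  then obtain u where u: "u \<in> T" "p y u" "\<not> p z u"
    by (rule separate_two[OF assms(3,2,5)])
  obtain v where v: "v \<in> T" "p z v" "\<not> p y v"
    by (rule separate_two[OF assms(2,3,6,9)])
  \<comment> \<open>Gaussian elimination: \<open>h\<close> is \<open>x\<close> corrected so as to be
    orthogonal to \<open>u\<close> and \<open>v\<close>. Dually, \<open>t\<close> below is
    \<open>w\<close> corrected so as to be orthogonal to \<open>y\<close> and \<open>z\<close>, and
    \<open>p x t\<close> agrees with \<open>p h w\<close>.\<close>
  define h where "h = x + (if p x u then y else 0) + (if p x v then z else 0)"
  have hH: "h \<in> H" unfolding h_def using assms(1-3) zero_H H_add by simp
  have "h \<notin> T" unfolding h_def using assms by simp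
  then obtain w where w: "w \<in> T" "p h w" using nondegenerate[OF hH] by blast
  define t where "t = w + (if p y w then u else 0) + (if p z w then v else 0)"
  have "p h w \<longleftrightarrow> (p x w \<noteq> (p x u \<and> p y w)) \<noteq> (p x v \<and> p z w)"
    unfolding h_def p_left_if[OF H_add_if[OF assms(1,2)] assms(3) w(1)] p_left_if[OF assms(1,2) w(1)] ..
  then have pw: "(p x w \<noteq> (p x u \<and> p y w)) \<noteq> (p x v \<and> p z w)" using w(2) by blast
  have pt: "p k t \<longleftrightarrow> (p k w \<noteq> (p y w \<and> p k u)) \<noteq> (p z w \<and> p k v)" if "k \<in> H" for k
    unfolding t_def p_right_if[OF that T_add_if[OF w(1) u(1)] v(1)] p_right_if[OF that w(1) u(1)] ..
  have "t \<in> T" unfolding t_def by (rule T_add_if[OF T_add_if[OF w(1) u(1)] v(1)])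
  moreover have "p x t" unfolding pt[OF assms(1)] using pw by argo
  moreover have "\<not> p y t" unfolding pt[OF assms(2)] using u(2) v(3) by simp
  moreover have "\<not> p z t" unfolding pt[OF assms(3)] using u(3) v(2) by simp
  ultimately show ?thesis by (rule that)
qed

lemma solve_three:
  assumes "x \<in> H" "y \<in> H" "z \<in> H" "x \<notin> T" "y \<notin> T" "z \<notin> T"
    and "x + y \<notin> T" "x + z \<notin> T" "y + z \<notin> T" "x + y + z \<notin> T"
  obtains t where "t \<in> T" "p x t = a" "p y t = b" "p z t = c"
proof -
  have sw: "y + x \<notin> T" "z + x \<notin> T" "z + y \<notin> T" "y + x + z \<notin> T" "z + x + y \<notin> T"
    using assms(7-10) by (simp_all add: ac_simps)
  obtain u where u: "u \<in> T" "p x u" "\<not> p y u" "\<not> p z u" by (rule separate_three[OF assms])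
  obtain v where v: "v \<in> T" "p y v" "\<not> p x v" "\<not> p z v"
    by (rule separate_three[OF assms(2,1,3,5,4,6) sw(1) assms(9,8) sw(4)])
  obtain w where w: "w \<in> T" "p z w" "\<not> p x w" "\<not> p y w"
    by (rule separate_three[OF assms(3,1,2,6,4,5) sw(2,3) assms(7) sw(5)])
  define t where "t = 0 + (if a then u else 0) + (if b then v else 0) + (if c then w else 0)"
  note T1 = T_add_if[OF zero_T u(1), of a]
  note T2 = T_add_if[OF T1 v(1), of b]
  have pt: "p k t \<longleftrightarrow> ((a \<and> p k u) \<noteq> (b \<and> p k v)) \<noteq> (c \<and> p k w)" if k: "k \<in> H" for k
    unfolding t_def p_right_if[OF k T2 w(1)] p_right_if[OF k T1 v(1)] p_right_if[OF k zero_T u(1)]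
    using p_zero_right[OF k] by argo
  have "t \<in> T" unfolding t_def by (rule T_add_if[OF T2 w(1)])
  moreover have "p x t = a" unfolding pt[OF assms(1)] using u v w by simp
  moreover have "p y t = b" unfolding pt[OF assms(2)] using u v w by simp
  moreover have "p z t = c" unfolding pt[OF assms(3)] using u v w by simp
  ultimately show ?thesis by (rule that)
qed

text \<open>Four of the seven points move, and the changes \<open>p x t\<close>,
  \<open>p (x + y) t\<close>, \<open>p (x + z) t\<close> and \<open>p (x + y + z) t\<close> cancel
  by additivity.\<close>

lemma plane_parity_shift:
  assumes "x \<in> H" "y \<in> H" "z \<in> H" "t \<in> T"
  shows "plane_parity f (x + t) y z \<longleftrightarrow> plane_parity f x y z"
proof -
  have eqs: "x + t + y = x + y + t" "x + t + z = x + z + t" "x + y + t + z = x + y + z + t"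
    by (simp_all add: ac_simps)
  show ?thesis
    using assms unfolding plane_parity_def eqs
    by (simp add: f_shift H_add p_left) argo
qed

lemma not_T_shift: "t \<in> T \<Longrightarrow> x + t \<notin> T \<longleftrightarrow> x \<notin> T" "t \<in> T \<Longrightarrow> t + x \<notin> T \<longleftrightarrow> x \<notin> T"
  using subspace_add_iff[OF T(1)] by blast+

definition independent_mod :: "'a \<Rightarrow> 'a \<Rightarrow> 'a \<Rightarrow> bool" where
  "independent_mod x y z \<longleftrightarrow> x \<in> H \<and> y \<in> H \<and> z \<in> H \<and> x \<notin> T \<and> y \<notin> T \<and> z \<notin> T \<and>
    x + y \<notin> T \<and> x + z \<notin> T \<and> y + z \<notin> T \<and> x + y + z \<notin> T"

lemma independent_mod_swap:
  assumes "independent_mod x y z"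
  shows "independent_mod y x z" "independent_mod x z y"
proof -
  have eqs: "y + x = x + y" "z + y = y + z" "x + z + y = x + y + z" by (simp_all add: ac_simps)
  show "independent_mod y x z" "independent_mod x z y"
    using assms unfolding independent_mod_def eqs by blast+
qed

lemma independent_mod_shift:
  assumes "independent_mod x y z" "t \<in> T"
  shows "independent_mod (x + t) y z"
proof -
  have eqs: "x + t + y = x + y + t" "x + t + z = x + z + t" "x + y + t + z = x + y + z + t"
    by (simp_all add: ac_simps)
  have "t \<in> H" using assms(2) T(2) by blast
  then show ?thesis
    using assms unfolding independent_mod_def eqs by (simp add: not_T_shift H_add)
qed

lemma solve_mod:
  assumes "independent_mod x y z"
  obtains t where "t \<in> T" "p x t = a" "p y t = b" "p z t = c"
  using assms solve_three[of x y z a b c] unfolding independent_mod_def by blast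

text \<open>
  Shifting by elements of \<open>T\<close> does not change the parity, and allows to assume that \<open>x\<close>, \<open>y\<close>, \<open>z\<close>
  but none of their pairwise sums satisfy \<open>f\<close>.
\<close>

lemma plane_parity_even:
  assumes "independent_mod x y z"
  shows "\<not> plane_parity f x y z"
proof -
  have shift: "f (u + t) \<longleftrightarrow> f u \<noteq> p u t" if "u \<in> H" "t \<in> T" for u t using that by (rule f_shift)
  obtain r where r: "r \<in> T" "p x r = (\<not> f x)" "p y r = True" "p z r = True"
    by (rule solve_mod[OF assms])
  define x' where "x' = x + r"
  have i1: "independent_mod x' y z" unfolding x'_def by (rule independent_mod_shift[OF assms r(1)])
  have xH: "x \<in> H" "y \<in> H" "z \<in> H" using assms by (simp_all add: independent_mod_def)
  have x'H: "x' \<in> H" using i1 by (simp add: independent_mod_def)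
  have fx: "f x'" unfolding x'_def using shift[OF xH(1) r(1)] r(2) by simp
  have par1: "plane_parity f x' y z \<longleftrightarrow> plane_parity f x y z"
    unfolding x'_def by (rule plane_parity_shift[OF xH r(1)])
  \<comment> \<open>The value of \<open>p y s\<close> makes \<open>f\<close> true at
    \<open>y + s\<close>; the value of \<open>p x' s\<close> then makes it false at
    \<open>x' + y + s\<close>.\<close>
  obtain s where s: "s \<in> T" "p x' s = (f (x' + y) \<noteq> (\<not> f y))" "p y s = (\<not> f y)" "p z s = True"
    by (rule solve_mod[OF i1])
  define y' where "y' = y + s"
  have i2: "independent_mod y' x' z" unfolding y'_def
    by (rule independent_mod_shift[OF independent_mod_swap(1)[OF i1] s(1)])
  have y'H: "y' \<in> H" using i2 by (simp add: independent_mod_def)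
  have fy: "f y'" unfolding y'_def using shift[OF xH(2) s(1)] s(3) by simp
  have xy: "x' + y' = x' + y + s" by (simp add: y'_def ac_simps)
  have fxy: "\<not> f (x' + y')"
    unfolding xy using shift[OF H_add[OF x'H xH(2)] s(1)] p_left[OF x'H xH(2) s(1)] s(2,3) by argo
  have par2: "plane_parity f y' x' z \<longleftrightarrow> plane_parity f y x' z"
    unfolding y'_def by (rule plane_parity_shift[OF xH(2) x'H xH(3) s(1)])
  \<comment> \<open>In the same way \<open>q\<close> makes \<open>f\<close> true at the third vector
    and false at its sums with \<open>x'\<close> and \<open>y'\<close>. Only the sum of all three is
    left, and \<open>f_claw\<close> decides it.\<close>
  obtain q where q: "q \<in> T" "p y' q = (f (y' + z) \<noteq> (\<not> f z))"
    "p x' q = (f (x' + z) \<noteq> (\<not> f z))" "p z q = (\<not> f z)"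
    by (rule solve_mod[OF i2])
  define z' where "z' = z + q"
  have i3: "independent_mod z' x' y'" unfolding z'_def
    by (rule independent_mod_shift[OF independent_mod_swap(1)[OF independent_mod_swap(2)[OF independent_mod_swap(1)[OF i2]]] q(1)])
  have z'H: "z' \<in> H" using i3 by (simp add: independent_mod_def)
  have fz: "f z'" unfolding z'_def using shift[OF xH(3) q(1)] q(4) by simp
  have xz: "x' + z' = x' + z + q" by (simp add: z'_def ac_simps)
  have fxz: "\<not> f (x' + z')"
    unfolding xz using shift[OF H_add[OF x'H xH(3)] q(1)] p_left[OF x'H xH(3) q(1)] q(3,4) by argo
  have yz: "y' + z' = y' + z + q" by (simp add: z'_def ac_simps)
  have fyz: "\<not> f (y' + z')"
    unfolding yz using shift[OF H_add[OF y'H xH(3)] q(1)] p_left[OF y'H xH(3) q(1)] q(2,4) by argo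
  have par3: "plane_parity f z' x' y' \<longleftrightarrow> plane_parity f z x' y'"
    unfolding z'_def by (rule plane_parity_shift[OF xH(3) x'H y'H q(1)])
  have i4: "independent_mod x' y' z'"
    by (rule independent_mod_swap(2)[OF independent_mod_swap(1)[OF i3]])
  then have "f (x' + y' + z')"
    unfolding independent_mod_def by (elim conjE) (rule f_claw[OF _ _ _ _ _ _ _ _ _ _ fx fy fz fxy fxz fyz])
  then have "\<not> plane_parity f x' y' z'"
    using fx fy fz fxy fxz fyz by (simp add: plane_parity_def)
  moreover have "plane_parity f x y z \<longleftrightarrow> plane_parity f y' x' z"
    unfolding par2 plane_parity_swap(1)[of f y x' z] par1 ..
  moreover have "plane_parity f y' x' z \<longleftrightarrow> plane_parity f z x' y'"
    using plane_parity_swap(1)[of f y' x' z] plane_parity_swap(2)[of f x' y' z]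
      plane_parity_swap(1)[of f x' z y'] by simp
  moreover have "plane_parity f z' x' y' \<longleftrightarrow> plane_parity f x' y' z'"
    using plane_parity_swap(1)[of f z' x' y'] plane_parity_swap(2)[of f x' z' y'] by simp
  ultimately show ?thesis using par3 by simp
qed

end

section \<open>Embedding one vector at a time\<close>

locale embedding_config = quadratic_config scale H T p f + N: binary_space scale'
  for scale :: "bit \<Rightarrow> 'a::ab_group_add \<Rightarrow> 'a" and H T p f
    and scale' :: "bit \<Rightarrow> 'b::ab_group_add \<Rightarrow> 'b" +
  fixes U :: "'b set" and q :: "'b \<Rightarrow> bool"
  assumes U: "N.subspace U" "finite U"
    and q_zero: "\<not> q 0"
    and q_even: "\<And>x y z. x \<in> U \<Longrightarrow> y \<in> U \<Longrightarrow> z \<in> U \<Longrightarrow> x \<noteq> 0 \<Longrightarrow> y \<noteq> 0 \<Longrightarrow> z \<noteq> 0 \<Longrightarrow>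
      x + y \<noteq> 0 \<Longrightarrow> x + z \<noteq> 0 \<Longrightarrow> y + z \<noteq> 0 \<Longrightarrow> x + y + z \<noteq> 0 \<Longrightarrow> \<not> N.plane_parity q x y z"
    and dim_le: "dim T + N.dim U \<le> dim H"
begin

text \<open>An image that meets \<open>T\<close> only in 0 is more than injectivity:
  \<open>p\<close> then realizes every functional on the image by an element of \<open>T\<close>,
  which the extension step exploits.\<close>

definition embeds :: "'b set \<Rightarrow> ('b \<Rightarrow> 'a) \<Rightarrow> bool" where
  "embeds A phi \<longleftrightarrow> N.subspace A \<and> A \<subseteq> U \<and> (\<forall>x\<in>A. \<forall>y\<in>A. phi (x + y) = phi x + phi y) \<and>
    phi ` A \<subseteq> H \<and> (\<forall>x\<in>A. phi x \<in> T \<longrightarrow> x = 0) \<and> (\<forall>x\<in>A. f (phi x) \<longleftrightarrow> q x)"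

lemma embeds_inj:
  assumes "embeds A phi"
  shows "inj_on phi A"
proof (rule inj_onI)
  fix x y assume xy: "x \<in> A" "y \<in> A" "phi x = phi y"
  have "phi (x + y) = phi x + phi y" using assms xy by (simp add: embeds_def)
  then have "phi (x + y) \<in> T" using xy(3) zero_T by simp
  moreover have "x + y \<in> A" using assms xy N.subspace_add by (simp add: embeds_def)
  ultimately have "x + y = 0" using assms unfolding embeds_def by blast
  then show "x = y" by simp
qed

text \<open>
  A partial embedding extends by one dimension: the conditions on the shift of the image of \<open>n\<close> by
  an element of \<open>T\<close> prescribe a functional, additive because both sides have even planes.
\<close>

lemma embeds_extend:
  assumes phi: "embeds A phi" and n: "n \<in> U" "n \<notin> A"
  shows "\<exists>phi'. embeds (N.ext n A) phi'"
proof -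
  have A: "N.subspace A" "A \<subseteq> U" and phi_add: "\<And>x y. x \<in> A \<Longrightarrow> y \<in> A \<Longrightarrow> phi (x + y) = phi x + phi y"
    and phi_H: "\<And>x. x \<in> A \<Longrightarrow> phi x \<in> H" and phi_T: "\<And>x. x \<in> A \<Longrightarrow> phi x \<in> T \<Longrightarrow> x = 0"
    and f_phi: "\<And>x. x \<in> A \<Longrightarrow> f (phi x) \<longleftrightarrow> q x"
    using phi by (auto simp: embeds_def)
  have A_add: "x + y \<in> A" if "x \<in> A" "y \<in> A" for x y using that by (rule N.subspace_add[OF A(1)])
  have A0: "0 \<in> A" by (rule N.subspace_0[OF A(1)])
  have phi0: "phi 0 = 0" using phi_add[OF A0 A0] by simp
  have finA: "finite A" using A(2) U(2) by (rule finite_subset)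
  define B where "B = phi ` A"
  have B: "subspace B"
  proof (rule subspaceI)
    show "0 \<in> B" unfolding B_def using A0 phi0 by (metis imageI)
  next
    fix x y assume "x \<in> B" "y \<in> B"
    then obtain a b where ab: "a \<in> A" "b \<in> A" "x = phi a" "y = phi b" by (auto simp: B_def)
    then have "x + y = phi (a + b)" using phi_add by simp
    then show "x + y \<in> B" unfolding B_def using A_add[OF ab(1,2)] by simp
  qed
  have B0: "0 \<in> B" by (rule subspace_0[OF B])
  have B_add: "x + y \<in> B" if "x \<in> B" "y \<in> B" for x y using that by (rule subspace_add[OF B])
  have BH: "B \<subseteq> H" using phi_H by (auto simp: B_def)
  have finB: "finite B" using BH H(2) by (rule finite_subset)
  have BT: "B \<inter> T = {0}"
    using phi_T phi0 B0 zero_T by (auto simp: B_def)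
  have "card B = card A" unfolding B_def by (rule card_image[OF embeds_inj[OF phi]])
  then have "(2::nat) ^ dim B = 2 ^ N.dim A"
    using card_subspace[OF B finB] N.card_subspace[OF A(1) finA] by simp
  then have "dim B = N.dim A" by simp
  moreover have "A \<subset> U" using A(2) n by blast
  then have "N.dim A < N.dim U" by (rule N.subspace_psubset_dim[OF A(1) U])
  moreover have finT: "finite T" using T(2) H(2) by (rule finite_subset)
  have "dim (sumset B T) = dim B + dim T" by (rule dim_sumset[OF B T(1) finB finT BT])
  ultimately have lt: "dim (sumset B T) < dim H" using dim_le by simp
  have "\<not> H \<subseteq> sumset B T"
  proof
    assume "H \<subseteq> sumset B T"
    then have "dim H \<le> dim (sumset B T)"
      by (rule subspace_dim_mono[OF H(1) subspace_sumset[OF B T(1)] finite_sumset[OF finB finT]])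
    then show False using lt by simp
  qed
  then obtain x0 where x0: "x0 \<in> H" "x0 \<notin> sumset B T" by blast
  have x0T: "b + x0 \<notin> T" if "b \<in> B" for b
  proof
    assume "b + x0 \<in> T"
    then have "b + (b + x0) \<in> sumset B T" by (rule sumsetI[OF that])
    then show False using x0(2) by simp
  qed
  have x0B: "x0 \<notin> B" using x0(2) sumset_superset(1)[OF B T(1)] by blast
  define psi where "psi = inv_into A phi"
  have psi: "psi (phi x) = x" if "x \<in> A" for x
    unfolding psi_def by (rule inv_into_f_f[OF embeds_inj[OF phi] that])
  \<comment> \<open>The error at \<open>b\<close> of the tentative choice of \<open>x0\<close> as
    image of \<open>n\<close>. A shift of \<open>x0\<close> by \<open>t\<close> in \<open>T\<close>
    repairs it exactly if \<open>p (b + x0) t\<close> equals \<open>L b\<close> for all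
    \<open>b\<close> in \<open>B\<close>.\<close>
  define L where "L b \<longleftrightarrow> f (b + x0) \<noteq> q (psi b + n)" for b
  have L: "L (phi x) \<longleftrightarrow> f (phi x + x0) \<noteq> q (x + n)" if "x \<in> A" for x
    unfolding L_def psi[OF that] ..
  \<comment> \<open>The plane of \<open>phi x\<close>, \<open>phi y\<close>, \<open>x0\<close> is
    even for \<open>f\<close> and that of \<open>x\<close>, \<open>y\<close>, \<open>n\<close> for
    \<open>q\<close>. On the points from \<open>A\<close> both functions agree, and the remaining
    four points give the affine relation.\<close>
  have affine: "L (phi x + phi y) \<longleftrightarrow> (L (phi x) \<noteq> L (phi y)) \<noteq> L 0" if x: "x \<in> A" and y: "y \<in> A" for x y
  proof (cases "x = 0 \<or> y = 0 \<or> x = y")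
    case True
    then show ?thesis using phi0 by auto
  next
    case False
    have nz: "x \<noteq> 0" "y \<noteq> 0" "x + y \<noteq> 0" using False by auto
    have xy: "x + y \<in> A" by (rule A_add[OF x y])
    have nA: "a + n \<noteq> 0" if "a \<in> A" for a using that n(2) by auto
    have BB: "phi x \<in> B" "phi y \<in> B" "phi x + phi y \<in> B"
      using x y B_add by (auto simp: B_def)
    have "independent_mod (phi x) (phi y) x0"
      unfolding independent_mod_def
    proof (intro conjI)
      show "phi x \<in> H" "phi y \<in> H" "x0 \<in> H" using phi_H x y x0(1) by blast+
      show "phi x \<notin> T" "phi y \<notin> T" using phi_T x y nz by blast+
      show "x0 \<notin> T" using x0T[OF B0] by simp
      show "phi x + phi y \<notin> T" unfolding phi_add[OF x y, symmetric] using phi_T[OF xy] nz(3) by blast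
      show "phi x + x0 \<notin> T" "phi y + x0 \<notin> T" "phi x + phi y + x0 \<notin> T" using x0T BB by blast+
    qed
    then have e1: "\<not> plane_parity f (phi x) (phi y) x0" by (rule plane_parity_even)
    have e2: "\<not> N.plane_parity q x y n"
      using x y n nz nA[OF x] nA[OF y] nA[OF xy] nA[OF A0] A(2) by (intro q_even) auto
    have Lxy: "L (phi x + phi y) \<longleftrightarrow> f (phi x + phi y + x0) \<noteq> q (x + y + n)"
      using L[OF xy] unfolding phi_add[OF x y] .
    have L0: "L 0 \<longleftrightarrow> f x0 \<noteq> q n" using L[OF A0] unfolding phi0 by simp
    have fxy: "f (phi x + phi y) \<longleftrightarrow> q (x + y)" using f_phi[OF xy] unfolding phi_add[OF x y] .
    show ?thesis
      unfolding Lxy L0 L[OF x] L[OF y]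
      using e1 e2 fxy f_phi[OF x] f_phi[OF y] unfolding plane_parity_def N.plane_parity_def by argo
  qed
  then have affine: "L (a + b) \<longleftrightarrow> (L a \<noteq> L b) \<noteq> L 0" if "a \<in> B" "b \<in> B" for a b
    using that by (auto simp: B_def)
  define D where "D = ext x0 B"
  have D: "subspace D" unfolding D_def by (rule subspace_ext[OF B])
  have DH: "D \<subseteq> H" unfolding D_def by (rule ext_subset[OF H(1) BH x0(1)])
  have finD: "finite D" using DH H(2) by (rule finite_subset)
  have D_mem: "a \<in> D \<longleftrightarrow> a \<in> B \<or> x0 + a \<in> B" for a by (simp add: D_def mem_ext)
  have D_T: "a \<notin> T" if "a \<in> D" "a \<noteq> 0" for a
  proof (cases "a \<in> B")
    case True
    then show ?thesis using that(2) BT by blast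
  next
    case False
    then have "x0 + a \<in> B" using that(1) D_mem by blast
    then have "x0 + a + x0 \<notin> T" by (rule x0T)
    then show ?thesis by (simp add: ac_simps)
  qed
  \<comment> \<open>The linear functional on \<open>D\<close> that restricts to \<open>L\<close> on
    the coset \<open>x0 + B\<close>. On \<open>B\<close> it has to be the linear part of
    \<open>L\<close>.\<close>
  define mu where "mu a \<longleftrightarrow> (if a \<in> B then L a \<noteq> L 0 else L (x0 + a))" for a
  have mu_in: "mu a \<longleftrightarrow> L a \<noteq> L 0" if "a \<in> B" for a using that by (simp add: mu_def)
  have mu_out: "mu (x0 + a) \<longleftrightarrow> L a" if "a \<in> B" for a
  proof -
    have "x0 + a \<notin> B" using subspace_add_iff(2)[OF B that] x0B by blast
    then show ?thesis by (simp add: mu_def)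
  qed
  have D_cases: "a \<in> B \<or> (\<exists>b\<in>B. a = x0 + b)" if "a \<in> D" for a
    using that D_mem by (metis add_left_self)
  have mu: "additive_on D mu"
    unfolding additive_on_def
  proof (intro ballI)
    fix a b assume ab: "a \<in> D" "b \<in> D"
    consider "a \<in> B" "b \<in> B" | b' where "a \<in> B" "b' \<in> B" "b = x0 + b'"
      | a' where "a' \<in> B" "a = x0 + a'" "b \<in> B" | a' b' where "a' \<in> B" "b' \<in> B" "a = x0 + a'" "b = x0 + b'"
      using D_cases[OF ab(1)] D_cases[OF ab(2)] by blast
    then show "mu (a + b) \<longleftrightarrow> mu a \<noteq> mu b"
    proof cases
      case 1
      show ?thesis unfolding mu_in[OF 1(1)] mu_in[OF 1(2)] mu_in[OF B_add[OF 1]] affine[OF 1] by argo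
    next
      case 2
      have "mu (a + b) \<longleftrightarrow> L (a + b')" "mu b \<longleftrightarrow> L b'"
        using mu_out[OF B_add[OF 2(1,2)]] mu_out[OF 2(2)] 2(3) by (simp_all add: ac_simps)
      then show ?thesis using mu_in[OF 2(1)] affine[OF 2(1,2)] by argo
    next
      case 3
      have "mu (a + b) \<longleftrightarrow> L (a' + b)" "mu a \<longleftrightarrow> L a'"
        using mu_out[OF B_add[OF 3(1,3)]] mu_out[OF 3(1)] 3(2) by (simp_all add: ac_simps)
      then show ?thesis using mu_in[OF 3(3)] affine[OF 3(1,3)] by argo
    next
      case 4
      have eq: "a + b = a' + b'" using 4(3,4) by (simp add: ac_simps)
      have "mu (a + b) \<longleftrightarrow> L (a' + b') \<noteq> L 0" unfolding eq by (rule mu_in[OF B_add[OF 4(1,2)]])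
      moreover have "mu a \<longleftrightarrow> L a'" "mu b \<longleftrightarrow> L b'"
        using mu_out[OF 4(1)] mu_out[OF 4(2)] 4(3,4) by simp_all
      ultimately show ?thesis using affine[OF 4(1,2)] by argo
    qed
  qed
  have "\<exists>t\<in>T. \<forall>a\<in>D. p a t \<longleftrightarrow> mu a"
  proof (rule functional_represented[OF D finD T(1) finT _ _ _ mu])
    show "additive_on D (\<lambda>a. p a t)" if "t \<in> T" for t
      using left[OF that] DH unfolding additive_on_def by blast
    show "additive_on T (p a)" if "a \<in> D" for a
      using DH that by (intro right) blast
    show "\<exists>t\<in>T. p a t" if "a \<in> D" "a \<noteq> 0" for a
      by (rule nondegenerate[OF subsetD[OF DH that(1)] D_T[OF that]])
  qed
  then obtain t where t: "t \<in> T" "\<And>a. a \<in> D \<Longrightarrow> p a t \<longleftrightarrow> mu a" by blast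
  have tH: "t \<in> H" using t(1) T(2) by blast
  define phi' where "phi' z = (if z \<in> A then phi z else phi (n + z) + (x0 + t))" for z
  have phi'_in: "phi' z = phi z" if "z \<in> A" for z using that by (simp add: phi'_def)
  have phi'_out: "phi' (n + z) = phi z + (x0 + t)" if "z \<in> A" for z
  proof -
    have "n + z \<notin> A" using N.subspace_add_iff(2)[OF A(1) that] n(2) by blast
    then show ?thesis by (simp add: phi'_def)
  qed
  have ext_cases: "z \<in> A \<or> (\<exists>y\<in>A. z = n + y)" if "z \<in> N.ext n A" for z
  proof (cases "z \<in> A")
    case False
    then have "n + z \<in> A" using that by (simp add: N.mem_ext)
    moreover have "z = n + (n + z)" by simp
    ultimately show ?thesis by blast
  qed simp
  have out: "phi y + (x0 + t) \<in> H" "phi y + (x0 + t) \<notin> T" "f (phi y + (x0 + t)) \<longleftrightarrow> q (n + y)" if y: "y \<in> A" for y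
  proof -
    have b: "phi y \<in> B" using y by (simp add: B_def)
    have bx: "phi y + x0 \<in> H" by (rule H_add[OF phi_H[OF y] x0(1)])
    have eq: "phi y + (x0 + t) = phi y + x0 + t" by (simp add: add.assoc)
    show "phi y + (x0 + t) \<in> H" unfolding eq by (rule H_add[OF bx tH])
    show "phi y + (x0 + t) \<notin> T" unfolding eq using not_T_shift(1)[OF t(1)] x0T[OF b] by blast
    have "phi y + x0 \<in> D" using b by (simp add: D_mem ac_simps)
    then have "p (phi y + x0) t \<longleftrightarrow> mu (x0 + phi y)" using t(2) by (simp add: add.commute)
    then have "p (phi y + x0) t \<longleftrightarrow> f (phi y + x0) \<noteq> q (y + n)"
      unfolding mu_out[OF b] L[OF y] .
    then have "f (phi y + (x0 + t)) \<longleftrightarrow> q (y + n)"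
      unfolding eq f_shift[OF bx t(1)] by argo
    then show "f (phi y + (x0 + t)) \<longleftrightarrow> q (n + y)" by (simp add: add.commute)
  qed
  have "embeds (N.ext n A) phi'"
    unfolding embeds_def
  proof (intro conjI ballI impI subsetI)
    show "N.subspace (N.ext n A)" by (rule N.subspace_ext[OF A(1)])
    show "z \<in> U" if "z \<in> N.ext n A" for z using N.ext_subset[OF U(1) A(2) n(1)] that by blast
  next
    fix x y assume xy: "x \<in> N.ext n A" "y \<in> N.ext n A"
    consider "x \<in> A" "y \<in> A" | y' where "x \<in> A" "y' \<in> A" "y = n + y'"
      | x' where "x' \<in> A" "x = n + x'" "y \<in> A" | x' y' where "x' \<in> A" "y' \<in> A" "x = n + x'" "y = n + y'"
      using ext_cases[OF xy(1)] ext_cases[OF xy(2)] by blast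
    then show "phi' (x + y) = phi' x + phi' y"
    proof cases
      case 1
      show ?thesis unfolding phi'_in[OF 1(1)] phi'_in[OF 1(2)] phi'_in[OF A_add[OF 1]] by (rule phi_add[OF 1])
    next
      case 2
      have eq: "x + y = n + (x + y')" using 2(3) by (simp add: ac_simps)
      have "phi' (x + y) = phi (x + y') + (x0 + t)"
        unfolding eq by (rule phi'_out[OF A_add[OF 2(1,2)]])
      moreover have "phi' y = phi y' + (x0 + t)" unfolding 2(3) by (rule phi'_out[OF 2(2)])
      ultimately show ?thesis using phi'_in[OF 2(1)] phi_add[OF 2(1,2)] by (simp add: ac_simps)
    next
      case 3
      have eq: "x + y = n + (x' + y)" using 3(2) by (simp add: ac_simps)
      have "phi' (x + y) = phi (x' + y) + (x0 + t)"
        unfolding eq by (rule phi'_out[OF A_add[OF 3(1,3)]])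
      moreover have "phi' x = phi x' + (x0 + t)" unfolding 3(2) by (rule phi'_out[OF 3(1)])
      ultimately show ?thesis using phi'_in[OF 3(3)] phi_add[OF 3(1,3)] by (simp add: ac_simps)
    next
      case 4
      have eq: "x + y = x' + y'" using 4(3,4) by (simp add: ac_simps)
      have "phi' (x + y) = phi (x' + y')"
        unfolding eq by (rule phi'_in[OF A_add[OF 4(1,2)]])
      moreover have "phi' x = phi x' + (x0 + t)" unfolding 4(3) by (rule phi'_out[OF 4(1)])
      moreover have "phi' y = phi y' + (x0 + t)" unfolding 4(4) by (rule phi'_out[OF 4(2)])
      ultimately show ?thesis using phi_add[OF 4(1,2)] by (simp add: ac_simps)
    qed
  next
    fix x assume "x \<in> phi' ` N.ext n A"
    then obtain z where z: "z \<in> N.ext n A" "x = phi' z" by blast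
    then show "x \<in> H" using ext_cases[OF z(1)] phi'_in phi'_out phi_H out(1) by auto
  next
    fix z assume "z \<in> N.ext n A" "phi' z \<in> T"
    then show "z = 0" using ext_cases[of z] phi'_in phi'_out phi_T out(2) by auto
  next
    fix z assume "z \<in> N.ext n A"
    then show "f (phi' z) \<longleftrightarrow> q z" using ext_cases[of z] phi'_in phi'_out f_phi out(3) by auto
  qed
  then show ?thesis by blast
qed

theorem embedding_exists: "\<exists>phi. embeds U phi"
proof -
  define Q where "Q A \<longleftrightarrow> (\<exists>phi. embeds A phi)" for A
  have "N.subspace {0}" by (simp add: N.subspace_iff)
  then have "embeds {0} (\<lambda>_. 0)"
    using N.subspace_0[OF U(1)] zero_H f_zero q_zero by (simp add: embeds_def)
  then have "Q {0}" unfolding Q_def by blast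
  moreover have "finite {A. Q A}"
    using U(2) by (rule finite_subset[rotated, OF finite_Pow_iff[THEN iffD2]]) (auto simp: Q_def embeds_def)
  ultimately obtain A where A: "Q A" and max: "\<And>B. Q B \<Longrightarrow> A \<subseteq> B \<Longrightarrow> B = A"
    using finite_has_maximal[of "{A. Q A}"] by auto
  obtain phi where phi: "embeds A phi" using A by (auto simp: Q_def)
  have sA: "N.subspace A" "A \<subseteq> U" using phi by (simp_all add: embeds_def)
  have "U \<subseteq> A"
  proof
    fix n assume n: "n \<in> U"
    show "n \<in> A"
    proof (rule ccontr)
      assume nA: "n \<notin> A"
      have "Q (N.ext n A)" unfolding Q_def by (rule embeds_extend[OF phi n nA])
      then have "N.ext n A = A" by (rule max) (simp add: N.ext_def)
      then show False using N.self_in_ext[OF sA(1), of n] nA by simp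
    qed
  qed
  then have "A = U" using sA(2) by blast
  then show ?thesis using phi by blast
qed

end

section \<open>The main theorem\<close>

context claw_free_config
begin

text \<open>\<open>K h\<close> is the kernel of a nonzero functional on \<open>T\<close>, since it
  has index two there. Additivity in \<open>h\<close> is the trisection: every \<open>t\<close> in
  \<open>T\<close> lies outside an even number of \<open>K x\<close>, \<open>K y\<close> and
  \<open>K (x + y)\<close>. As \<open>E\<close> meets \<open>h + T\<close> in a coset of
  \<open>K h\<close>, a shift by \<open>t\<close> changes membership exactly if \<open>t\<close> is
  outside \<open>K h\<close>.\<close>

lemma quadratic_config_lift:
  assumes C: "subspace C" "S \<subseteq> C" "C \<subseteq> V" and T: "subspace T" "T \<subseteq> S"
    and index: "\<And>x. x \<in> C \<Longrightarrow> x \<notin> S \<Longrightarrow> index_two (K x) T"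
    and tri: "\<And>x y. x \<in> C \<Longrightarrow> y \<in> C \<Longrightarrow> x \<notin> S \<Longrightarrow> y \<notin> S \<Longrightarrow> x + y \<notin> S \<Longrightarrow>
      trisection (K x) (K y) (K (x + y))"
  shows "quadratic_config scale (lift C T) T (\<lambda>h t. h \<notin> T \<and> t \<notin> K h) (\<lambda>h. h \<in> E)"
proof -
  have KT: "K x \<subseteq> T" if "x \<in> C" "x \<notin> S" for x
    using index[OF that] by (simp add: index_two_def psubset_imp_subset)
  have out: "h \<in> C" "h \<notin> S" if "h \<in> lift C T" "h \<notin> T" for h
    using lift_outside[OF that] by blast+
  have TS: "t \<in> S" if "t \<in> T" for t using that T(2) by blast
  have T_add: "s + t \<in> T" if "s \<in> T" "t \<in> T" for s t using that by (rule subspace_add[OF T(1)])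
  have K_add: "s + t \<in> K h \<longleftrightarrow> (s \<in> K h \<longleftrightarrow> t \<in> K h)" if "h \<in> lift C T" "h \<notin> T" "s \<in> T" "t \<in> T" for h s t
    by (rule index_two_add_iff[OF index[OF out[OF that(1,2)]] subspace_K that(3,4)])
  have sH: "subspace (lift C T)" by (rule subspace_lift[OF C T KT])
  have lift_S: "h \<in> T" if "h \<in> lift C T" "h \<in> S" for h using lift_int_S[OF T(2)] that by blast
  show ?thesis
  proof
    show "subspace (lift C T)" by (rule sH)
    show "finite (lift C T)" by (rule finite_lift[OF C T KT])
    show "subspace T" by (rule T(1))
    show "T \<subseteq> lift C T" by (rule lift_superset)
    show "0 \<notin> E" by (rule zero_not_E)
  next
    fix t assume t: "t \<in> T"
    show "additive_on (lift C T) (\<lambda>h. h \<notin> T \<and> t \<notin> K h)"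
      unfolding additive_on_def
    proof (intro ballI)
      fix x y assume x: "x \<in> lift C T" and y: "y \<in> lift C T"
      have xy: "x + y \<in> lift C T" by (rule subspace_add[OF sH x y])
      consider "x \<in> T" | "y \<in> T" | "x \<notin> T" "y \<notin> T" "x + y \<in> T" | "x \<notin> T" "y \<notin> T" "x + y \<notin> T" by blast
      then show "(x + y \<notin> T \<and> t \<notin> K (x + y)) \<longleftrightarrow> (x \<notin> T \<and> t \<notin> K x) \<noteq> (y \<notin> T \<and> t \<notin> K y)"
      proof cases
        case 1
        then show ?thesis
          using subspace_add_iff(1)[OF T(1) 1, of y] K_shift_left[OF TS[OF 1], of y] by simp
      next
        case 2
        then show ?thesis
          using subspace_add_iff(2)[OF T(1) 2, of x] K_shift[OF TS[OF 2], of x] by simp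
      next
        case 3
        then show ?thesis using K_eq_if_coset[OF TS[OF 3(3)]] by simp
      next
        case 4
        note xC = out[OF x 4(1)] and yC = out[OF y 4(2)] and xyC = out[OF xy 4(3)]
        have tr: "trisection (K x) (K y) (K (x + y))" by (rule tri[OF xC(1) yC(1) xC(2) yC(2) xyC(2)])
        have "t \<in> K (x + y) \<longleftrightarrow> (t \<in> K x \<longleftrightarrow> t \<in> K y)"
        proof (cases "t \<in> K x \<or> t \<in> K y")
          case True
          then show ?thesis using trisectionD(1,2)[OF tr] by blast
        next
          case False
          \<comment> \<open>Like \<open>t\<close>, the element \<open>p + q\<close> of
            \<open>T\<close> lies outside both \<open>K x\<close> and \<open>K y\<close>, so their
            sum lies in the common intersection.\<close>
          obtain p q where pq: "p \<in> K x" "p \<notin> K y" "q \<in> K y" "q \<notin> K x" "p + q \<in> K (x + y)"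
            by (rule trisection_obtain[OF tr])
          have pqT: "p \<in> T" "q \<in> T" using pq(1,3) KT[OF xC] KT[OF yC] by blast+
          have "p + q \<notin> K x" "p + q \<notin> K y"
            using K_add[OF x 4(1) pqT] K_add[OF y 4(2) pqT] pq by simp_all
          then have "t + (p + q) \<in> K x" "t + (p + q) \<in> K y"
            using K_add[OF x 4(1) t T_add[OF pqT]] K_add[OF y 4(2) t T_add[OF pqT]] False by simp_all
          then have "t + (p + q) \<in> K (x + y)" using trisectionD(1)[OF tr] by blast
          then have "t \<in> K (x + y)" using subspace_add_iff(2)[OF subspace_K pq(5)] by blast
          then show ?thesis using False by blast
        qed
        then show ?thesis using 4 by blast
      qed
    qed
  next
    fix h assume h: "h \<in> lift C T"
    show "additive_on T (\<lambda>t. h \<notin> T \<and> t \<notin> K h)"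
      unfolding additive_on_def using K_add[OF h] by blast
    show "\<exists>t\<in>T. h \<notin> T \<and> t \<notin> K h" if "h \<notin> T"
    proof -
      have "K h \<subset> T" using index[OF out[OF h that]] by (simp add: index_two_def)
      then show ?thesis using that by blast
    qed
    fix t assume t: "t \<in> T"
    show "h + t \<in> E \<longleftrightarrow> (h \<in> E) \<noteq> (h \<notin> T \<and> t \<notin> K h)"
    proof (cases "h \<in> T")
      case True
      then have "h \<notin> E" "h + t \<notin> E" using TS T_add[OF True t] E_notin_S by blast+
      then show ?thesis using True by simp
    next
      case False
      obtain u where u: "u \<in> T" "h + u \<in> E" using lift_outside[OF h False] by blast
      have Ku: "K (h + u) = K h" by (rule K_shift[OF TS[OF u(1)]])
      have "u \<in> K h \<longleftrightarrow> h \<in> E"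
        using K_iff[OF u(2), of u] TS[OF u(1)] unfolding Ku by (simp add: add.assoc)
      moreover have "u + t \<in> K h \<longleftrightarrow> h + t \<in> E"
        using K_iff[OF u(2), of "u + t"] TS[OF T_add[OF u(1) t]] unfolding Ku by (simp add: add.assoc)
      ultimately show ?thesis using K_add[OF h False u(1) t] False by blast
    qed
  next
    fix x y z assume *: "x + y \<notin> T" "x + z \<notin> T" "y + z \<notin> T" "x + y + z \<notin> T" "x \<in> E" "y \<in> E" "z \<in> E"
      "x + y \<notin> E" "x + z \<notin> E" "y + z \<notin> E"
    have zero: "0 \<in> T" by (rule subspace_0[OF T(1)])
    have "x \<noteq> y" "z \<noteq> x" "z \<noteq> y" "z \<noteq> x + y" using *(1-4) zero by auto
    then show "x + y + z \<in> E" using claw[OF *(5-7)] *(8-10) by blast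
  qed
qed

end

context binary_space
begin

section \<open>Planes, claws and flats in terms of matroids\<close>

lemma plane_elements:
  "ext z (ext y (ext x {0})) = insert 0 {x, y, x + y, z, x + z, y + z, x + y + z}"
  by (auto simp: ext_def ac_simps)

lemma plane_elements_distinct:
  fixes x y z :: 'a
  assumes nz: "x \<noteq> 0" "y \<noteq> 0" "z \<noteq> 0" "x + y \<noteq> 0" "x + z \<noteq> 0" "y + z \<noteq> 0" "x + y + z \<noteq> 0"
  shows "distinct [x, y, x + y, z, x + z, y + z, x + y + z]"
proof -
  have ne: "a \<noteq> b" if "a + b = c" "c \<noteq> 0" for a b c :: 'a using that by auto
  have n1: "x \<notin> {y, x + y, z, x + z, y + z, x + y + z}"
    using nz ne[of "x" "y" "x + y"] ne[of "x" "x + y" "y"] ne[of "x" "z" "x + z"] ne[of "x" "x + z" "z"] ne[of "x" "y + z" "x + y + z"] ne[of "x" "x + y + z" "y + z"] by (simp add: ac_simps)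
  have n2: "y \<notin> {x + y, z, x + z, y + z, x + y + z}"
    using nz ne[of "y" "x + y" "x"] ne[of "y" "z" "y + z"] ne[of "y" "x + z" "x + y + z"] ne[of "y" "y + z" "z"] ne[of "y" "x + y + z" "x + z"] by (simp add: ac_simps)
  have n3: "x + y \<notin> {z, x + z, y + z, x + y + z}"
    using nz ne[of "x + y" "z" "x + y + z"] ne[of "x + y" "x + z" "y + z"] ne[of "x + y" "y + z" "x + z"] ne[of "x + y" "x + y + z" "z"] by (simp add: ac_simps)
  have n4: "z \<notin> {x + z, y + z, x + y + z}"
    using nz ne[of "z" "x + z" "x"] ne[of "z" "y + z" "y"] ne[of "z" "x + y + z" "x + y"] by (simp add: ac_simps)
  have n5: "x + z \<notin> {y + z, x + y + z}"
    using nz ne[of "x + z" "y + z" "x + y"] ne[of "x + z" "x + y + z" "y"] by (simp add: ac_simps)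
  have n6: "y + z \<notin> {x + y + z}"
    using nz ne[of "y + z" "x + y + z" "x"] by (simp add: ac_simps)
  show ?thesis using n1 n2 n3 n4 n5 n6 by simp
qed

lemma plane_dim:
  assumes nz: "x \<noteq> 0" "y \<noteq> 0" "z \<noteq> 0" "x + y \<noteq> 0" "x + z \<noteq> 0" "y + z \<noteq> 0" "x + y + z \<noteq> 0"
  shows "subspace (ext z (ext y (ext x {0})))" "dim (ext z (ext y (ext x {0}))) = 3"
    "independent {z, y, x}" "span {z, y, x} = ext z (ext y (ext x {0}))"
proof -
  have s0: "subspace {0}" by (simp add: subspace_iff)
  have s1: "subspace (ext x {0})" "finite (ext x {0})" by (rule subspace_ext[OF s0]) (simp add: ext_def)
  have s2: "subspace (ext y (ext x {0}))" "finite (ext y (ext x {0}))"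
    by (rule subspace_ext[OF s1(1)]) (use s1(2) in \<open>simp add: ext_def\<close>)
  have n: "x \<notin> {0}" "y \<notin> ext x {0}" "z \<notin> ext y (ext x {0})"
    using nz by (auto simp: mem_ext add.assoc)
  show "subspace (ext z (ext y (ext x {0})))" by (rule subspace_ext[OF s2(1)])
  show "dim (ext z (ext y (ext x {0}))) = 3"
    using dim_ext[OF s2 n(3)] dim_ext[OF s1 n(2)] dim_ext[OF s0 _ n(1)]
      dim_le_card[of "{0}" "{}"] by simp
  show sp: "span {z, y, x} = ext z (ext y (ext x {0}))"
    by (simp add: span_insert_eq_ext)
  show "independent {z, y, x}"
    using n by (simp add: independent_insert span_insert_eq_ext)
qed

lemma is_matroidD:
  assumes "is_matroid N"
  shows "subspace (insert 0 (geom N))" "finite (insert 0 (geom N))" "ground N \<subseteq> geom N" "0 \<notin> geom N"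
proof -
  obtain B where "finite B" "insert 0 (geom N) = span B" using assms by (auto simp: is_matroid_def)
  then show "subspace (insert 0 (geom N))" "finite (insert 0 (geom N))" by (simp, simp only: finite_span)
qed (use assms in \<open>simp_all add: is_matroid_def\<close>)

lemma odd_card_insert:
  assumes "finite A" "a \<notin> A"
  shows "odd (card (X \<inter> insert a A)) \<longleftrightarrow> (a \<in> X) \<noteq> odd (card (X \<inter> A))"
  using assms by (cases "a \<in> X") simp_all

text \<open>The three vectors are independent, so the seven points listed are distinct and form a
  plane; the parity of its intersection with the ground set is an iterated exclusive or.\<close>

lemma even_plane_parity:
  assumes N: "is_matroid N" "even_plane N"
    and U: "x \<in> insert 0 (geom N)" "y \<in> insert 0 (geom N)" "z \<in> insert 0 (geom N)"
    and nz: "x \<noteq> 0" "y \<noteq> 0" "z \<noteq> 0" "x + y \<noteq> 0" "x + z \<noteq> 0" "y + z \<noteq> 0" "x + y + z \<noteq> 0"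
  shows "\<not> plane_parity (\<lambda>v. v \<in> ground N) x y z"
proof -
  define P where "P = {x, y, x + y, z, x + z, y + z, x + y + z}"
  note M = is_matroidD[OF N(1)]
  have P0: "insert 0 P = ext z (ext y (ext x {0}))" unfolding P_def by (rule plane_elements[symmetric])
  have "ext z (ext y (ext x {0})) \<subseteq> insert 0 (geom N)"
    using U by (intro ext_subset[OF M(1)]) simp_all
  moreover have "0 \<notin> P" using nz by (auto simp: P_def)
  ultimately have "P \<subseteq> geom N" unfolding P0[symmetric] by blast
  then have "flat_of (geom N) P" "flat_dim P = 3"
    unfolding flat_of_def flat_dim_def P0 using plane_dim(1,2)[OF nz] by simp_all
  then have even: "even (card (ground N \<inter> P))" using N(2) by (simp add: even_plane_def)
  have d: "distinct [x, y, x + y, z, x + z, y + z, x + y + z]" by (rule plane_elements_distinct[OF nz])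
  have "odd (card (ground N \<inter> P)) \<longleftrightarrow> plane_parity (\<lambda>v. v \<in> ground N) x y z"
    unfolding P_def plane_parity_def
    by (subst odd_card_insert, simp, use d in \<open>simp del: add_cancel_left_right\<close>)+ simp
  then show ?thesis using even by simp
qed

text \<open>If all four sums were missing, the restriction to the plane through \<open>x\<close>,
  \<open>y\<close>, \<open>z\<close> would itself be a claw, with the identity as
  isomorphism.\<close>

lemma claw_condition:
  assumes M: "is_matroid M" "claw_free M"
    and xyz: "x \<in> ground M" "y \<in> ground M" "z \<in> ground M"
    and ne: "x \<noteq> y" "z \<noteq> x" "z \<noteq> y" "z \<noteq> x + y"
  shows "x + y \<in> ground M \<or> x + z \<in> ground M \<or> y + z \<in> ground M \<or> x + y + z \<in> ground M"
proof (rule ccontr)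
  assume no: "\<not> ?thesis"
  note D = is_matroidD[OF M(1)]
  have nz: "x \<noteq> 0" "y \<noteq> 0" "z \<noteq> 0" using xyz D(3,4) by auto
  have nz': "x + y \<noteq> 0" "x + z \<noteq> 0" "y + z \<noteq> 0" "x + y + z \<noteq> 0"
    using ne by auto
  define P where "P = {x, y, x + y, z, x + z, y + z, x + y + z}"
  have P0: "insert 0 P = ext z (ext y (ext x {0}))" unfolding P_def by (rule plane_elements[symmetric])
  have zero: "0 \<notin> P" using nz nz' by (auto simp: P_def)
  have "ext z (ext y (ext x {0})) \<subseteq> insert 0 (geom M)"
    using xyz D(3) by (intro ext_subset[OF D(1)]) auto
  then have "P \<subseteq> geom M" unfolding P0[symmetric] using zero by blast
  note pl = plane_dim[OF nz nz']
  have flat: "flat_of (geom M) P"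
    unfolding flat_of_def P0 using \<open>P \<subseteq> geom M\<close> pl(1) by simp
  define C where "C = \<lparr>ground = {z, y, x}, geom = P\<rparr>"
  have "is_matroid C"
    unfolding is_matroid_def C_def using zero P0 pl(4) by (auto simp: P_def intro!: exI[of _ "{z, y, x}"])
  then have "is_claw C"
    unfolding is_claw_def mdim_def flat_dim_def using pl P0 by (simp add: C_def)
  then have "free_of scale scale M C" using M(2) by (simp add: claw_free_def)
  moreover have "ground M \<inter> P = {z, y, x}" using xyz no by (auto simp: P_def)
  then have "restriction M P = C" by (simp add: restriction_def C_def)
  then have "isomorphic scale scale (restriction M P) C"
    unfolding isomorphic_def by (intro exI[of _ id]) simp
  ultimately show False using flat unfolding free_of_def by blast
qed

lemma finite_flats:
  assumes "is_matroid M"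
  shows "finite {flat_dim F |F. flat_of (geom M) F \<and> F \<subseteq> X}"
proof -
  have "finite (geom M)" using is_matroidD(2)[OF assms] by simp
  then have "finite (Pow (geom M))" by simp
  then have "finite {F. flat_of (geom M) F \<and> F \<subseteq> X}"
    by (rule finite_subset[rotated]) (auto simp: flat_of_def)
  then have "finite (flat_dim ` {F. flat_of (geom M) F \<and> F \<subseteq> X})" by (rule finite_imageI)
  then show ?thesis by (rule finite_subset[rotated]) auto
qed

lemma flat_of_remove_zero:
  assumes "subspace W" "W - {0} \<subseteq> geom M"
  shows "flat_of (geom M) (W - {0})" "flat_dim (W - {0}) = dim W"
proof -
  have "insert 0 (W - {0}) = W" using subspace_0[OF assms(1)] by blast
  then show "flat_of (geom M) (W - {0})" "flat_dim (W - {0}) = dim W"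
    using assms by (simp_all add: flat_of_def flat_dim_def)
qed

lemma dim_le_omega:
  assumes "is_matroid M" "subspace W" "W - {0} \<subseteq> ground M"
  shows "dim W \<le> omega M"
proof -
  have "W - {0} \<subseteq> geom M" using assms(3) is_matroidD(3)[OF assms(1)] by blast
  note W = flat_of_remove_zero[OF assms(2) this]
  have "dim W \<in> {flat_dim F |F. flat_of (geom M) F \<and> F \<subseteq> ground M}"
    unfolding W(2)[symmetric] using W(1) assms(3) by blast
  then show ?thesis unfolding omega_def by (rule Max_ge[OF finite_flats[OF assms(1)]])
qed

lemma omega_attained:
  assumes "is_matroid M"
  obtains W where "subspace W" "W - {0} \<subseteq> ground M" "dim W = omega M"
proof -
  let ?D = "{flat_dim F |F. flat_of (geom M) F \<and> F \<subseteq> ground M}"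
  have "subspace {0}" by (simp add: subspace_iff)
  then have "flat_of (geom M) {}" by (simp add: flat_of_def)
  then have "?D \<noteq> {}" by blast
  then have "omega M \<in> ?D" unfolding omega_def by (rule Max_in[OF finite_flats[OF assms]])
  then obtain F where F: "omega M = flat_dim F" "flat_of (geom M) F" "F \<subseteq> ground M" by blast
  then show ?thesis
    by (intro that[of "insert 0 F"]) (auto simp: flat_of_def flat_dim_def)
qed

lemma is_matroid_complement: "is_matroid M \<Longrightarrow> is_matroid (complement M)"
  unfolding is_matroid_def complement_def by auto

end

theorem theorem7p5:
  fixes s :: "bit \<Rightarrow> 'a::ab_group_add \<Rightarrow> 'a"
    and t :: "bit \<Rightarrow> 'b::ab_group_add \<Rightarrow> 'b"
    and M :: "'a matroid"
    and N :: "'b matroid"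
    and f :: "nat \<Rightarrow> nat"
  assumes "binary_space s" and "binary_space t"
    and "binary_space.is_matroid t N" and "binary_space.even_plane t N"
    and "\<And>k. f k = (k + 2) * 2 ^ (k + 1) + k * (binary_space.mdim t N + 4)"
    and "binary_space.is_matroid s M" and "binary_space.claw_free s M" and "free_of s t M N"
  shows "binary_space.chi s M \<le> f (binary_space.omega s M)"
proof -
  interpret M: binary_space s by fact
  interpret N: binary_space t by fact
  note MD = M.is_matroidD[OF assms(6)]
  note ND = N.is_matroidD[OF assms(3)]
  define V where "V = insert 0 (geom M)"
  define U where "U = insert 0 (geom N)"
  define E where "E = ground M"
  define d where "d = N.mdim N"
  note mc = M.is_matroid_complement[OF assms(6)]
  \<comment> \<open>The dimension of this \<open>S\<close> is the number subtracted in
    \<open>chi\<close>. Being largest, \<open>S\<close> is also maximal under inclusion, which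
    \<open>claw_free_config\<close> asks for.\<close>
  obtain S where S: "M.subspace S" "S - {0} \<subseteq> ground (complement M)" "M.dim S = M.omega (complement M)"
    by (rule M.omega_attained[OF mc])
  note S_dim = S(3)
  have SE: "S \<inter> E = {}" and SV: "S \<subseteq> V"
    using S(2) MD(3,4) by (auto simp: complement_def E_def V_def)
  have EV: "E \<subseteq> V" using MD(3) by (auto simp: E_def V_def)
  have V: "M.subspace V" "finite V" using MD(1,2) by (simp_all add: V_def)
  have finS: "finite S" using SV V(2) by (rule finite_subset)
  have max: "\<exists>u\<in>S. x + u \<in> E" if x: "x \<in> V" "x \<notin> S" for x
  proof (rule ccontr)
    assume "\<not> ?thesis"
    then have "M.ext x S \<inter> E = {}" using SE by (auto simp: M.ext_def)
    moreover have "M.ext x S \<subseteq> V" by (rule M.ext_subset[OF V(1) SV x(1)])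
    ultimately have "M.ext x S - {0} \<subseteq> ground (complement M)"
      by (auto simp: complement_def E_def V_def)
    then have "M.dim (M.ext x S) \<le> M.omega (complement M)"
      by (rule M.dim_le_omega[OF mc M.subspace_ext[OF S(1)]])
    then show False using M.dim_ext[OF S(1) finS x(2)] S(3) by simp
  qed
  interpret claw_free_config s V E S
  proof
    fix x y z assume "x \<in> E" "y \<in> E" "z \<in> E" "x \<noteq> y" "z \<noteq> x" "z \<noteq> y" "z \<noteq> x + y"
    then show "x + y \<in> E \<or> x + z \<in> E \<or> y + z \<in> E \<or> x + y + z \<in> E"
      unfolding E_def by (rule M.claw_condition[OF assms(6,7)])
  qed (use V EV S(1) SV SE max in blast)+
  have "M.dim V \<le> M.dim S + level_bound d (M.omega M)"
  proof (rule dim_V_le)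
    fix W assume "eflat W"
    then have "M.subspace W" "W - {0} \<subseteq> ground M" by (simp_all add: eflat_def) (simp add: E_def)
    then show "M.dim W \<le> M.omega M" by (rule M.dim_le_omega[OF assms(6)])
  next
    fix C T assume C: "M.subspace C" "S \<subseteq> C" "C \<subseteq> V" and T: "M.subspace T" "T \<subseteq> S"
      and index: "\<And>x. x \<in> C \<Longrightarrow> x \<notin> S \<Longrightarrow> index_two (K x) T"
      and tri: "\<And>x y. x \<in> C \<Longrightarrow> y \<in> C \<Longrightarrow> x \<notin> S \<Longrightarrow> y \<notin> S \<Longrightarrow> x + y \<notin> S \<Longrightarrow>
        trisection (K x) (K y) (K (x + y))"
    have KT: "K x \<subseteq> T" if "x \<in> C" "x \<notin> S" for x
      using index[OF that] by (simp add: index_two_def psubset_imp_subset)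
    have lift_C: "lift C T \<subseteq> C" by (rule lift_subset[OF order_trans[OF T(2) C(2)]])
    show "M.dim C \<le> M.dim S + d"
    proof (rule ccontr)
      assume "\<not> M.dim C \<le> M.dim S + d"
      \<comment> \<open>The dimension of the lift modulo \<open>T\<close> is that of
        \<open>C\<close> modulo \<open>S\<close>, which exceeds dim(N). This is the room that the
        embedding of \<open>N\<close> requires.\<close>
      then have big: "M.dim T + N.dim U \<le> M.dim (lift C T)"
        using dim_lift[OF C T KT] by (simp add: d_def N.mdim_def N.flat_dim_def U_def)
      interpret quadratic_config s "lift C T" T "\<lambda>h t. h \<notin> T \<and> t \<notin> K h" "\<lambda>h. h \<in> E"
        by (rule quadratic_config_lift[OF C T index tri])
      interpret embedding_config s "lift C T" T "\<lambda>h t. h \<notin> T \<and> t \<notin> K h" "\<lambda>h. h \<in> E" t U "\<lambda>v. v \<in> ground N"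
      proof
        show "N.subspace U" "finite U" using ND(1,2) by (simp_all add: U_def)
        show "0 \<notin> ground N" using ND(3,4) by blast
        show "M.dim T + N.dim U \<le> M.dim (lift C T)" by (rule big)
      next
        fix x y z
        assume "x \<in> U" "y \<in> U" "z \<in> U" "x \<noteq> 0" "y \<noteq> 0" "z \<noteq> 0" "x + y \<noteq> 0" "x + z \<noteq> 0" "y + z \<noteq> 0" "x + y + z \<noteq> 0"
        then show "\<not> N.plane_parity (\<lambda>v. v \<in> ground N) x y z"
          unfolding U_def by (rule N.even_plane_parity[OF assms(3,4)])
      qed
      obtain phi where phi: "embeds U phi" using embedding_exists by blast
      have inj: "inj_on phi U" by (rule embeds_inj[OF phi])
      have add: "phi (x + y) = phi x + phi y" if "x \<in> U" "y \<in> U" for x y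
        using phi that by (simp add: embeds_def)
      have U0: "0 \<in> U" by (simp add: U_def)
      have U_add: "x + y \<in> U" if "x \<in> U" "y \<in> U" for x y
        using that unfolding U_def by (rule N.subspace_add[OF ND(1)])
      have phi0: "phi 0 = 0" using add[OF U0 U0] by simp
      define F where "F = phi ` U - {0}"
      have "0 \<in> phi ` U" using imageI[OF U0, of phi] phi0 by simp
      then have F0: "insert 0 F = phi ` U" unfolding F_def by (rule insert_Diff)
      have subU: "M.subspace (phi ` U)"
      proof (rule M.subspaceI)
        show "0 \<in> phi ` U" by fact
      next
        fix x y assume "x \<in> phi ` U" "y \<in> phi ` U"
        then obtain a b where ab: "a \<in> U" "b \<in> U" "x = phi a" "y = phi b" by blast
        then have "x + y = phi (a + b)" using add by simp
        then show "x + y \<in> phi ` U" using imageI[OF U_add[OF ab(1,2)], of phi] by simp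
      qed
      have "phi ` U \<subseteq> lift C T" using phi by (simp add: embeds_def)
      then have "phi ` U \<subseteq> V" using lift_C C(3) by (meson order_trans)
      then have "F \<subseteq> geom M" unfolding F_def V_def by blast
      then have flat: "M.flat_of (geom M) F" unfolding M.flat_of_def F0 using subU by blast
      define psi where "psi = inv_into U phi"
      have psi: "psi (phi x) = x" if "x \<in> U" for x
        unfolding psi_def by (rule inv_into_f_f[OF inj that])
      have EN: "phi x \<in> E \<longleftrightarrow> x \<in> ground N" if "x \<in> U" for x
        using phi that by (simp add: embeds_def)
      have gU: "ground N \<subseteq> U" using ND(3) by (auto simp: U_def)
      have ground: "E \<inter> F = phi ` ground N"
      proof
        show "E \<inter> F \<subseteq> phi ` ground N" unfolding F_def using EN by blast
        show "phi ` ground N \<subseteq> E \<inter> F"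
        proof
          fix x assume "x \<in> phi ` ground N"
          then obtain y where y: "y \<in> ground N" "x = phi y" by blast
          then have "x \<in> E" "x \<in> phi ` U" using EN gU by auto
          moreover from this(1) have "x \<noteq> 0" using zero_not_E by blast
          ultimately show "x \<in> E \<inter> F" by (simp add: F_def)
        qed
      qed
      have "isomorphic s t (restriction M F) N"
        unfolding isomorphic_def
      proof (intro exI[of _ psi] conjI ballI allI)
        have geo: "geom (restriction M F) = F" "ground (restriction M F) = E \<inter> F"
          by (simp_all add: restriction_def E_def)
        show "bij_betw psi (insert 0 (geom (restriction M F))) (insert 0 (geom N))"
          unfolding geo F0 psi_def U_def[symmetric]
          by (rule bij_betw_inv_into) (simp add: bij_betw_def inj)
        show "psi ` ground (restriction M F) = ground N"
          unfolding geo ground image_image using psi gU by force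
        fix x assume "x \<in> insert 0 (geom (restriction M F))"
        then obtain a where a: "a \<in> U" "x = phi a" unfolding geo F0 by blast
        show "psi (s c x) = t c (psi x)" for c
          using a psi[OF a(1)] psi[OF U0] phi0 by (cases "c = 0") simp_all
        fix y assume "y \<in> insert 0 (geom (restriction M F))"
        then obtain b where b: "b \<in> U" "y = phi b" unfolding geo F0 by blast
        show "psi (x + y) = psi x + psi y"
          using psi[OF U_add[OF a(1) b(1)]] psi[OF a(1)] psi[OF b(1)] a b add[OF a(1) b(1)] by simp
      qed
      then show False using assms(8) flat unfolding free_of_def by blast
    qed
  qed
  moreover have "M.mdim M = M.dim V" by (simp add: M.mdim_def M.flat_dim_def V_def)
  ultimately have "M.chi M \<le> level_bound d (M.omega M)" using S_dim by (simp add: M.chi_def)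
  \<comment> \<open>The two sides agree unless \<open>M.omega M\<close> is 0, where they are 0 and
    4.\<close>
  also have "\<dots> \<le> f (M.omega M)" unfolding assms(5) by (simp add: level_bound_def d_def)
  finally show ?thesis .
qed

end
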